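(* Let $(M,g)$ be a Riemannian manifold with Levi-Civita connection map $C:TM\oplus TM\to TTM$, let $\mathcal{V}=\ker(\pi_M)_*\subseteq TTM$ be the vertical distribution, and let $\Psi:TTM\to\oplus^2\mathcal{V}=\mathcal{V}\oplus\mathcal{V}$ be the isomorphism of vector bundles over $TM$ given by $$\Psi\big(C(u,v)+\mathfrak{I}(u,w)\big)=\big(\mathfrak{I}(u,v),\mathfrak{I}(u,w)\big),\qquad u,v,w\in T_pM,\ p\in M.$$ Endow $TTM$ (as a vector bundle over $TM$) with the Sasaki metric $g_S$, and endow $\oplus^2\mathcal{V}$ with the Whitney sum metric $$h=(pr_2\circ\mathfrak{I}^{-1})^*g\oplus(pr_2\circ\mathfrak{I}^{-1})^*g .$$ Then $\Psi$ is a bundle isometry.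
   Context: Notation: $\pi_M:TM\to M$ is the projection; $TTM$ is regarded as a vector bundle over $TM$ via the standard projection $\pi_{TM}$, and $\mathcal{V}$ as a subbundle of it. For $u,v\in T_pM$, $\mathfrak{I}(u,v)\in T_uTM$ denotes the vertical vector $\frac{d}{dt}\big|_{t=0}(u+tv)$; $\mathfrak{I}:TM\oplus TM\to\mathcal{V}$ is a bundle isomorphism over $TM$, where $TM\oplus TM$ (Whitney sum over $M$) is a bundle over $TM$ via the first projection $pr_1$, and $pr_2:TM\oplus TM\to TM$ is the second projection. With $\nabla$ the Levi-Civita connection of $g$, and $u,x\in T_pM$, $C(u,x)\in T_uTM$ is the horizontal lift of $x$ at $u$, characterized by $C(Y(p),x)=Y_*x-\mathfrak{I}(Y(p),\nabla_xY)$ for every vector field $Y$ on $M$. Every element of $T_uTM$ is uniquely of the form $C(u,v)+\mathfrak{I}(u,w)$. Metrics on vector bundles: a metric on a vector bundle $E\to N$ is a function on $\oplus^2E$ that is an inner product on each fibre. The pullback metric $(pr_2\circ\mathfrak{I}^{-1})^*g$ on $\mathcal{V}$ is given by $(\mathfrak{I}(u,v),\mathfrak{I}(u,w))\mapsto g(v,w)$. For bundles with metrics $(E,a)$, $(F,b)$ over the same base, the Whitney sum metric on $E\oplus F$ is $(a\oplus b)((e,f),(e',f'))=a(e,e')+b(f,f')$. The Sasaki metric $g_S$ on $TM$ is determined by: for all $u,v,w\in T_pM$, $g_S(C(u,v),C(u,w))=g(v,w)$, $g_S(\mathfrak{I}(u,v),\mathfrak{I}(u,w))=g(v,w)$, and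 $g_S(\mathfrak{I}(u,v),C(u,w))=0$. *)

theory Defs
  imports "HOL-Analysis.Analysis"
begin

section \<open>Smooth functions between Euclidean spaces\<close>

text \<open>Both predicates are meant for open \<open>S\<close>. In finite dimension, continuity of all the
  directional derivatives \<open>x \<mapsto> Df(x)v\<close> amounts to continuity of \<open>Df\<close>, so
  \<open>Ck_on k S f\<close> says that \<open>f\<close> is of class \<open>C^k\<close> on \<open>S\<close>.\<close>

primrec Ck_on :: "nat \<Rightarrow> 'a::real_normed_vector set \<Rightarrow> ('a \<Rightarrow> 'b::real_normed_vector) \<Rightarrow> bool" where
  "Ck_on 0 S f \<longleftrightarrow> continuous_on S f"
| "Ck_on (Suc k) S f \<longleftrightarrow>
     (\<forall>x\<in>S. f differentiable (at x)) \<and> (\<forall>v. Ck_on k S (\<lambda>x. frechet_derivative f (at x) v))"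

definition smooth_on :: "'a::real_normed_vector set \<Rightarrow> ('a \<Rightarrow> 'b::real_normed_vector) \<Rightarrow> bool" where
  "smooth_on S f \<longleftrightarrow> (\<forall>k. Ck_on k S f)"


section \<open>Smooth manifolds\<close>

text \<open>A chart is a pair of a domain and a coordinate map (relevant only on the domain). A smooth
  manifold is presented by a smooth atlas, not necessarily maximal, whose chart domains cover it;
  the dimension of the manifold is that of the model space.\<close>

type_synonym ('m, 'e) chart = "'m set \<times> ('m \<Rightarrow> 'e)"
type_synonym ('m, 'e) atlas = "('m, 'e) chart set"

definition points :: "('m, 'e) atlas \<Rightarrow> 'm set" where
  "points A = (\<Union>c\<in>A. fst c)"

definition charts_at :: "('m, 'e) atlas \<Rightarrow> 'm \<Rightarrow> ('m, 'e) chart set" where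
  "charts_at A p = {c \<in> A. p \<in> fst c}"

definition chart_image :: "('m, 'e) chart \<Rightarrow> 'e set" where
  "chart_image c = snd c ` fst c"

definition chart_inv :: "('m, 'e) chart \<Rightarrow> 'e \<Rightarrow> 'm" where
  "chart_inv c = inv_into (fst c) (snd c)"

definition atlas_topology :: "('m, 'e::topological_space) atlas \<Rightarrow> 'm topology" where
  "atlas_topology A = topology (\<lambda>U. U \<subseteq> points A \<and> (\<forall>c\<in>A. open (snd c ` (U \<inter> fst c))))"

definition smooth_manifold :: "('m, 'e::euclidean_space) atlas \<Rightarrow> bool" where
  "smooth_manifold A \<longleftrightarrow>
     (\<forall>c\<in>A. inj_on (snd c) (fst c) \<and> open (chart_image c)) \<and>
     (\<forall>c\<in>A. \<forall>d\<in>A. open (snd c ` (fst c \<inter> fst d)) \<and>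
        smooth_on (snd c ` (fst c \<inter> fst d)) (snd d \<circ> chart_inv c)) \<and>
     Hausdorff_space (atlas_topology A) \<and>
     second_countable (atlas_topology A)"

definition smooth_fun ::
  "('m, 'e::euclidean_space) atlas \<Rightarrow> ('m \<Rightarrow> real) \<Rightarrow> bool" where
  "smooth_fun A f \<longleftrightarrow> (\<forall>c\<in>A. smooth_on (chart_image c) (f \<circ> chart_inv c))"

text \<open>Since atlases need not be maximal, the source chart may have to be shrunk, to the part
  corresponding to \<open>W\<close>, for its image to fit into a chart of the target.\<close>

definition smooth_map ::
  "('m, 'e::euclidean_space) atlas \<Rightarrow> ('n, 'f::euclidean_space) atlas \<Rightarrow> ('m \<Rightarrow> 'n) \<Rightarrow> bool" where
  "smooth_map A B F \<longleftrightarrow>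
     (\<forall>p\<in>points A. \<exists>c\<in>charts_at A p. \<exists>d\<in>charts_at B (F p). \<exists>W.
        open W \<and> snd c p \<in> W \<and> W \<subseteq> chart_image c \<and>
        (\<forall>x\<in>W. F (chart_inv c x) \<in> fst d) \<and> smooth_on W (snd d \<circ> F \<circ> chart_inv c))"


section \<open>Tangent vectors\<close>

text \<open>A tangent vector at \<open>p\<close> is a pair \<open>(p, \<xi>)\<close>, where \<open>\<xi>\<close> assigns to every chart of the atlas
  around \<open>p\<close> the coordinates of the vector in that chart, subject to the usual transformation
  rule; \<open>\<xi>\<close> is set to \<open>0\<close> on all other charts, so that equality of tangent vectors is equality
  in HOL.\<close>

type_synonym ('m, 'e) tvec = "'m \<times> (('m, 'e) chart \<Rightarrow> 'e)"

definition tangent_space ::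
  "('m, 'e::euclidean_space) atlas \<Rightarrow> 'm \<Rightarrow> ('m, 'e) tvec set" where
  "tangent_space A p = {(p, \<xi>) | \<xi>. p \<in> points A \<and> (\<forall>c. c \<notin> charts_at A p \<longrightarrow> \<xi> c = 0) \<and>
     (\<forall>c\<in>charts_at A p. \<forall>d\<in>charts_at A p.
        \<xi> d = frechet_derivative (snd d \<circ> chart_inv c) (at (snd c p)) (\<xi> c))}"

definition tv_zero :: "'m \<Rightarrow> ('m, 'e::real_vector) tvec" where
  "tv_zero p = (p, \<lambda>c. 0)"

text \<open>The operations below are meaningful for vectors with the same base point.\<close>

definition tv_add :: "('m, 'e::real_vector) tvec \<Rightarrow> ('m, 'e) tvec \<Rightarrow> ('m, 'e) tvec"
    (infixl \<open>+\<^sub>T\<close> 65) where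
  "u +\<^sub>T v = (fst u, \<lambda>c. snd u c + snd v c)"

definition tv_diff :: "('m, 'e::real_vector) tvec \<Rightarrow> ('m, 'e) tvec \<Rightarrow> ('m, 'e) tvec"
    (infixl \<open>-\<^sub>T\<close> 65) where
  "u -\<^sub>T v = (fst u, \<lambda>c. snd u c - snd v c)"

definition tv_scale :: "real \<Rightarrow> ('m, 'e::real_vector) tvec \<Rightarrow> ('m, 'e) tvec"
    (infixr \<open>*\<^sub>T\<close> 75) where
  "r *\<^sub>T u = (fst u, \<lambda>c. r *\<^sub>R snd u c)"

definition tangent_vectors :: "('m, 'e::euclidean_space) atlas \<Rightarrow> ('m, 'e) tvec set" where
  "tangent_vectors A = (\<Union>p\<in>points A. tangent_space A p)"

definition tangent_chart ::
  "('m, 'e::euclidean_space) atlas \<Rightarrow> ('m, 'e) chart \<Rightarrow> (('m, 'e) tvec, 'e \<times> 'e) chart" where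
  "tangent_chart A c =
     ({u \<in> tangent_vectors A. fst u \<in> fst c}, \<lambda>u. (snd c (fst u), snd u c))"

text \<open>The manifold \<open>TM\<close>. In particular \<open>tangent_space (tangent_atlas A) u\<close> is the tangent space
  of \<open>TM\<close> at \<open>u\<close>, and \<open>tangent_vectors (tangent_atlas A)\<close> is \<open>TTM\<close>. The projections of \<open>TM\<close> onto
  \<open>M\<close> and of \<open>TTM\<close> onto \<open>TM\<close> are both \<open>fst\<close>.\<close>

definition tangent_atlas ::
  "('m, 'e::euclidean_space) atlas \<Rightarrow> (('m, 'e) tvec, 'e \<times> 'e) atlas" where
  "tangent_atlas A = tangent_chart A ` A"

text \<open>The differential of a smooth map; the result does not depend on the chart chosen in the
  source.\<close>

definition pushforward ::
  "('m, 'e::euclidean_space) atlas \<Rightarrow> ('n, 'f::euclidean_space) atlas \<Rightarrow> ('m \<Rightarrow> 'n) \<Rightarrow>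
   ('m, 'e) tvec \<Rightarrow> ('n, 'f) tvec" where
  "pushforward A B F x =
     (let p = fst x; c = (SOME c. c \<in> charts_at A p) in
      (F p, \<lambda>d. if d \<in> charts_at B (F p)
        then frechet_derivative (snd d \<circ> F \<circ> chart_inv c) (at (snd c p)) (snd x c) else 0))"

definition dir_deriv ::
  "('m, 'e::euclidean_space) atlas \<Rightarrow> ('m, 'e) tvec \<Rightarrow> ('m \<Rightarrow> real) \<Rightarrow> real" where
  "dir_deriv A x f =
     (let p = fst x; c = (SOME c. c \<in> charts_at A p) in
      frechet_derivative (f \<circ> chart_inv c) (at (snd c p)) (snd x c))"

definition velocity ::
  "('n, 'f::euclidean_space) atlas \<Rightarrow> (real \<Rightarrow> 'n) \<Rightarrow> ('n, 'f) tvec" where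
  "velocity B \<gamma> =
     (\<gamma> 0, \<lambda>d. if d \<in> charts_at B (\<gamma> 0) then vector_derivative (snd d \<circ> \<gamma>) (at 0) else 0)"


section \<open>Vector bundles\<close>

text \<open>The data of a smooth vector bundle with typical fibre \<open>'f\<close>. A local trivialization is given by
  an open subset of the base together with its fibre component, a map that restricts to a linear
  isomorphism onto \<open>'f\<close> on every fibre over this subset.\<close>

record ('b, 'x, 'v, 'f) vbundle =
  vb_base :: "('b, 'x) atlas"
  vb_total :: "'v set"
  vb_proj :: "'v \<Rightarrow> 'b"
  vb_add :: "'v \<Rightarrow> 'v \<Rightarrow> 'v"
  vb_scale :: "real \<Rightarrow> 'v \<Rightarrow> 'v"
  vb_trivs :: "('b set \<times> ('v \<Rightarrow> 'f)) set"

definition vb_fibre :: "('b, 'x, 'v, 'f) vbundle \<Rightarrow> 'b \<Rightarrow> 'v set" where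
  "vb_fibre E p = {e \<in> vb_total E. vb_proj E e = p}"

definition vb_atlas :: "('b, 'x, 'v, 'f) vbundle \<Rightarrow> ('v, 'x \<times> 'f) atlas" where
  "vb_atlas E =
     {({e \<in> vb_total E. vb_proj E e \<in> fst c \<inter> fst t},
       \<lambda>e. (snd c (vb_proj E e), snd t e)) | c t. c \<in> vb_base E \<and> t \<in> vb_trivs E}"

definition tangent_bundle ::
  "('m, 'e::euclidean_space) atlas \<Rightarrow> ('m, 'e, ('m, 'e) tvec, 'e) vbundle" where
  "tangent_bundle A =
     \<lparr>vb_base = A, vb_total = tangent_vectors A, vb_proj = fst,
      vb_add = tv_add, vb_scale = tv_scale,
      vb_trivs = (\<lambda>c. (fst c, \<lambda>u. snd u c)) ` A\<rparr>"

text \<open>The kernel of the differential of \<open>fst : TM \<rightarrow> M\<close>. In the chart of \<open>TM\<close> induced by a chart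
  of \<open>M\<close>, vertical vectors have coordinates of the form \<open>(0, w)\<close>; the trivializations pick \<open>w\<close>.\<close>

definition vertical_bundle ::
  "('m, 'e::euclidean_space) atlas \<Rightarrow>
   (('m, 'e) tvec, 'e \<times> 'e, (('m, 'e) tvec, 'e \<times> 'e) tvec, 'e) vbundle" where
  "vertical_bundle A =
     \<lparr>vb_base = tangent_atlas A,
      vb_total = {\<xi> \<in> tangent_vectors (tangent_atlas A).
        pushforward (tangent_atlas A) A fst \<xi> = tv_zero (fst (fst \<xi>))},
      vb_proj = fst, vb_add = tv_add, vb_scale = tv_scale,
      vb_trivs = (\<lambda>c. (fst (tangent_chart A c), \<lambda>\<xi>. snd (snd \<xi> (tangent_chart A c)))) ` A\<rparr>"

definition whitney_sum ::
  "('b, 'x, 'v, 'f) vbundle \<Rightarrow> ('b, 'x, 'w, 'g) vbundle \<Rightarrow> ('b, 'x, 'v \<times> 'w, 'f \<times> 'g) vbundle" where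
  "whitney_sum E F =
     \<lparr>vb_base = vb_base E,
      vb_total = {(e, f). e \<in> vb_total E \<and> f \<in> vb_total F \<and> vb_proj E e = vb_proj F f},
      vb_proj = (\<lambda>(e, f). vb_proj E e),
      vb_add = (\<lambda>(e, f) (e', f'). (vb_add E e e', vb_add F f f')),
      vb_scale = (\<lambda>r (e, f). (vb_scale E r e, vb_scale F r f)),
      vb_trivs = {(fst s \<inter> fst t, \<lambda>(e, f). (snd s e, snd t f)) | s t.
        s \<in> vb_trivs E \<and> t \<in> vb_trivs F}\<rparr>"

text \<open>Over the identity of the base. Smoothness refers to the total spaces.\<close>

definition vb_isomorphism ::
  "('b, 'x::euclidean_space, 'v, 'f::euclidean_space) vbundle \<Rightarrow>
   ('b, 'x, 'w, 'g::euclidean_space) vbundle \<Rightarrow> ('v \<Rightarrow> 'w) \<Rightarrow> bool" where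
  "vb_isomorphism E F \<Phi> \<longleftrightarrow>
     vb_base E = vb_base F \<and>
     bij_betw \<Phi> (vb_total E) (vb_total F) \<and>
     (\<forall>e\<in>vb_total E. vb_proj F (\<Phi> e) = vb_proj E e) \<and>
     (\<forall>p\<in>points (vb_base E). \<forall>e\<in>vb_fibre E p. \<forall>e'\<in>vb_fibre E p. \<forall>r.
        \<Phi> (vb_add E e e') = vb_add F (\<Phi> e) (\<Phi> e') \<and>
        \<Phi> (vb_scale E r e) = vb_scale F r (\<Phi> e)) \<and>
     smooth_map (vb_atlas E) (vb_atlas F) \<Phi> \<and>
     smooth_map (vb_atlas F) (vb_atlas E) (inv_into (vb_total E) \<Phi>)"

text \<open>The zero vector of the fibre of \<open>e\<close> is \<open>vb_scale E 0 e\<close>. No smoothness is required here; it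
  is added for Riemannian metrics below.\<close>

definition vb_metric :: "('b, 'x, 'v, 'f) vbundle \<Rightarrow> ('v \<Rightarrow> 'v \<Rightarrow> real) \<Rightarrow> bool" where
  "vb_metric E a \<longleftrightarrow>
     (\<forall>p\<in>points (vb_base E). \<forall>e\<in>vb_fibre E p. \<forall>e'\<in>vb_fibre E p. \<forall>f\<in>vb_fibre E p. \<forall>r.
        a e f = a f e \<and>
        a (vb_add E e e') f = a e f + a e' f \<and>
        a (vb_scale E r e) f = r * a e f \<and>
        (e \<noteq> vb_scale E 0 e \<longrightarrow> 0 < a e e))"

definition pullback_metric :: "('v \<Rightarrow> 'w) \<Rightarrow> ('w \<Rightarrow> 'w \<Rightarrow> real) \<Rightarrow> 'v \<Rightarrow> 'v \<Rightarrow> real" where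
  "pullback_metric \<Phi> a e e' = a (\<Phi> e) (\<Phi> e')"

definition whitney_sum_metric ::
  "('v \<Rightarrow> 'v \<Rightarrow> real) \<Rightarrow> ('w \<Rightarrow> 'w \<Rightarrow> real) \<Rightarrow> 'v \<times> 'w \<Rightarrow> 'v \<times> 'w \<Rightarrow> real" where
  "whitney_sum_metric a b = (\<lambda>(e, f) (e', f'). a e e' + b f f')"

definition bundle_isometry ::
  "('b, 'x::euclidean_space, 'v, 'f::euclidean_space) vbundle \<Rightarrow> ('v \<Rightarrow> 'v \<Rightarrow> real) \<Rightarrow>
   ('b, 'x, 'w, 'g::euclidean_space) vbundle \<Rightarrow> ('w \<Rightarrow> 'w \<Rightarrow> real) \<Rightarrow> ('v \<Rightarrow> 'w) \<Rightarrow> bool" where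
  "bundle_isometry E a F b \<Phi> \<longleftrightarrow>
     vb_metric E a \<and> vb_metric F b \<and> vb_isomorphism E F \<Phi> \<and>
     (\<forall>p\<in>points (vb_base E). \<forall>e\<in>vb_fibre E p. \<forall>e'\<in>vb_fibre E p. b (\<Phi> e) (\<Phi> e') = a e e')"


section \<open>Vector fields, Riemannian metrics and the Levi-Civita connection\<close>

text \<open>Vector fields are extensional functions, so that they are determined by their values on the
  manifold.\<close>

definition vector_fields ::
  "('m, 'e::euclidean_space) atlas \<Rightarrow> ('m \<Rightarrow> ('m, 'e) tvec) set" where
  "vector_fields A =
     {X \<in> (\<Pi>\<^sub>E p\<in>points A. tangent_space A p). smooth_map A (tangent_atlas A) X}"

text \<open>In coordinates, \<open>[X, Y] = DY(X) - DX(Y)\<close>.\<close>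

definition lie_bracket ::
  "('m, 'e::euclidean_space) atlas \<Rightarrow> ('m \<Rightarrow> ('m, 'e) tvec) \<Rightarrow> ('m \<Rightarrow> ('m, 'e) tvec) \<Rightarrow>
   'm \<Rightarrow> ('m, 'e) tvec" where
  "lie_bracket A X Y p =
     (p, \<lambda>c. if c \<in> charts_at A p
        then frechet_derivative (\<lambda>a. snd (Y (chart_inv c a)) c) (at (snd c p)) (snd (X p) c) -
             frechet_derivative (\<lambda>a. snd (X (chart_inv c a)) c) (at (snd c p)) (snd (Y p) c)
        else 0)"

definition riemannian_metric ::
  "('m, 'e::euclidean_space) atlas \<Rightarrow> (('m, 'e) tvec \<Rightarrow> ('m, 'e) tvec \<Rightarrow> real) \<Rightarrow> bool" where
  "riemannian_metric A g \<longleftrightarrow>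
     vb_metric (tangent_bundle A) g \<and>
     (\<forall>X\<in>vector_fields A. \<forall>Y\<in>vector_fields A. smooth_fun A (\<lambda>p. g (X p) (Y p)))"

text \<open>\<open>D x Y\<close> is the covariant derivative of the vector field \<open>Y\<close> in the direction of the tangent
  vector \<open>x\<close>.\<close>

definition affine_connection ::
  "('m, 'e::euclidean_space) atlas \<Rightarrow>
   (('m, 'e) tvec \<Rightarrow> ('m \<Rightarrow> ('m, 'e) tvec) \<Rightarrow> ('m, 'e) tvec) \<Rightarrow> bool" where
  "affine_connection A D \<longleftrightarrow>
     (\<forall>Y\<in>vector_fields A. \<forall>p\<in>points A. \<forall>x\<in>tangent_space A p. \<forall>x'\<in>tangent_space A p. \<forall>r.
        D x Y \<in> tangent_space A p \<and>
        D (x +\<^sub>T x') Y = D x Y +\<^sub>T D x' Y \<and>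
        D (r *\<^sub>T x) Y = r *\<^sub>T D x Y) \<and>
     (\<forall>Y\<in>vector_fields A. \<forall>Z\<in>vector_fields A. \<forall>p\<in>points A. \<forall>x\<in>tangent_space A p.
        D x (\<lambda>q\<in>points A. Y q +\<^sub>T Z q) = D x Y +\<^sub>T D x Z) \<and>
     (\<forall>Y\<in>vector_fields A. \<forall>f. smooth_fun A f \<longrightarrow> (\<forall>p\<in>points A. \<forall>x\<in>tangent_space A p.
        D x (\<lambda>q\<in>points A. f q *\<^sub>T Y q) = dir_deriv A x f *\<^sub>T Y p +\<^sub>T f p *\<^sub>T D x Y)) \<and>
     (\<forall>X\<in>vector_fields A. \<forall>Y\<in>vector_fields A.
        (\<lambda>p\<in>points A. D (X p) Y) \<in> vector_fields A)"

definition levi_civita ::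
  "('m, 'e::euclidean_space) atlas \<Rightarrow> (('m, 'e) tvec \<Rightarrow> ('m, 'e) tvec \<Rightarrow> real) \<Rightarrow>
   (('m, 'e) tvec \<Rightarrow> ('m \<Rightarrow> ('m, 'e) tvec) \<Rightarrow> ('m, 'e) tvec) \<Rightarrow> bool" where
  "levi_civita A g D \<longleftrightarrow>
     affine_connection A D \<and>
     (\<forall>X\<in>vector_fields A. \<forall>Y\<in>vector_fields A. \<forall>p\<in>points A.
        D (X p) Y -\<^sub>T D (Y p) X = lie_bracket A X Y p) \<and>
     (\<forall>Y\<in>vector_fields A. \<forall>Z\<in>vector_fields A. \<forall>p\<in>points A. \<forall>x\<in>tangent_space A p.
        dir_deriv A x (\<lambda>q. g (Y q) (Z q)) = g (D x Y) (Z p) + g (Y p) (D x Z))"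


section \<open>Vertical and horizontal lifts, and the Sasaki metric\<close>

definition vertical_lift ::
  "('m, 'e::euclidean_space) atlas \<Rightarrow> ('m, 'e) tvec \<Rightarrow> ('m, 'e) tvec \<Rightarrow>
   (('m, 'e) tvec, 'e \<times> 'e) tvec" where
  "vertical_lift A u v = velocity (tangent_atlas A) (\<lambda>t. u +\<^sub>T t *\<^sub>T v)"

text \<open>The map \<open>pr\<^sub>2 \<circ> I\<inverse> : V \<rightarrow> TM\<close>, where \<open>I : TM \<oplus> TM \<rightarrow> V\<close> is the vertical lift.\<close>

definition vertical_part ::
  "('m, 'e::euclidean_space) atlas \<Rightarrow> (('m, 'e) tvec, 'e \<times> 'e) tvec \<Rightarrow> ('m, 'e) tvec" where
  "vertical_part A =
     snd \<circ> inv_into (vb_total (whitney_sum (tangent_bundle A) (tangent_bundle A)))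
             (\<lambda>(u, v). vertical_lift A u v)"

text \<open>The defining property of the connection map of \<open>D\<close>: \<open>C u x\<close> is the horizontal lift of \<open>x\<close>
  at \<open>u\<close>.\<close>

definition connection_map ::
  "('m, 'e::euclidean_space) atlas \<Rightarrow>
   (('m, 'e) tvec \<Rightarrow> ('m \<Rightarrow> ('m, 'e) tvec) \<Rightarrow> ('m, 'e) tvec) \<Rightarrow>
   (('m, 'e) tvec \<Rightarrow> ('m, 'e) tvec \<Rightarrow> (('m, 'e) tvec, 'e \<times> 'e) tvec) \<Rightarrow> bool" where
  "connection_map A D C \<longleftrightarrow>
     (\<forall>Y\<in>vector_fields A. \<forall>p\<in>points A. \<forall>x\<in>tangent_space A p.
        C (Y p) x = pushforward A (tangent_atlas A) Y x -\<^sub>T vertical_lift A (Y p) (D x Y))"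

definition sasaki_metric ::
  "('m, 'e::euclidean_space) atlas \<Rightarrow> (('m, 'e) tvec \<Rightarrow> ('m, 'e) tvec \<Rightarrow> real) \<Rightarrow>
   (('m, 'e) tvec \<Rightarrow> ('m, 'e) tvec \<Rightarrow> (('m, 'e) tvec, 'e \<times> 'e) tvec) \<Rightarrow>
   ((('m, 'e) tvec, 'e \<times> 'e) tvec \<Rightarrow> (('m, 'e) tvec, 'e \<times> 'e) tvec \<Rightarrow> real) \<Rightarrow> bool" where
  "sasaki_metric A g C gS \<longleftrightarrow>
     vb_metric (tangent_bundle (tangent_atlas A)) gS \<and>
     (\<forall>p\<in>points A. \<forall>u\<in>tangent_space A p. \<forall>v\<in>tangent_space A p. \<forall>w\<in>tangent_space A p.
        gS (C u v) (C u w) = g v w \<and>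
        gS (vertical_lift A u v) (vertical_lift A u w) = g v w \<and>
        gS (vertical_lift A u v) (C u w) = 0)"

end

theory Submission
  imports Defs
begin

text \<open>Near every point of \<open>M\<close>, cut-off coordinate fields express the horizontal lift through smooth
  functions: in the chart of \<open>TM\<close> induced by a chart of \<open>M\<close>, the vectors \<open>C u v\<close> and \<open>I u w\<close> have
  coordinates \<open>(v, - \<Gamma> x u v)\<close> and \<open>(0, w)\<close>, where \<open>\<Gamma>\<close> is bilinear in \<open>u\<close> and \<open>v\<close> and smooth in
  \<open>x\<close>. Hence every element of \<open>T\<^sub>uTM\<close> is uniquely \<open>C u v + I u w\<close>, and \<open>\<Psi>\<close> is the shear
  \<open>((x, u), (a, b)) \<mapsto> ((x, u), (a, b + \<Gamma> x u a))\<close>, which is smooth with smooth inverse. The isometry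
  property is the orthogonality of the splitting for the Sasaki metric, and \<open>h\<close> is a metric because
  it is the transport of \<open>g\<^sub>S\<close> along \<open>\<Psi>\<close>.\<close>

section \<open>Calculus of smooth functions\<close>

text \<open>The hypothesis \<open>connection_map\<close> describes \<open>C u x\<close> only through
  globally defined vector fields \<open>Y\<close> with \<open>Y p = u\<close>; tangency, linearity
  and smooth dependence of \<open>C\<close> are not assumed and have to be extracted from it. So
  every \<open>u\<close> must first be extended to a global field, and it is the Hausdorff property
  that makes a cut-off coordinate field, extended by zero, smooth. The sign of
  \<open>\<Gamma>\<close> comes from the defining formula: if \<open>Y\<close> has constant
  coordinates near the point, its differential sends \<open>x\<close> to \<open>(x, 0)\<close>, and
  subtracting the vertical lift of the covariant derivative leaves \<open>- \<Gamma>\<close> in the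
  fibre slot; the coefficients of \<open>\<Gamma>\<close> are the Christoffel symbols of the chart.
  Likewise \<open>\<Psi>\<close> is prescribed only on sums of a horizontal and a vertical lift.
  Since every vector of \<open>TTM\<close> is such a sum, this fixes \<open>\<Psi>\<close>
  everywhere, and its inverse is understood through the same coordinates.\<close>

lemma Ck_on_subset: "Ck_on k S f \<Longrightarrow> T \<subseteq> S \<Longrightarrow> Ck_on k T f"
  by (induction k arbitrary: f) (auto intro: continuous_on_subset)

lemma Ck_on_has_derivative:
  "Ck_on (Suc k) S f \<Longrightarrow> x \<in> S \<Longrightarrow> (f has_derivative frechet_derivative f (at x)) (at x)"
  by (auto simp: frechet_derivative_works)

text \<open>A derivative at a point of the open set \<open>S\<close> depends only on values near
  that point, so agreement on \<open>S\<close> is inherited by all iterated derivatives.\<close>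

lemma Ck_on_cong:
  assumes "open S" "\<And>x. x \<in> S \<Longrightarrow> f x = g x"
  shows "Ck_on k S f \<longleftrightarrow> Ck_on k S g"
proof -
  have *: "Ck_on k S g" if "Ck_on k S f" "\<And>x. x \<in> S \<Longrightarrow> f x = g x" for f g :: "'a \<Rightarrow> 'b"
    using that
  proof (induction k arbitrary: f g)
    case 0
    then show ?case by (auto cong: continuous_on_cong)
  next
    case (Suc k)
    have d: "(g has_derivative frechet_derivative f (at x)) (at x)" if "x \<in> S" for x
      by (rule has_derivative_transform_within_open[OF
            Ck_on_has_derivative[OF Suc.prems(1) that] \<open>open S\<close> that Suc.prems(2)])
    have "Ck_on k S (\<lambda>x. frechet_derivative g (at x) v)" for v
    proof (rule Suc.IH)
      show "Ck_on k S (\<lambda>x. frechet_derivative f (at x) v)"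
        using Suc.prems(1) by simp
      show "frechet_derivative f (at x) v = frechet_derivative g (at x) v" if "x \<in> S" for x
        by (rule fun_cong[OF frechet_derivative_at[OF d[OF that]]])
    qed
    moreover have "g differentiable (at x)" if "x \<in> S" for x
      using d[OF that] by (rule differentiableI)
    ultimately show ?case
      by simp
  qed
  show ?thesis
    using *[of f g] *[of g f] assms(2) by metis
qed

text \<open>\<open>frechet_derivative\<close> is defined by choice; uniqueness of the derivative
  lets an explicit formula \<open>f'\<close> replace it in the inductions below.\<close>

lemma Ck_on_SucI:
  assumes "open S" "\<And>x. x \<in> S \<Longrightarrow> (f has_derivative f' x) (at x)"
    and "\<And>v. Ck_on k S (\<lambda>x. f' x v)"
  shows "Ck_on (Suc k) S f"
proof -
  have "frechet_derivative f (at x) = f' x" if "x \<in> S" for x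
    using frechet_derivative_at[OF assms(2)[OF that]] by simp
  then have "Ck_on k S (\<lambda>x. frechet_derivative f (at x) v)" for v
    using assms(3)[of v] by (subst Ck_on_cong[OF \<open>open S\<close>]) auto
  then show ?thesis
    using assms(2) by (auto simp: differentiable_def)
qed

lemma Ck_on_SucD: "Ck_on (Suc k) S f \<Longrightarrow> Ck_on k S f"
proof (induction k arbitrary: f)
  case 0
  then show ?case
    by (auto intro!: continuous_at_imp_continuous_on differentiable_imp_continuous_within)
next
  case (Suc k)
  then show ?case by (subst Ck_on.simps) (auto simp del: Ck_on.simps(1))
qed

lemma Ck_on_local:
  assumes "\<And>x. x \<in> S \<Longrightarrow> \<exists>U. open U \<and> x \<in> U \<and> Ck_on k U f"
  shows "Ck_on k S f"
  using assms
proof (induction k arbitrary: f)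
  case 0
  show ?case
    unfolding Ck_on.simps
  proof (intro continuous_at_imp_continuous_on ballI)
    show "isCont f x" if "x \<in> S" for x
      using 0[OF that] by (auto simp: continuous_on_eq_continuous_at)
  qed
next
  case (Suc k)
  show ?case
    unfolding Ck_on.simps
  proof safe
    show "f differentiable at x" if "x \<in> S" for x
      using Suc.prems[OF that] by (metis Ck_on.simps(2))
    show "Ck_on k S (\<lambda>x. frechet_derivative f (at x) v)" for v
    proof (rule Suc.IH)
      fix x
      assume "x \<in> S"
      then obtain U where "open U" "x \<in> U" "Ck_on (Suc k) U f"
        using Suc.prems by blast
      then show "\<exists>U. open U \<and> x \<in> U \<and> Ck_on k U (\<lambda>x. frechet_derivative f (at x) v)"
        by (intro exI[of _ U]) simp
    qed
  qed
qed

lemma Ck_on_const: "open S \<Longrightarrow> Ck_on k S (\<lambda>x. a)"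
proof (induction k arbitrary: a)
  case (Suc k)
  show ?case by (rule Ck_on_SucI[where f'="\<lambda>x v. 0"]) (use Suc in auto)
qed auto

lemma Ck_on_bounded_linear:
  assumes "bounded_linear L" "open S"
  shows "Ck_on k S f \<Longrightarrow> Ck_on k S (\<lambda>x. L (f x))"
proof (induction k arbitrary: f)
  case 0
  then show ?case using bounded_linear.continuous_on[OF assms(1)] by auto
next
  case (Suc k)
  show ?case
  proof (rule Ck_on_SucI[OF assms(2)])
    show "((\<lambda>x. L (f x)) has_derivative (\<lambda>v. L (frechet_derivative f (at x) v))) (at x)"
      if "x \<in> S" for x
      by (rule bounded_linear.has_derivative[OF assms(1) Ck_on_has_derivative[OF Suc.prems that]])
    show "Ck_on k S (\<lambda>x. L (frechet_derivative f (at x) v))" for v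
      using Suc.prems by (intro Suc.IH) simp
  qed
qed

lemma Ck_on_add:
  assumes "open S"
  shows "Ck_on k S f \<Longrightarrow> Ck_on k S g \<Longrightarrow> Ck_on k S (\<lambda>x. f x + g x)"
proof (induction k arbitrary: f g)
  case 0
  then show ?case by (auto intro: continuous_intros)
next
  case (Suc k)
  show ?case
  proof (rule Ck_on_SucI[OF assms])
    show "((\<lambda>x. f x + g x) has_derivative
        (\<lambda>v. frechet_derivative f (at x) v + frechet_derivative g (at x) v)) (at x)" if "x \<in> S" for x
      by (intro has_derivative_add Suc.prems[THEN Ck_on_has_derivative, OF that])
    show "Ck_on k S (\<lambda>x. frechet_derivative f (at x) v + frechet_derivative g (at x) v)" for v
      using Suc.prems by (intro Suc.IH) simp_all
  qed
qed

lemma Ck_on_sum: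
  assumes "open S" "\<And>i. i \<in> I \<Longrightarrow> Ck_on k S (f i)"
  shows "Ck_on k S (\<lambda>x. \<Sum>i\<in>I. f i x)"
  using assms(2)
proof (induction I rule: infinite_finite_induct)
  case (insert i I)
  then show ?case using Ck_on_add[OF assms(1), of k "f i"] by simp
qed (use assms in \<open>auto intro: Ck_on_const\<close>)

lemma (in bounded_bilinear) Ck_on_bilinear:
  assumes "open S"
  shows "Ck_on k S f \<Longrightarrow> Ck_on k S g \<Longrightarrow> Ck_on k S (\<lambda>x. prod (f x) (g x))"
proof (induction k arbitrary: f g)
  case 0
  then show ?case by (auto intro: continuous_on)
next
  case (Suc k)
  note prems = Suc.prems[THEN Ck_on_SucD]
  show ?case
  proof (rule Ck_on_SucI[OF assms])
    show "((\<lambda>x. prod (f x) (g x)) has_derivative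
        (\<lambda>v. prod (f x) (frechet_derivative g (at x) v) + prod (frechet_derivative f (at x) v) (g x)))
        (at x)" if "x \<in> S" for x
      by (intro FDERIV Suc.prems[THEN Ck_on_has_derivative, OF that])
    show "Ck_on k S (\<lambda>x. prod (f x) (frechet_derivative g (at x) v) +
        prod (frechet_derivative f (at x) v) (g x))" for v
      using Suc.prems prems by (intro Ck_on_add[OF assms] Suc.IH) simp_all
  qed
qed

lemma linear_euclidean_expand:
  fixes x :: "'a::euclidean_space"
  assumes "linear L"
  shows "L x = (\<Sum>b\<in>Basis. (x \<bullet> b) *\<^sub>R L b)"
  using linear_sum[OF assms, of "\<lambda>b. (x \<bullet> b) *\<^sub>R b" Basis]
  by (simp add: euclidean_representation linear_cmul[OF assms])

text \<open>In the chain rule the direction in which \<open>g\<close> is differentiated varies with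
  \<open>x\<close>, whereas the induction hypothesis covers fixed directions only. Expanding the
  direction in \<open>Basis\<close> gives a sum of products whose factors involve fixed
  directions.\<close>

lemma Ck_on_compose:
  fixes f :: "'a::real_normed_vector \<Rightarrow> 'b::euclidean_space"
  assumes "open S" "open T" "\<And>x. x \<in> S \<Longrightarrow> f x \<in> T"
  shows "Ck_on k S f \<Longrightarrow> Ck_on k T g \<Longrightarrow> Ck_on k S (\<lambda>x. g (f x))"
proof (induction k arbitrary: g)
  case 0
  then show ?case using assms
    by (auto intro: continuous_on_compose2)
next
  case (Suc k)
  let ?f' = "\<lambda>x v. frechet_derivative f (at x) v"
  let ?g' = "\<lambda>x v. frechet_derivative g (at x) v"
  have d: "((\<lambda>x. g (f x)) has_derivative (\<lambda>v. \<Sum>b\<in>Basis. (?f' x v \<bullet> b) *\<^sub>R ?g' (f x) b)) (at x)"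
    if "x \<in> S" for x
  proof -
    have g: "(g has_derivative ?g' (f x)) (at (f x))"
      using Ck_on_has_derivative[OF Suc.prems(2) assms(3)[OF that]] .
    show ?thesis
      unfolding linear_euclidean_expand[OF has_derivative_linear[OF g], symmetric]
      by (rule has_derivative_compose[OF Ck_on_has_derivative[OF Suc.prems(1) that] g])
  qed
  show ?case
  proof (rule Ck_on_SucI[OF assms(1) d])
    show "Ck_on k S (\<lambda>x. \<Sum>b\<in>Basis. (?f' x v \<bullet> b) *\<^sub>R ?g' (f x) b)" for v
    proof (intro Ck_on_sum[OF assms(1)] bounded_bilinear.Ck_on_bilinear[OF bounded_bilinear_scaleR]
        assms(1) Ck_on_bounded_linear[OF bounded_linear_inner_left])
      show "Ck_on k S (\<lambda>x. ?f' x v)"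
        using Suc.prems(1) by simp
      show "Ck_on k S (\<lambda>x. ?g' (f x) b)" for b
        using Suc.prems(2) by (intro Suc.IH[OF Ck_on_SucD[OF Suc.prems(1)], of "\<lambda>y. ?g' y b"]) simp
    qed
  qed
qed

lemma smooth_on_subset: "smooth_on S f \<Longrightarrow> T \<subseteq> S \<Longrightarrow> smooth_on T f"
  by (auto simp: smooth_on_def intro: Ck_on_subset)

lemma smooth_on_cong:
  "open S \<Longrightarrow> (\<And>x. x \<in> S \<Longrightarrow> f x = g x) \<Longrightarrow> smooth_on S f \<longleftrightarrow> smooth_on S g"
  unfolding smooth_on_def using Ck_on_cong[of S f g] by presburger

lemma smooth_on_has_derivative:
  "smooth_on S f \<Longrightarrow> x \<in> S \<Longrightarrow> (f has_derivative frechet_derivative f (at x)) (at x)"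
  unfolding smooth_on_def by (metis Ck_on_has_derivative)

lemma smooth_on_continuous: "smooth_on S f \<Longrightarrow> continuous_on S f"
  unfolding smooth_on_def by (metis Ck_on.simps(1))

lemma smooth_on_frechet_derivative:
  "smooth_on S f \<Longrightarrow> smooth_on S (\<lambda>x. frechet_derivative f (at x) v)"
  unfolding smooth_on_def by (metis Ck_on.simps(2))

lemma smooth_on_local:
  assumes "\<And>x. x \<in> S \<Longrightarrow> \<exists>U. open U \<and> x \<in> U \<and> smooth_on U f"
  shows "smooth_on S f"
  unfolding smooth_on_def
proof (intro allI Ck_on_local)
  fix k x
  assume "x \<in> S"
  then show "\<exists>U. open U \<and> x \<in> U \<and> Ck_on k U f"
    using assms unfolding smooth_on_def by meson
qed

lemma smooth_on_const: "open S \<Longrightarrow> smooth_on S (\<lambda>x. a)"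
  by (auto simp: smooth_on_def intro: Ck_on_const)

lemma smooth_on_ident: "open S \<Longrightarrow> smooth_on S (\<lambda>x. x)"
  unfolding smooth_on_def
proof
  fix k
  assume "open S"
  show "Ck_on k S (\<lambda>x. x)"
  proof (cases k)
    case (Suc n)
    show ?thesis
      unfolding Suc
      by (rule Ck_on_SucI[OF \<open>open S\<close> has_derivative_ident Ck_on_const[OF \<open>open S\<close>]])
  qed simp
qed

lemma smooth_on_bounded_linear:
  "bounded_linear L \<Longrightarrow> open S \<Longrightarrow> smooth_on S f \<Longrightarrow> smooth_on S (\<lambda>x. L (f x))"
  by (auto simp: smooth_on_def intro: Ck_on_bounded_linear)

lemmas smooth_on_fst = smooth_on_bounded_linear[OF bounded_linear_fst]
  and smooth_on_snd = smooth_on_bounded_linear[OF bounded_linear_snd]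
  and smooth_on_uminus = smooth_on_bounded_linear[OF bounded_linear_minus[OF bounded_linear_ident]]

lemma smooth_on_add:
  "open S \<Longrightarrow> smooth_on S f \<Longrightarrow> smooth_on S g \<Longrightarrow> smooth_on S (\<lambda>x. f x + g x)"
  by (auto simp: smooth_on_def intro: Ck_on_add)

lemma smooth_on_diff:
  "open S \<Longrightarrow> smooth_on S f \<Longrightarrow> smooth_on S g \<Longrightarrow> smooth_on S (\<lambda>x. f x - g x)"
  using smooth_on_add[of S f "\<lambda>x. - g x"] smooth_on_uminus[of S g] by simp

lemma smooth_on_sum:
  "open S \<Longrightarrow> (\<And>i. i \<in> I \<Longrightarrow> smooth_on S (f i)) \<Longrightarrow> smooth_on S (\<lambda>x. \<Sum>i\<in>I. f i x)"
  by (auto simp: smooth_on_def intro: Ck_on_sum)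

lemma (in bounded_bilinear) smooth_on_bilinear:
  "open S \<Longrightarrow> smooth_on S f \<Longrightarrow> smooth_on S g \<Longrightarrow> smooth_on S (\<lambda>x. prod (f x) (g x))"
  by (auto simp: smooth_on_def intro: Ck_on_bilinear)

lemmas smooth_on_scaleR = bounded_bilinear.smooth_on_bilinear[OF bounded_bilinear_scaleR]
  and smooth_on_mult = bounded_bilinear.smooth_on_bilinear[OF bounded_bilinear_mult]
  and smooth_on_inner = bounded_bilinear.smooth_on_bilinear[OF bounded_bilinear_inner]

lemma smooth_on_Pair:
  assumes "open S" "smooth_on S f" "smooth_on S g"
  shows "smooth_on S (\<lambda>x. (f x, g x))"
proof -
  have "smooth_on S (\<lambda>x. (f x, 0) + (0, g x))"
    using assms
    by (intro smooth_on_add smooth_on_bounded_linear[where L="\<lambda>y. (y, 0)"]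
        smooth_on_bounded_linear[where L="\<lambda>y. (0, y)"])
      (auto intro: bounded_linear_Pair bounded_linear_ident bounded_linear_zero)
  then show ?thesis by simp
qed

lemma smooth_on_compose:
  fixes f :: "'a::real_normed_vector \<Rightarrow> 'b::euclidean_space"
  assumes "smooth_on T g" "smooth_on S f" "open S" "open T" "\<And>x. x \<in> S \<Longrightarrow> f x \<in> T"
  shows "smooth_on S (\<lambda>x. g (f x))"
  using assms(1,2) unfolding smooth_on_def
  by (auto intro: Ck_on_compose[OF assms(3,4,5)])

lemmas smooth_on_intros = smooth_on_const smooth_on_ident smooth_on_fst smooth_on_snd
  smooth_on_uminus smooth_on_add smooth_on_diff smooth_on_sum smooth_on_scaleR smooth_on_mult
  smooth_on_inner smooth_on_Pair

text \<open>Smoothness as defined controls the derivative for one direction at a time, but the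
  transition maps of \<open>TM\<close> contain it as a function of point and direction together.
  Linearity in the direction bridges the gap.\<close>

lemma smooth_on_frechet_derivative_joint:
  fixes f :: "'a::euclidean_space \<Rightarrow> 'b::real_normed_vector"
  assumes "smooth_on S f" "open S"
  shows "smooth_on (S \<times> UNIV) (\<lambda>z. frechet_derivative f (at (fst z)) (snd z))"
proof -
  have op: "open (S \<times> (UNIV :: 'a set))"
    using assms by (simp add: open_Times)
  have "smooth_on (S \<times> (UNIV :: 'a set))
     (\<lambda>z. \<Sum>b\<in>Basis. (snd z \<bullet> b) *\<^sub>R frechet_derivative f (at (fst z)) b)"
    by (intro smooth_on_intros op smooth_on_compose[OF smooth_on_frechet_derivative[OF assms(1)]])
      (use assms in auto)
  then show ?thesis
    using linear_euclidean_expand[OF has_derivative_linear[OF smooth_on_has_derivative[OF assms(1)]]]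
    by (subst smooth_on_cong[OF op]) auto
qed

text \<open>The derivative of the reciprocal is a product of reciprocals and constants, so each
  order of differentiability follows from the one before.\<close>

lemma smooth_on_inverse: "smooth_on {0<..} (inverse :: real \<Rightarrow> real)"
  unfolding smooth_on_def
proof
  fix k
  show "Ck_on k {0<..} (inverse :: real \<Rightarrow> real)"
  proof (induction k)
    case 0
    show ?case by (auto intro!: continuous_intros)
  next
    case (Suc k)
    show ?case
    proof (rule Ck_on_SucI)
      show "(inverse has_derivative (\<lambda>v. - (inverse x * v * inverse x))) (at x)"
        if "x \<in> {0<..}" for x :: real
        using that by (intro has_derivative_inverse') simp
      show "Ck_on k {0<..} (\<lambda>x :: real. - (inverse x * v * inverse x))" for v
        by (intro Suc Ck_on_const bounded_bilinear.Ck_on_bilinear[OF bounded_bilinear_mult]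
            Ck_on_bounded_linear[OF bounded_linear_minus[OF bounded_linear_ident]] open_greaterThan)
    qed simp
  qed
qed

section \<open>Bump functions\<close>

text \<open>The case \<open>n = 0\<close> is the classical flat function
  \<open>exp (- 1 / t)\<close>; the negative powers of \<open>t\<close> are the factors that
  differentiating it produces.\<close>

definition flat_exp :: "nat \<Rightarrow> real \<Rightarrow> real" where
  "flat_exp n t = (if 0 < t then exp (- inverse t) * inverse t ^ n else 0)"

text \<open>On the right, the substitution \<open>s = 1 / t\<close> turns the claim into the decay
  of \<open>s ^ n / exp s\<close> at infinity; on the left the function is zero.\<close>

lemma flat_exp_tendsto_0: "(flat_exp n \<longlongrightarrow> 0) (at 0)"
proof (rule filterlim_split_at)
  have "\<forall>\<^sub>F t in at_left 0. flat_exp n t = 0"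
    by (auto simp: eventually_at_filter flat_exp_def)
  then show "(flat_exp n \<longlongrightarrow> 0) (at_left 0)"
    by (rule tendsto_eventually)
  have "((\<lambda>t. inverse t ^ n / exp (inverse t)) \<longlongrightarrow> 0) (at_right (0::real))"
    by (rule filterlim_compose[OF tendsto_power_div_exp_0 filterlim_inverse_at_top_right])
  moreover have "\<forall>\<^sub>F t in at_right 0. inverse t ^ n / exp (inverse t) = flat_exp n t"
    by (auto simp: eventually_at_filter flat_exp_def exp_minus field_simps)
  ultimately show "(flat_exp n \<longlongrightarrow> 0) (at_right 0)"
    by (rule Lim_transform_eventually)
qed

lemma flat_exp_has_derivative:
  "(flat_exp n has_real_derivative flat_exp (n + 2) t - real n * flat_exp (n + 1) t) (at t)"
proof -
  consider "t < 0" | "t = 0" | "0 < t" by linarith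
  then show ?thesis
  proof cases
    case 1
    have "((\<lambda>t. 0) has_real_derivative 0) (at t)" by simp
    then have "(flat_exp n has_real_derivative 0) (at t)"
      by (rule has_field_derivative_transform_within_open[where S="{..<0}"])
        (use 1 in \<open>auto simp: flat_exp_def\<close>)
    then show ?thesis using 1 by (simp add: flat_exp_def)
  next
    case 2
    \<comment> \<open>At 0 the difference quotient is itself a member of the family, even for
      \<open>h = 0\<close> because division by zero yields 0, so its limit is already known.\<close>
    have "(\<lambda>h. (flat_exp n (t + h) - flat_exp n t) / h) = flat_exp (Suc n)"
      using 2 by (auto simp: flat_exp_def field_simps)
    moreover have "flat_exp (n + 2) t - real n * flat_exp (n + 1) t = 0"
      using 2 by (simp add: flat_exp_def)
    ultimately show ?thesis
      unfolding DERIV_def using flat_exp_tendsto_0[of "Suc n"] by simp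
  next
    case 3
    have inv: "(inverse has_real_derivative - (inverse t)\<^sup>2) (at t)"
      using DERIV_inverse[of t] 3 by (simp add: numeral_2_eq_2)
    have p: "((\<lambda>t. inverse t ^ n) has_real_derivative - real n * inverse t ^ (n + 1)) (at t)"
      using DERIV_power[OF inv, of n] by (cases n) (simp_all add: power2_eq_square algebra_simps)
    have e: "((\<lambda>t. exp (- inverse t)) has_real_derivative exp (- inverse t) * (inverse t)\<^sup>2) (at t)"
      using DERIV_chain2[OF DERIV_exp DERIV_minus[OF inv]] by simp
    have "((\<lambda>t. exp (- inverse t) * inverse t ^ n) has_real_derivative
        exp (- inverse t) * inverse t ^ (n + 2) - real n * (exp (- inverse t) * inverse t ^ (n + 1))) (at t)"
      using DERIV_mult[OF e p] by (simp add: algebra_simps power2_eq_square)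
    then have "(flat_exp n has_real_derivative
        exp (- inverse t) * inverse t ^ (n + 2) - real n * (exp (- inverse t) * inverse t ^ (n + 1))) (at t)"
      by (rule has_field_derivative_transform_within_open[where S="{0<..}"])
        (use 3 in \<open>auto simp: flat_exp_def\<close>)
    then show ?thesis using 3 by (simp add: flat_exp_def)
  qed
qed

text \<open>The induction covers all \<open>n\<close> at once: \<open>flat_exp n\<close> has a derivative in the span of the family.\<close>

lemma smooth_on_flat_exp: "smooth_on UNIV (flat_exp n)"
  unfolding smooth_on_def
proof
  fix k
  show "Ck_on k UNIV (flat_exp n)"
  proof (induction k arbitrary: n)
    case 0
    show ?case
      by (auto intro!: continuous_at_imp_continuous_on DERIV_isCont[OF flat_exp_has_derivative])
  next
    case (Suc k)
    show ?case
    proof (rule Ck_on_SucI)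
      show "(flat_exp n has_derivative
          (\<lambda>v. (flat_exp (n + 2) t + (- real n) * flat_exp (n + 1) t) * v)) (at t)" for t
        using flat_exp_has_derivative[of n t] by (simp add: has_field_derivative_def)
      show "Ck_on k UNIV (\<lambda>t. (flat_exp (n + 2) t + (- real n) * flat_exp (n + 1) t) * v)" for v
        by (intro bounded_bilinear.Ck_on_bilinear[OF bounded_bilinear_mult] Ck_on_add Ck_on_const
            open_UNIV Suc)
    qed simp
  qed
qed

lemma smooth_bump_exists:
  fixes x0 :: "'a::euclidean_space"
  assumes "open S" "x0 \<in> S"
  obtains \<psi> :: "'a \<Rightarrow> real" and B K where "smooth_on UNIV \<psi>" "open B" "x0 \<in> B" "B \<subseteq> S"
    "compact K" "K \<subseteq> S" "\<And>x. x \<in> B \<Longrightarrow> \<psi> x = 1" "\<And>x. x \<notin> K \<Longrightarrow> \<psi> x = 0"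
proof -
  obtain e where e: "e > 0" "cball x0 e \<subseteq> S"
    using assms open_contains_cball by blast
  \<comment> \<open>The squared distance is smooth at \<open>x0\<close> too, unlike the
    distance.\<close>
  define s where "s x = (x0 - x) \<bullet> (x0 - x)" for x
  have s: "s x = (dist x0 x)\<^sup>2" for x
    by (simp add: s_def dist_norm power2_norm_eq_inner)
  \<comment> \<open>Since \<open>e / 2 < e\<close>, at least one of the two arguments is positive,
    so the denominator never vanishes. Within distance \<open>e / 2\<close> of \<open>x0\<close> its
    second term is 0 and the quotient is 1; beyond distance \<open>e\<close> the numerator is
    0.\<close>
  define den where "den x = flat_exp 0 (e\<^sup>2 - s x) + flat_exp 0 (s x - (e / 2)\<^sup>2)" for x
  define \<psi> where "\<psi> x = flat_exp 0 (e\<^sup>2 - s x) * inverse (den x)" for x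
  have h: "flat_exp 0 t \<ge> 0" "t > 0 \<Longrightarrow> flat_exp 0 t > 0" "t \<le> 0 \<Longrightarrow> flat_exp 0 t = 0" for t
    by (auto simp: flat_exp_def)
  have e2: "(e / 2)\<^sup>2 < e\<^sup>2"
    using e by (intro power_strict_mono) auto
  have den_pos: "den x > 0" for x
  proof (cases "s x < e\<^sup>2")
    case True
    then show ?thesis using h(2)[of "e\<^sup>2 - s x"] h(1)[of "s x - (e / 2)\<^sup>2"] by (simp add: den_def)
  next
    case False
    then show ?thesis using e2 h(1)[of "e\<^sup>2 - s x"] h(2)[of "s x - (e / 2)\<^sup>2"] by (simp add: den_def)
  qed
  have sm: "smooth_on UNIV s"
    unfolding s_def by (intro smooth_on_intros) simp_all
  have sm1: "smooth_on UNIV (\<lambda>x. flat_exp 0 (e\<^sup>2 - s x))"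
    by (rule smooth_on_compose[OF smooth_on_flat_exp]) (auto intro!: smooth_on_intros sm)
  have sm2: "smooth_on UNIV (\<lambda>x. flat_exp 0 (s x - (e / 2)\<^sup>2))"
    by (rule smooth_on_compose[OF smooth_on_flat_exp]) (auto intro!: smooth_on_intros sm)
  have sm3: "smooth_on UNIV den"
    unfolding den_def by (intro smooth_on_intros sm1 sm2) simp
  have "smooth_on UNIV \<psi>"
    unfolding \<psi>_def using den_pos
    by (intro smooth_on_mult sm1 smooth_on_compose[OF smooth_on_inverse sm3]) auto
  moreover have "\<psi> x = 1" if "x \<in> ball x0 (e / 2)" for x
  proof -
    have "s x < (e / 2)\<^sup>2"
      using that unfolding s by (intro power_strict_mono) auto
    then show ?thesis
      using den_pos[of x] h(3)[of "s x - (e / 2)\<^sup>2"] by (simp add: \<psi>_def den_def)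
  qed
  moreover have "\<psi> x = 0" if "x \<notin> cball x0 e" for x
  proof -
    have "e\<^sup>2 < s x"
      using that e unfolding s by (intro power_strict_mono) auto
    then show ?thesis
      using h(3)[of "e\<^sup>2 - s x"] by (simp add: \<psi>_def)
  qed
  moreover have "ball x0 (e / 2) \<subseteq> S"
    using e by (intro order.trans[OF _ e(2)]) auto
  ultimately show thesis
    using e that[of \<psi> "ball x0 (e / 2)" "cball x0 e"] by auto
qed

section \<open>Charts and smooth maps\<close>

text \<open>Isolates the conditions on charts alone. They pass on to \<open>tangent_atlas\<close>,
  so lemmas stated for them apply to \<open>TM\<close> as well as to \<open>M\<close>.\<close>

definition smooth_atlas :: "('m, 'e::euclidean_space) atlas \<Rightarrow> bool" where
  "smooth_atlas A \<longleftrightarrow>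
     (\<forall>c\<in>A. inj_on (snd c) (fst c) \<and> open (chart_image c)) \<and>
     (\<forall>c\<in>A. \<forall>d\<in>A. open (snd c ` (fst c \<inter> fst d)) \<and>
        smooth_on (snd c ` (fst c \<inter> fst d)) (snd d \<circ> chart_inv c))"

abbreviation overlap :: "('m, 'e) chart \<Rightarrow> ('m, 'e) chart \<Rightarrow> 'e set" where
  "overlap c d \<equiv> snd c ` (fst c \<inter> fst d)"

lemma smooth_atlas_of_manifold: "smooth_manifold A \<Longrightarrow> smooth_atlas A"
  by (simp add: smooth_manifold_def smooth_atlas_def)

lemma charts_atD: "c \<in> charts_at A p \<Longrightarrow> c \<in> A" "c \<in> charts_at A p \<Longrightarrow> p \<in> fst c"
  by (auto simp: charts_at_def)

lemma charts_at_nonempty: "p \<in> points A \<Longrightarrow> \<exists>c. c \<in> charts_at A p"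
  by (auto simp: charts_at_def points_def)

lemma charts_at_points: "c \<in> charts_at A p \<Longrightarrow> p \<in> points A"
  by (auto simp: charts_at_def points_def)

lemma some_chart_at: "p \<in> points A \<Longrightarrow> (SOME c. c \<in> charts_at A p) \<in> charts_at A p"
  using charts_at_nonempty by (rule someI_ex)

lemma chart_inv_in: "x \<in> chart_image c \<Longrightarrow> chart_inv c x \<in> fst c"
  by (auto simp: chart_image_def chart_inv_def inv_into_into)

lemma snd_chart_inv: "x \<in> chart_image c \<Longrightarrow> snd c (chart_inv c x) = x"
  by (auto simp: chart_image_def chart_inv_def f_inv_into_f)

lemma chart_inv_snd: "smooth_atlas A \<Longrightarrow> c \<in> A \<Longrightarrow> p \<in> fst c \<Longrightarrow> chart_inv c (snd c p) = p"
  by (simp add: smooth_atlas_def chart_inv_def)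

lemma snd_in_chart_image: "p \<in> fst c \<Longrightarrow> snd c p \<in> chart_image c"
  by (auto simp: chart_image_def)

lemma open_chart_image: "smooth_atlas A \<Longrightarrow> c \<in> A \<Longrightarrow> open (chart_image c)"
  by (simp add: smooth_atlas_def)

lemma in_overlap_iff:
  "smooth_atlas A \<Longrightarrow> c \<in> A \<Longrightarrow> x \<in> overlap c d \<longleftrightarrow> x \<in> chart_image c \<and> chart_inv c x \<in> fst d"
  using chart_inv_snd[of A c] chart_inv_in[of x c] snd_chart_inv[of x c]
  by (auto simp: chart_image_def)

lemma open_overlap: "smooth_atlas A \<Longrightarrow> c \<in> A \<Longrightarrow> d \<in> A \<Longrightarrow> open (overlap c d)"
  by (simp add: smooth_atlas_def)

lemma smooth_on_transition:
  "smooth_atlas A \<Longrightarrow> c \<in> A \<Longrightarrow> d \<in> A \<Longrightarrow> smooth_on (overlap c d) (snd d \<circ> chart_inv c)"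
  by (simp add: smooth_atlas_def)

text \<open>The definition of \<open>smooth_map\<close> only provides one suitable pair of charts at each point.\<close>

lemma smooth_map_charts:
  assumes A: "smooth_atlas A" and B: "smooth_atlas B" and F: "smooth_map A B F"
    and c: "c \<in> A" and d: "d \<in> B"
  defines "S \<equiv> {x \<in> chart_image c. F (chart_inv c x) \<in> fst d}"
  shows "open S" "smooth_on S (snd d \<circ> F \<circ> chart_inv c)"
proof -
  have ex: "\<exists>U. open U \<and> x \<in> U \<and> U \<subseteq> S \<and> smooth_on U (snd d \<circ> F \<circ> chart_inv c)"
    if "x \<in> S" for x
  proof -
    define p where "p = chart_inv c x"
    have p: "p \<in> fst c" "F p \<in> fst d" "snd c p = x" "x \<in> chart_image c"
      using that by (auto simp: S_def p_def chart_inv_in snd_chart_inv)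
    then have "p \<in> points A"
      using c by (auto simp: points_def)
    then obtain c' d' W where *: "c' \<in> charts_at A p" "d' \<in> charts_at B (F p)" "open W"
      "snd c' p \<in> W" "W \<subseteq> chart_image c'" "\<And>y. y \<in> W \<Longrightarrow> F (chart_inv c' y) \<in> fst d'"
      "smooth_on W (snd d' \<circ> F \<circ> chart_inv c')"
      using F unfolding smooth_map_def by blast
    note c' = charts_atD[OF *(1)] and d' = charts_atD[OF *(2)]
    \<comment> \<open>\<open>W'\<close> keeps the points of the given chart \<open>c'\<close> whose
      image lies in both target charts; \<open>U\<close> transports it to the desired chart
      \<open>c\<close>. On \<open>U\<close> the representation in \<open>c\<close>, \<open>d\<close>
      is the given one composed with a transition map on either side.\<close>
    define W' where "W' = W \<inter> (snd d' \<circ> F \<circ> chart_inv c') -` overlap d' d"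
    define U where "U = overlap c c' \<inter> (snd c' \<circ> chart_inv c) -` W'"
    have W': "open W'"
      unfolding W'_def by (rule continuous_open_preimage[OF smooth_on_continuous[OF *(7)] *(3)
            open_overlap[OF B d'(1) d]])
    have U: "open U"
      unfolding U_def
      by (rule continuous_open_preimage[OF smooth_on_continuous[OF smooth_on_transition[OF A c c'(1)]]
            open_overlap[OF A c c'(1)] W'])
    have eq: "y \<in> chart_image c" "chart_inv c' (snd c' (chart_inv c y)) = chart_inv c y"
      "F (chart_inv c y) \<in> fst d'" "snd d' (F (chart_inv c y)) \<in> overlap d' d" if "y \<in> U" for y
      using that *(6)[of "snd c' (chart_inv c y)"] chart_inv_snd[OF A c'(1), of "chart_inv c y"]
      unfolding U_def W'_def by (auto simp: in_overlap_iff[OF A c])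
    have Fd: "chart_inv d' (snd d' (F (chart_inv c y))) = F (chart_inv c y)" if "y \<in> U" for y
      using chart_inv_snd[OF B d'(1) eq(3)[OF that]] .
    have "U \<subseteq> S"
    proof
      fix y
      assume y: "y \<in> U"
      show "y \<in> S"
        using eq(1,4)[OF y] Fd[OF y] unfolding S_def in_overlap_iff[OF B d'(1)] by auto
    qed
    moreover have "x \<in> U"
      using p c' d' *(4) chart_inv_snd[OF A c'(1), of p]
      by (auto simp: U_def W'_def in_overlap_iff[OF A c] p_def[symmetric])
    moreover have "smooth_on U (\<lambda>y. (snd d \<circ> chart_inv d')
        ((\<lambda>y. (snd d' \<circ> F \<circ> chart_inv c') ((snd c' \<circ> chart_inv c) y)) y))"
    proof (rule smooth_on_compose[OF smooth_on_transition[OF B d'(1) d] _ U open_overlap[OF B d'(1) d]])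
      show "smooth_on U (\<lambda>y. (snd d' \<circ> F \<circ> chart_inv c') ((snd c' \<circ> chart_inv c) y))"
      proof (rule smooth_on_compose[OF *(7) _ U *(3)])
        show "smooth_on U (snd c' \<circ> chart_inv c)"
          by (rule smooth_on_subset[OF smooth_on_transition[OF A c c'(1)]]) (auto simp: U_def)
      qed (auto simp: U_def W'_def)
      show "(snd d' \<circ> F \<circ> chart_inv c') ((snd c' \<circ> chart_inv c) y) \<in> overlap d' d" if "y \<in> U" for y
        using eq(2,4)[OF that] by simp
    qed
    then have "smooth_on U (snd d \<circ> F \<circ> chart_inv c)"
      by (subst smooth_on_cong[OF U]) (auto simp: eq(2) Fd)
    ultimately show ?thesis
      using U by blast
  qed
  show "open S"
    by (subst open_subopen) (use ex in blast)
  show "smooth_on S (snd d \<circ> F \<circ> chart_inv c)"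
    by (rule smooth_on_local) (use ex in blast)
qed

lemma smooth_map_id:
  assumes "smooth_atlas A"
  shows "smooth_map A A (\<lambda>p. p)"
  unfolding smooth_map_def
proof
  fix p
  assume "p \<in> points A"
  then obtain c where c: "c \<in> charts_at A p"
    by (rule exE[OF charts_at_nonempty])
  note op = open_chart_image[OF assms charts_atD(1)[OF c]]
  have "smooth_on (chart_image c) (snd c \<circ> (\<lambda>p. p) \<circ> chart_inv c)"
    by (rule smooth_on_cong[OF op, THEN iffD1, OF _ smooth_on_ident[OF op]])
      (simp add: snd_chart_inv)
  moreover have "\<forall>x\<in>chart_image c. chart_inv c x \<in> fst c"
    by (simp add: chart_inv_in)
  moreover have "snd c p \<in> chart_image c"
    by (rule snd_in_chart_image[OF charts_atD(2)[OF c]])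
  ultimately show "\<exists>c\<in>charts_at A p. \<exists>d\<in>charts_at A p. \<exists>W. open W \<and> snd c p \<in> W \<and> W \<subseteq> chart_image c \<and>
      (\<forall>x\<in>W. chart_inv c x \<in> fst d) \<and> smooth_on W (snd d \<circ> (\<lambda>p. p) \<circ> chart_inv c)"
    by (intro bexI[OF _ c] exI[of _ "chart_image c"] conjI op subset_refl)
qed

text \<open>The Jacobian in a pair of charts. For the identity map it is the derivative of a
  transition map, so the transformation rule of tangent vectors and the differential of a map obey
  the same chain rule.\<close>

definition coord_deriv ::
  "('m, 'e::euclidean_space) chart \<Rightarrow> ('n, 'f::euclidean_space) chart \<Rightarrow> ('m \<Rightarrow> 'n) \<Rightarrow> 'm \<Rightarrow> 'e \<Rightarrow> 'f"
  where "coord_deriv c d F p = frechet_derivative (snd d \<circ> F \<circ> chart_inv c) (at (snd c p))"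

lemma coord_deriv_id:
  "coord_deriv c d (\<lambda>p. p) p = frechet_derivative (snd d \<circ> chart_inv c) (at (snd c p))"
  by (simp add: coord_deriv_def comp_def)

lemma has_coord_deriv:
  assumes "smooth_atlas A" "smooth_atlas B" "smooth_map A B F"
    and c: "c \<in> charts_at A p" and d: "d \<in> charts_at B (F p)"
  shows "((snd d \<circ> F \<circ> chart_inv c) has_derivative coord_deriv c d F p) (at (snd c p))"
  unfolding coord_deriv_def
  using smooth_map_charts(2)[OF assms(1-3) charts_atD(1)[OF c] charts_atD(1)[OF d]]
  by (rule smooth_on_has_derivative)
    (use charts_atD[OF c] charts_atD[OF d] in \<open>auto simp: chart_inv_snd[OF assms(1)] snd_in_chart_image\<close>)

lemma linear_coord_deriv:
  "\<lbrakk>smooth_atlas A; smooth_atlas B; smooth_map A B F; c \<in> charts_at A p; d \<in> charts_at B (F p)\<rbrakk> \<Longrightarrow>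
    linear (coord_deriv c d F p)"
  by (rule has_derivative_linear[OF has_coord_deriv])

lemma coord_deriv_eqI:
  assumes A: "smooth_atlas A" and c: "c \<in> charts_at A p"
    and U: "open U" "snd c p \<in> U" "\<And>x. x \<in> U \<Longrightarrow> (snd d \<circ> F \<circ> chart_inv c) x = f x"
    and "(f has_derivative f') (at (snd c p))"
  shows "coord_deriv c d F p = f'"
  unfolding coord_deriv_def
  by (rule frechet_derivative_at[symmetric], rule has_derivative_transform_within_open[OF assms(6) U(1,2)])
    (use U(3) in auto)

text \<open>Near \<open>p\<close> the intermediate chart \<open>d\<close> cancels. Taking
  \<open>F\<close> or \<open>G\<close> to be the identity gives independence of the chart, and
  taking both gives the cocycle rule for transition maps.\<close>

lemma coord_deriv_compose:
  assumes A: "smooth_atlas A" and B: "smooth_atlas B" and C: "smooth_atlas C"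
    and F: "smooth_map A B F" and G: "smooth_map B C G"
    and c: "c \<in> charts_at A p" and d: "d \<in> charts_at B (F p)" and e: "e \<in> charts_at C (G (F p))"
  shows "coord_deriv c e (\<lambda>p. G (F p)) p v = coord_deriv d e G (F p) (coord_deriv c d F p v)"
proof -
  note c' = charts_atD[OF c] and d' = charts_atD[OF d]
  let ?S = "{x \<in> chart_image c. F (chart_inv c x) \<in> fst d}"
  have p: "chart_inv c (snd c p) = p"
    using c' by (simp add: chart_inv_snd[OF A])
  have "coord_deriv c e (\<lambda>p. G (F p)) p = (\<lambda>v. coord_deriv d e G (F p) (coord_deriv c d F p v))"
  proof (rule coord_deriv_eqI[OF A c smooth_map_charts(1)[OF A B F c'(1) d'(1)]])
    show "snd c p \<in> ?S"
      using c' d' p by (simp add: snd_in_chart_image)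
    show "(snd e \<circ> (\<lambda>p. G (F p)) \<circ> chart_inv c) x =
        (snd e \<circ> G \<circ> chart_inv d) ((snd d \<circ> F \<circ> chart_inv c) x)" if "x \<in> ?S" for x
      using that by (simp add: chart_inv_snd[OF B d'(1)])
    show "((\<lambda>x. (snd e \<circ> G \<circ> chart_inv d) ((snd d \<circ> F \<circ> chart_inv c) x)) has_derivative
        (\<lambda>v. coord_deriv d e G (F p) (coord_deriv c d F p v))) (at (snd c p))"
      using has_coord_deriv[OF B C G d e]
      by (intro has_derivative_compose[OF has_coord_deriv[OF A B F c d]]) (simp add: p comp_def)
  qed
  then show ?thesis by simp
qed

lemma coord_deriv_refl:
  assumes "smooth_atlas A" "c \<in> charts_at A p"
  shows "coord_deriv c c (\<lambda>p. p) p v = v"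
proof -
  have "coord_deriv c c (\<lambda>p. p) p = (\<lambda>v. v)"
    by (rule coord_deriv_eqI[OF assms open_chart_image[OF assms(1) charts_atD(1)[OF assms(2)]],
          where f="\<lambda>x. x"])
      (use charts_atD(2)[OF assms(2)] in \<open>auto simp: snd_in_chart_image snd_chart_inv\<close>)
  then show ?thesis by simp
qed


section \<open>Tangent spaces\<close>

lemma tangent_space_iff:
  "u \<in> tangent_space A p \<longleftrightarrow> fst u = p \<and> p \<in> points A \<and> (\<forall>c. c \<notin> charts_at A p \<longrightarrow> snd u c = 0) \<and>
     (\<forall>c\<in>charts_at A p. \<forall>d\<in>charts_at A p. snd u d = coord_deriv c d (\<lambda>p. p) p (snd u c))"
  by (cases u) (auto simp: tangent_space_def coord_deriv_id)

lemma tangent_spaceI: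
  assumes "fst u = p" "p \<in> points A" "\<And>c. c \<notin> charts_at A p \<Longrightarrow> snd u c = 0"
    and "\<And>c d. \<lbrakk>c \<in> charts_at A p; d \<in> charts_at A p\<rbrakk> \<Longrightarrow>
      snd u d = coord_deriv c d (\<lambda>p. p) p (snd u c)"
  shows "u \<in> tangent_space A p"
  unfolding tangent_space_iff using assms by blast

lemma tangent_spaceD:
  assumes "u \<in> tangent_space A p"
  shows "fst u = p" "p \<in> points A" "c \<notin> charts_at A p \<Longrightarrow> snd u c = 0"
  using assms unfolding tangent_space_iff by blast+

lemma tangent_space_coord_change:
  "\<lbrakk>u \<in> tangent_space A p; c \<in> charts_at A p; d \<in> charts_at A p\<rbrakk> \<Longrightarrow>
    snd u d = coord_deriv c d (\<lambda>p. p) p (snd u c)"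
  unfolding tangent_space_iff by blast

text \<open>The transformation rule propagates coordinates from one chart to all others around
  \<open>p\<close>, and elsewhere both vectors are 0. Most identities between tangent vectors below
  are checked in a single convenient chart by this rule.\<close>

lemma tangent_space_eqI:
  assumes u: "u \<in> tangent_space A p" and v: "v \<in> tangent_space A p"
    and c: "c \<in> charts_at A p" and eq: "snd u c = snd v c"
  shows "u = v"
proof (rule prod_eqI)
  show "fst u = fst v"
    using tangent_spaceD(1)[OF u] tangent_spaceD(1)[OF v] by simp
  show "snd u = snd v"
  proof
    fix d
    show "snd u d = snd v d"
    proof (cases "d \<in> charts_at A p")
      case True
      then show ?thesis
        using tangent_space_coord_change[OF u c True] tangent_space_coord_change[OF v c True] eq by simp
    next
      case False
      then show ?thesis
        using tangent_spaceD(3)[OF u False] tangent_spaceD(3)[OF v False] by simp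
    qed
  qed
qed

lemma tangent_vectors_iff: "u \<in> tangent_vectors A \<longleftrightarrow> u \<in> tangent_space A (fst u)"
  unfolding tangent_vectors_def using tangent_spaceD(1,2)[of u A] by blast

lemma tangent_vectorsI: "u \<in> tangent_space A p \<Longrightarrow> u \<in> tangent_vectors A"
  unfolding tangent_vectors_def using tangent_spaceD(2)[of u A p] by blast

text \<open>The inverse of taking coordinates in \<open>c\<close>: the vector at \<open>p\<close>
  whose coordinates in \<open>c\<close> are \<open>v\<close>, for \<open>c\<close> around
  \<open>p\<close>.\<close>

definition tvec_of :: "('m, 'e::euclidean_space) atlas \<Rightarrow> ('m, 'e) chart \<Rightarrow> 'm \<Rightarrow> 'e \<Rightarrow> ('m, 'e) tvec"
  where "tvec_of A c p v =
    (p, \<lambda>d. if d \<in> charts_at A p then coord_deriv c d (\<lambda>p. p) p v else 0)"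

lemma fst_tvec_of [simp]: "fst (tvec_of A c p v) = p"
  by (simp add: tvec_of_def)

lemma tvec_of_in:
  assumes "smooth_atlas A" "c \<in> charts_at A p"
  shows "tvec_of A c p v \<in> tangent_space A p"
proof (rule tangent_spaceI)
  fix d e
  assume d: "d \<in> charts_at A p" and e: "e \<in> charts_at A p"
  have "coord_deriv c e (\<lambda>p. p) p v = coord_deriv d e (\<lambda>p. p) p (coord_deriv c d (\<lambda>p. p) p v)"
    by (rule coord_deriv_compose[OF assms(1,1,1) smooth_map_id[OF assms(1)]
          smooth_map_id[OF assms(1)] assms(2) d e])
  then show "snd (tvec_of A c p v) e = coord_deriv d e (\<lambda>p. p) p (snd (tvec_of A c p v) d)"
    using d e by (simp add: tvec_of_def)
qed (use assms in \<open>simp_all add: tvec_of_def charts_at_points\<close>)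

lemma tvec_of_coord:
  assumes "smooth_atlas A" "c \<in> charts_at A p"
  shows "snd (tvec_of A c p v) c = v"
  using assms by (simp add: tvec_of_def coord_deriv_refl)

lemma tvec_of_tangent:
  assumes "smooth_atlas A" "c \<in> charts_at A p" "u \<in> tangent_space A p"
  shows "tvec_of A c p (snd u c) = u"
  using assms by (intro tangent_space_eqI[OF tvec_of_in _ _ tvec_of_coord])

lemma tangent_space_linear_combination:
  assumes A: "smooth_atlas A" and "u \<in> tangent_space A p" "v \<in> tangent_space A p"
  shows "(p, \<lambda>c. a *\<^sub>R snd u c + b *\<^sub>R snd v c) \<in> tangent_space A p"
proof (rule tangent_spaceI)
  fix c d
  assume c: "c \<in> charts_at A p" and d: "d \<in> charts_at A p"
  have "linear (coord_deriv c d (\<lambda>p. p) p)"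
    by (rule linear_coord_deriv[OF A A smooth_map_id[OF A] c d])
  then show "snd (p, \<lambda>c. a *\<^sub>R snd u c + b *\<^sub>R snd v c) d =
      coord_deriv c d (\<lambda>p. p) p (snd (p, \<lambda>c. a *\<^sub>R snd u c + b *\<^sub>R snd v c) c)"
    by (simp add: linear_add linear_cmul tangent_space_coord_change[OF assms(2) c d]
        tangent_space_coord_change[OF assms(3) c d])
qed (use tangent_spaceD[OF assms(2)] tangent_spaceD[OF assms(3)] in simp_all)

lemma tv_add_in:
  "smooth_atlas A \<Longrightarrow> u \<in> tangent_space A p \<Longrightarrow> v \<in> tangent_space A p \<Longrightarrow> u +\<^sub>T v \<in> tangent_space A p"
  using tangent_space_linear_combination[of A u p v 1 1] tangent_spaceD[of u A p]
  by (simp add: tv_add_def)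

lemma tv_diff_in:
  "smooth_atlas A \<Longrightarrow> u \<in> tangent_space A p \<Longrightarrow> v \<in> tangent_space A p \<Longrightarrow> u -\<^sub>T v \<in> tangent_space A p"
  using tangent_space_linear_combination[of A u p v 1 "-1"] tangent_spaceD[of u A p]
  by (simp add: tv_diff_def)

lemma tv_scale_in:
  "smooth_atlas A \<Longrightarrow> u \<in> tangent_space A p \<Longrightarrow> r *\<^sub>T u \<in> tangent_space A p"
  using tangent_space_linear_combination[of A u p u r 0] tangent_spaceD[of u A p]
  by (simp add: tv_scale_def)

lemma fst_tv_ops [simp]: "fst (u +\<^sub>T v) = fst u" "fst (u -\<^sub>T v) = fst u" "fst (r *\<^sub>T u) = fst u"
  by (simp_all add: tv_add_def tv_diff_def tv_scale_def)

lemma snd_tv_ops [simp]: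
  "snd (u +\<^sub>T v) c = snd u c + snd v c" "snd (u -\<^sub>T v) c = snd u c - snd v c"
  "snd (r *\<^sub>T u) c = r *\<^sub>R snd u c"
  by (simp_all add: tv_add_def tv_diff_def tv_scale_def)

text \<open>Frees the differential from the arbitrary source chart in its definition: the change
  from that chart to \<open>c\<close> is absorbed by the chain rule.\<close>

lemma pushforward_coord:
  assumes A: "smooth_atlas A" and B: "smooth_atlas B" and F: "smooth_map A B F"
    and x: "x \<in> tangent_space A p" and c: "c \<in> charts_at A p" and d: "d \<in> charts_at B (F p)"
  shows "snd (pushforward A B F x) d = coord_deriv c d F p (snd x c)"
proof -
  define c0 where "c0 = (SOME c. c \<in> charts_at A p)"
  have c0: "c0 \<in> charts_at A p"
    unfolding c0_def by (rule some_chart_at[OF charts_at_points[OF c]])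
  have "snd (pushforward A B F x) d = coord_deriv c0 d F p (snd x c0)"
    using d tangent_spaceD(1)[OF x]
    by (simp add: pushforward_def Let_def c0_def coord_deriv_def)
  also have "\<dots> = coord_deriv c0 d F p (coord_deriv c c0 (\<lambda>p. p) p (snd x c))"
    using tangent_space_coord_change[OF x c c0] by simp
  also have "\<dots> = coord_deriv c d F p (snd x c)"
    using coord_deriv_compose[OF A A B smooth_map_id[OF A] F c c0 d] by simp
  finally show ?thesis .
qed

lemma pushforward_in:
  assumes A: "smooth_atlas A" and B: "smooth_atlas B" and F: "smooth_map A B F"
    and x: "x \<in> tangent_space A p" and Fp: "F p \<in> points B"
  shows "pushforward A B F x \<in> tangent_space B (F p)"
proof -
  obtain c where c: "c \<in> charts_at A p"
    by (rule exE[OF charts_at_nonempty[OF tangent_spaceD(2)[OF x]]])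
  show ?thesis
  proof (rule tangent_spaceI)
    fix d e
    assume d: "d \<in> charts_at B (F p)" and e: "e \<in> charts_at B (F p)"
    show "snd (pushforward A B F x) e = coord_deriv d e (\<lambda>p. p) (F p) (snd (pushforward A B F x) d)"
      unfolding pushforward_coord[OF A B F x c d] pushforward_coord[OF A B F x c e]
      by (rule coord_deriv_compose[OF A B B F smooth_map_id[OF B] c d e])
  qed (use Fp tangent_spaceD(1)[OF x] in \<open>simp_all add: pushforward_def Let_def\<close>)
qed

text \<open>Requiring the whole curve to stay in one chart allows its other coordinate expressions
  to be rewritten globally. Straight lines in a fibre of \<open>TM\<close>, the curves of interest,
  satisfy this.\<close>

lemma velocity_eq:
  assumes B: "smooth_atlas B" and d: "d \<in> charts_at B (\<gamma> 0)"
    and \<gamma>: "\<And>t. \<gamma> t \<in> fst d" "((snd d \<circ> \<gamma>) has_vector_derivative v) (at 0)"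
  shows "velocity B \<gamma> = tvec_of B d (\<gamma> 0) v"
proof -
  have "vector_derivative (snd e \<circ> \<gamma>) (at 0) = coord_deriv d e (\<lambda>p. p) (\<gamma> 0) v"
    if e: "e \<in> charts_at B (\<gamma> 0)" for e
  proof -
    have "snd e \<circ> \<gamma> = (snd e \<circ> (\<lambda>p. p) \<circ> chart_inv d) \<circ> (snd d \<circ> \<gamma>)"
      using \<gamma>(1) by (auto simp: chart_inv_snd[OF B charts_atD(1)[OF d]])
    moreover have "((snd e \<circ> (\<lambda>p. p) \<circ> chart_inv d) \<circ> (snd d \<circ> \<gamma>) has_vector_derivative
        coord_deriv d e (\<lambda>p. p) (\<gamma> 0) v) (at 0)"
      using has_coord_deriv[OF B B smooth_map_id[OF B] d e]
      by (intro vector_derivative_diff_chain_within[OF \<gamma>(2)])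
        (simp add: has_derivative_at_withinI comp_def)
    ultimately show ?thesis
      by (simp add: vector_derivative_at)
  qed
  then show ?thesis
    by (auto simp: velocity_def tvec_of_def)
qed

lemma tv_zero_in:
  assumes A: "smooth_atlas A" and p: "p \<in> points A"
  shows "tv_zero p \<in> tangent_space A p"
proof (rule tangent_spaceI)
  fix c d
  assume c: "c \<in> charts_at A p" and d: "d \<in> charts_at A p"
  show "snd (tv_zero p) d = coord_deriv c d (\<lambda>p. p) p (snd (tv_zero p) c)"
    using linear_0[OF linear_coord_deriv[OF A A smooth_map_id[OF A] c d]] by (simp add: tv_zero_def)
qed (use p in \<open>simp_all add: tv_zero_def\<close>)

lemma tvec_of_add:
  assumes A: "smooth_atlas A" and c: "c \<in> charts_at A p"
  shows "tvec_of A c p (v + w) = tvec_of A c p v +\<^sub>T tvec_of A c p w"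
  by (rule tangent_space_eqI[OF tvec_of_in[OF A c] tv_add_in[OF A tvec_of_in[OF A c] tvec_of_in[OF A c]] c])
    (simp add: tvec_of_coord[OF A c])

lemma tvec_of_scale:
  assumes A: "smooth_atlas A" and c: "c \<in> charts_at A p"
  shows "tvec_of A c p (r *\<^sub>R v) = r *\<^sub>T tvec_of A c p v"
  by (rule tangent_space_eqI[OF tvec_of_in[OF A c] tv_scale_in[OF A tvec_of_in[OF A c]] c])
    (simp add: tvec_of_coord[OF A c])


section \<open>The tangent bundle as a manifold\<close>

lemma fst_tangent_chart: "fst (tangent_chart A c) = {u \<in> tangent_vectors A. fst u \<in> fst c}"
  by (simp add: tangent_chart_def)

lemma snd_tangent_chart: "snd (tangent_chart A c) u = (snd c (fst u), snd u c)"
  by (simp add: tangent_chart_def)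

lemma points_tangent_atlas: "points (tangent_atlas A) = tangent_vectors A"
proof -
  have "\<exists>c\<in>A. fst u \<in> fst c" if "u \<in> tangent_vectors A" for u
    using that tangent_spaceD(2)[of u A] by (auto simp: tangent_vectors_iff points_def)
  then show ?thesis
    unfolding points_def tangent_atlas_def by (auto simp: fst_tangent_chart)
qed

lemma tangent_chart_at:
  "u \<in> tangent_space A p \<Longrightarrow> c \<in> charts_at A p \<Longrightarrow> tangent_chart A c \<in> charts_at (tangent_atlas A) u"
  using tangent_spaceD(1)[of u A p] tangent_vectorsI[of u A p]
  by (auto simp: charts_at_def tangent_atlas_def fst_tangent_chart)

lemma chart_image_tangent_chart:
  fixes A :: "('m, 'e::euclidean_space) atlas"
  assumes A: "smooth_atlas A" and c: "c \<in> A"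
  shows "chart_image (tangent_chart A c) = chart_image c \<times> UNIV"
proof (intro equalityI subsetI)
  fix z
  assume "z \<in> chart_image c \<times> (UNIV :: 'e set)"
  then obtain p v where z: "p \<in> fst c" "z = (snd c p, v)"
    by (auto simp: chart_image_def)
  then have p: "c \<in> charts_at A p"
    using c by (simp add: charts_at_def)
  show "z \<in> chart_image (tangent_chart A c)"
    unfolding chart_image_def
  proof (rule image_eqI)
    show "z = snd (tangent_chart A c) (tvec_of A c p v)"
      using z by (simp add: snd_tangent_chart tvec_of_coord[OF A p])
    show "tvec_of A c p v \<in> fst (tangent_chart A c)"
      using z tangent_vectorsI[OF tvec_of_in[OF A p]] by (simp add: fst_tangent_chart)
  qed
qed (auto simp: chart_image_def fst_tangent_chart snd_tangent_chart)

lemma inj_on_tangent_chart: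
  assumes A: "smooth_atlas A" and c: "c \<in> A"
  shows "inj_on (snd (tangent_chart A c)) (fst (tangent_chart A c))"
proof (rule inj_onI)
  fix u v
  assume u: "u \<in> fst (tangent_chart A c)" and v: "v \<in> fst (tangent_chart A c)"
    and eq: "snd (tangent_chart A c) u = snd (tangent_chart A c) v"
  have "inj_on (snd c) (fst c)"
    using A c by (simp add: smooth_atlas_def)
  then have p: "fst u = fst v"
    using u v eq by (auto simp: fst_tangent_chart snd_tangent_chart inj_on_def)
  show "u = v"
    by (rule tangent_space_eqI[of _ A "fst u" _ c])
      (use u v eq p c in \<open>auto simp: fst_tangent_chart snd_tangent_chart tangent_vectors_iff charts_at_def\<close>)
qed

lemma chart_inv_tangent_chart:
  assumes A: "smooth_atlas A" and c: "c \<in> A" and x: "x \<in> chart_image c"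
  shows "chart_inv (tangent_chart A c) (x, v) = tvec_of A c (chart_inv c x) v"
proof -
  have p: "c \<in> charts_at A (chart_inv c x)"
    using c chart_inv_in[OF x] by (simp add: charts_at_def)
  show ?thesis
    unfolding chart_inv_def[of "tangent_chart A c"]
    by (rule inv_into_f_eq[OF inj_on_tangent_chart[OF A c]])
      (use tangent_vectorsI[OF tvec_of_in[OF A p]] in
        \<open>simp_all add: fst_tangent_chart snd_tangent_chart tvec_of_coord[OF A p] chart_inv_in[OF x]
          snd_chart_inv[OF x]\<close>)
qed

text \<open>If \<open>\<tau>\<close> is the transition map of two charts of \<open>M\<close>, the
  induced one on \<open>TM\<close> sends \<open>(x, v)\<close> to \<open>\<tau> x\<close> paired
  with the derivative of \<open>\<tau>\<close> at \<open>x\<close> applied to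
  \<open>v\<close>.\<close>

lemma smooth_atlas_tangent_atlas:
  fixes A :: "('m, 'e::euclidean_space) atlas"
  assumes A: "smooth_atlas A"
  shows "smooth_atlas (tangent_atlas A)"
proof -
  have 1: "inj_on (snd (tangent_chart A c)) (fst (tangent_chart A c))"
    "open (chart_image (tangent_chart A c))" if "c \<in> A" for c
    using inj_on_tangent_chart[OF A that] open_chart_image[OF A that]
    by (simp_all add: chart_image_tangent_chart[OF A that] open_Times)
  have 2: "open (overlap (tangent_chart A c) (tangent_chart A d)) \<and>
    smooth_on (overlap (tangent_chart A c) (tangent_chart A d))
      (snd (tangent_chart A d) \<circ> chart_inv (tangent_chart A c))"
    if c: "c \<in> A" and d: "d \<in> A" for c d
  proof -
    let ?\<tau> = "snd d \<circ> chart_inv c"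
    have ov: "overlap (tangent_chart A c) (tangent_chart A d) = overlap c d \<times> UNIV"
    proof (intro equalityI subsetI)
      fix z
      assume "z \<in> overlap c d \<times> (UNIV :: 'e set)"
      then obtain p v where z: "p \<in> fst c" "p \<in> fst d" "z = (snd c p, v)"
        by auto
      then have p: "c \<in> charts_at A p"
        using c by (simp add: charts_at_def)
      show "z \<in> overlap (tangent_chart A c) (tangent_chart A d)"
      proof (rule image_eqI)
        show "z = snd (tangent_chart A c) (tvec_of A c p v)"
          using z by (simp add: snd_tangent_chart tvec_of_coord[OF A p])
        show "tvec_of A c p v \<in> fst (tangent_chart A c) \<inter> fst (tangent_chart A d)"
          using z tangent_vectorsI[OF tvec_of_in[OF A p]] by (simp add: fst_tangent_chart)
      qed
    qed (auto simp: fst_tangent_chart snd_tangent_chart)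
    have op: "open (overlap c d \<times> (UNIV :: 'e set))"
      using open_overlap[OF A c d] by (simp add: open_Times)
    have sm: "smooth_on (overlap c d \<times> UNIV)
        (\<lambda>z. (?\<tau> (fst z), frechet_derivative ?\<tau> (at (fst z)) (snd z)))"
    proof (rule smooth_on_Pair[OF op])
      show "smooth_on (overlap c d \<times> (UNIV :: 'e set)) (\<lambda>z. ?\<tau> (fst z))"
        by (rule smooth_on_compose[OF smooth_on_transition[OF A c d] smooth_on_fst[OF op
                smooth_on_ident[OF op]] op open_overlap[OF A c d]]) auto
    qed (rule smooth_on_frechet_derivative_joint[OF smooth_on_transition[OF A c d] open_overlap[OF A c d]])
    have "smooth_on (overlap c d \<times> UNIV) (snd (tangent_chart A d) \<circ> chart_inv (tangent_chart A c))"
    proof (rule smooth_on_cong[OF op, THEN iffD1, OF _ sm])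
      fix z
      assume z: "z \<in> overlap c d \<times> (UNIV :: 'e set)"
      define p where "p = chart_inv c (fst z)"
      have x: "fst z \<in> chart_image c" "p \<in> fst d"
        using z unfolding in_overlap_iff[OF A c] mem_Times_iff p_def by simp_all
      have d': "d \<in> charts_at A p"
        using d x by (simp add: charts_at_def)
      have "chart_inv (tangent_chart A c) z = tvec_of A c p (snd z)"
        using chart_inv_tangent_chart[OF A c x(1), of "snd z"] by (simp add: p_def)
      then show "(?\<tau> (fst z), frechet_derivative ?\<tau> (at (fst z)) (snd z)) =
          (snd (tangent_chart A d) \<circ> chart_inv (tangent_chart A c)) z"
        using d' snd_chart_inv[OF x(1)]
        by (simp add: snd_tangent_chart tvec_of_def coord_deriv_id p_def)
    qed
    then show ?thesis
      using op ov by simp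
  qed
  show ?thesis
    unfolding smooth_atlas_def tangent_atlas_def using 1 2 by blast
qed

lemma smooth_map_fst:
  assumes A: "smooth_atlas A"
  shows "smooth_map (tangent_atlas A) A fst"
  unfolding smooth_map_def
proof
  fix u
  assume "u \<in> points (tangent_atlas A)"
  then have u: "u \<in> tangent_space A (fst u)"
    by (simp add: points_tangent_atlas tangent_vectors_iff)
  obtain c where c: "c \<in> charts_at A (fst u)"
    by (rule exE[OF charts_at_nonempty[OF tangent_spaceD(2)[OF u]]])
  let ?W = "chart_image (tangent_chart A c)"
  note c' = charts_atD[OF c] and tc = tangent_chart_at[OF u c]
  have op: "open ?W"
    by (rule open_chart_image[OF smooth_atlas_tangent_atlas[OF A] charts_atD(1)[OF tc]])
  have inv: "fst (chart_inv (tangent_chart A c) z) = chart_inv c (fst z) \<and> fst z \<in> chart_image c"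
    if "z \<in> ?W" for z
    using that chart_inv_tangent_chart[OF A c'(1), of "fst z" "snd z"]
    by (simp add: chart_image_tangent_chart[OF A c'(1)] mem_Times_iff)
  have "smooth_on ?W (snd c \<circ> fst \<circ> chart_inv (tangent_chart A c))"
    by (rule smooth_on_cong[OF op, THEN iffD1, OF _ smooth_on_fst[OF op smooth_on_ident[OF op]]])
      (simp add: inv snd_chart_inv)
  moreover have "\<forall>z\<in>?W. fst (chart_inv (tangent_chart A c) z) \<in> fst c"
    by (simp add: inv chart_inv_in)
  ultimately show "\<exists>c\<in>charts_at (tangent_atlas A) u. \<exists>d\<in>charts_at A (fst u). \<exists>W. open W \<and> snd c u \<in> W \<and>
      W \<subseteq> chart_image c \<and> (\<forall>x\<in>W. fst (chart_inv c x) \<in> fst d) \<and> smooth_on W (snd d \<circ> fst \<circ> chart_inv c)"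
    by (intro bexI[OF _ tc] bexI[OF _ c] exI[of _ ?W] conjI op subset_refl
        snd_in_chart_image[OF charts_atD(2)[OF tc]])
qed

lemma coord_deriv_fst:
  assumes A: "smooth_atlas A" and u: "u \<in> tangent_space A p" and c: "c \<in> charts_at A p"
  shows "coord_deriv (tangent_chart A c) c fst u = fst"
proof -
  note tc = tangent_chart_at[OF u c] and TA = smooth_atlas_tangent_atlas[OF A]
  show ?thesis
  proof (rule coord_deriv_eqI[OF TA tc open_chart_image[OF TA charts_atD(1)[OF tc]]
        snd_in_chart_image[OF charts_atD(2)[OF tc]]])
    show "(snd c \<circ> fst \<circ> chart_inv (tangent_chart A c)) z = fst z"
      if "z \<in> chart_image (tangent_chart A c)" for z
      using that chart_inv_tangent_chart[OF A charts_atD(1)[OF c], of "fst z" "snd z"]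
      by (simp add: chart_image_tangent_chart[OF A charts_atD(1)[OF c]] mem_Times_iff snd_chart_inv)
  qed (rule bounded_linear_imp_has_derivative[OF bounded_linear_fst])
qed

text \<open>In the induced chart the line through \<open>u\<close> has constant base coordinates and
  affine fibre coordinates, so its velocity has only a fibre part.\<close>

lemma vertical_lift_eq:
  assumes A: "smooth_atlas A" and u: "u \<in> tangent_space A p" and v: "v \<in> tangent_space A p"
    and c: "c \<in> charts_at A p"
  shows "vertical_lift A u v = tvec_of (tangent_atlas A) (tangent_chart A c) u (0, snd v c)"
proof -
  let ?\<gamma> = "\<lambda>t. u +\<^sub>T t *\<^sub>T v"
  have 0: "?\<gamma> 0 = u"
    by (rule prod_eqI) (auto simp: fun_eq_iff)
  have "velocity (tangent_atlas A) ?\<gamma> =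
      tvec_of (tangent_atlas A) (tangent_chart A c) (?\<gamma> 0) (0, snd v c)"
  proof (rule velocity_eq[OF smooth_atlas_tangent_atlas[OF A]])
    show "tangent_chart A c \<in> charts_at (tangent_atlas A) (?\<gamma> 0)"
      unfolding 0 by (rule tangent_chart_at[OF u c])
    show "?\<gamma> t \<in> fst (tangent_chart A c)" for t
      by (rule charts_atD(2)[OF tangent_chart_at[OF tv_add_in[OF A u tv_scale_in[OF A v]] c]])
    have "((\<lambda>t. (snd c (fst u), snd u c + t *\<^sub>R snd v c)) has_vector_derivative (0, snd v c)) (at 0)"
      by (auto intro!: derivative_eq_intros has_vector_derivative_Pair)
    then show "(snd (tangent_chart A c) \<circ> ?\<gamma> has_vector_derivative (0, snd v c)) (at 0)"
      by (simp add: snd_tangent_chart comp_def)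
  qed
  then show ?thesis
    unfolding vertical_lift_def 0 .
qed

lemma vertical_lift_in:
  assumes A: "smooth_atlas A" and u: "u \<in> tangent_space A p" and v: "v \<in> tangent_space A p"
  shows "vertical_lift A u v \<in> tangent_space (tangent_atlas A) u"
proof -
  obtain c where c: "c \<in> charts_at A p"
    by (rule exE[OF charts_at_nonempty[OF tangent_spaceD(2)[OF u]]])
  show ?thesis
    unfolding vertical_lift_eq[OF A u v c]
    by (rule tvec_of_in[OF smooth_atlas_tangent_atlas[OF A] tangent_chart_at[OF u c]])
qed

lemma vertical_lift_coord:
  assumes A: "smooth_atlas A" and u: "u \<in> tangent_space A p" and v: "v \<in> tangent_space A p"
    and c: "c \<in> charts_at A p"
  shows "snd (vertical_lift A u v) (tangent_chart A c) = (0, snd v c)"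
  unfolding vertical_lift_eq[OF A u v c]
  by (rule tvec_of_coord[OF smooth_atlas_tangent_atlas[OF A] tangent_chart_at[OF u c]])

text \<open>In induced charts the projection of \<open>TM\<close> to \<open>M\<close> is the first
  projection of \<open>'e \<times> 'e\<close>, which is its own derivative. One chart is enough to
  test for the kernel.\<close>

lemma in_vertical_bundle_iff:
  assumes A: "smooth_atlas A" and u: "u \<in> tangent_space A p" and c: "c \<in> charts_at A p"
    and \<xi>: "\<xi> \<in> tangent_space (tangent_atlas A) u"
  shows "\<xi> \<in> vb_total (vertical_bundle A) \<longleftrightarrow> fst (snd \<xi> (tangent_chart A c)) = 0"
proof -
  note TA = smooth_atlas_tangent_atlas[OF A]
  note p = tangent_spaceD(1,2)[OF u]
  have c': "c \<in> charts_at A (fst u)"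
    using c p by simp
  have in1: "pushforward (tangent_atlas A) A fst \<xi> \<in> tangent_space A (fst u)"
    by (rule pushforward_in[OF TA A smooth_map_fst[OF A] \<xi>]) (simp add: p)
  have in2: "tv_zero (fst u) \<in> tangent_space A (fst u)"
    using tv_zero_in[OF A p(2)] p by simp
  have "snd (pushforward (tangent_atlas A) A fst \<xi>) c = fst (snd \<xi> (tangent_chart A c))"
    using pushforward_coord[OF TA A smooth_map_fst[OF A] \<xi> tangent_chart_at[OF u c] c']
    by (simp add: coord_deriv_fst[OF A u c])
  then have "pushforward (tangent_atlas A) A fst \<xi> = tv_zero (fst u) \<longleftrightarrow>
      fst (snd \<xi> (tangent_chart A c)) = 0"
    using tangent_space_eqI[OF in1 in2 c'] by (auto simp: tv_zero_def)
  then show ?thesis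
    using tangent_vectorsI[OF \<xi>] tangent_spaceD(1)[OF \<xi>] by (simp add: vertical_bundle_def)
qed


section \<open>Vector fields with prescribed local coordinates\<close>

text \<open>The abstraction \<open>topology\<close> can be undone only after the predicate is shown
  to define a topology; injectivity of the charts makes images commute with intersections.\<close>

lemma openin_atlas_topology:
  assumes A: "smooth_atlas A"
  shows "openin (atlas_topology A) U \<longleftrightarrow> U \<subseteq> points A \<and> (\<forall>c\<in>A. open (snd c ` (U \<inter> fst c)))"
proof -
  have "istopology (\<lambda>U. U \<subseteq> points A \<and> (\<forall>c\<in>A. open (snd c ` (U \<inter> fst c))))"
    unfolding istopology_def
  proof (intro conjI allI impI ballI)
    fix S T c
    assume S: "S \<subseteq> points A \<and> (\<forall>c\<in>A. open (snd c ` (S \<inter> fst c)))"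
      and T: "T \<subseteq> points A \<and> (\<forall>c\<in>A. open (snd c ` (T \<inter> fst c)))" and c: "c \<in> A"
    have "inj_on (snd c) (fst c)"
      using A c by (simp add: smooth_atlas_def)
    then have "snd c ` (S \<inter> T \<inter> fst c) = snd c ` (S \<inter> fst c) \<inter> snd c ` (T \<inter> fst c)"
      by (auto simp: inj_on_def)
    then show "open (snd c ` (S \<inter> T \<inter> fst c))"
      using S T c by (simp add: open_Int)
  next
    fix \<K> c
    assume K: "\<forall>K\<in>\<K>. K \<subseteq> points A \<and> (\<forall>c\<in>A. open (snd c ` (K \<inter> fst c)))" and c: "c \<in> A"
    have "snd c ` (\<Union>\<K> \<inter> fst c) = (\<Union>K\<in>\<K>. snd c ` (K \<inter> fst c))"
      by auto
    then show "open (snd c ` (\<Union>\<K> \<inter> fst c))"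
      using K c by (simp add: open_UN)
  qed blast+
  then show ?thesis
    unfolding atlas_topology_def by (simp add: topology_inverse')
qed

lemma topspace_atlas_topology:
  assumes A: "smooth_atlas A"
  shows "topspace (atlas_topology A) = points A"
proof (rule equalityI)
  show "topspace (atlas_topology A) \<subseteq> points A"
    using openin_topspace[of "atlas_topology A"] unfolding openin_atlas_topology[OF A] by blast
  have "snd c ` (points A \<inter> fst c) = chart_image c" if "c \<in> A" for c
    using that by (auto simp: chart_image_def points_def)
  then have "openin (atlas_topology A) (points A)"
    unfolding openin_atlas_topology[OF A] using open_chart_image[OF A] by simp
  then show "points A \<subseteq> topspace (atlas_topology A)"
    by (rule openin_subset)
qed

text \<open>The inverse chart is continuous, so it maps \<open>K\<close> to a compact set, which is
  closed because the manifold is Hausdorff. Without closedness a field supported there could fail to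
  be smooth at points outside the chart domain.\<close>

lemma closedin_chart_inv_image:
  assumes M: "smooth_manifold A" and c: "c \<in> A" and K: "compact K" "K \<subseteq> chart_image c"
  shows "closedin (atlas_topology A) (chart_inv c ` K)"
proof -
  note A = smooth_atlas_of_manifold[OF M]
  have "continuous_map (top_of_set (chart_image c)) (atlas_topology A) (chart_inv c)"
    unfolding continuous_map_def
  proof (intro conjI allI impI)
    show "chart_inv c \<in> topspace (top_of_set (chart_image c)) \<rightarrow> topspace (atlas_topology A)"
      using c by (auto simp: topspace_atlas_topology[OF A] points_def chart_inv_in)
    fix U
    assume U: "openin (atlas_topology A) U"
    have "{x \<in> chart_image c. chart_inv c x \<in> U} = snd c ` (U \<inter> fst c)"
    proof (intro equalityI subsetI)
      fix x
      assume "x \<in> {x \<in> chart_image c. chart_inv c x \<in> U}"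
      then show "x \<in> snd c ` (U \<inter> fst c)"
        by (intro image_eqI[of _ _ "chart_inv c x"]) (simp_all add: snd_chart_inv chart_inv_in)
    qed (auto simp: chart_inv_snd[OF A c] snd_in_chart_image)
    moreover have "open (snd c ` (U \<inter> fst c))"
      using U c unfolding openin_atlas_topology[OF A] by blast
    ultimately show "openin (top_of_set (chart_image c))
        {x \<in> topspace (top_of_set (chart_image c)). chart_inv c x \<in> U}"
      using open_chart_image[OF A c] by (simp add: openin_open_eq) (auto simp: chart_image_def)
  qed
  moreover have "compactin (top_of_set (chart_image c)) K"
    using K by (simp add: compactin_subtopology)
  ultimately have "compactin (atlas_topology A) (chart_inv c ` K)"
    by (rule image_compactin[rotated])
  then show ?thesis
    using M by (intro compactin_imp_closedin) (simp_all add: smooth_manifold_def)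
qed

text \<open>The coordinate expression of a section is \<open>x\<close> paired with its fibre part,
  so only the fibre part needs checking, in a chart that may be chosen separately at each
  point.\<close>

lemma smooth_map_sectionI:
  assumes A: "smooth_atlas A" and X: "\<And>p. p \<in> points A \<Longrightarrow> X p \<in> tangent_space A p"
    and ex: "\<And>p. p \<in> points A \<Longrightarrow> \<exists>c\<in>charts_at A p. \<exists>W. open W \<and> snd c p \<in> W \<and> W \<subseteq> chart_image c \<and>
      smooth_on W (\<lambda>x. snd (X (chart_inv c x)) c)"
  shows "smooth_map A (tangent_atlas A) X"
  unfolding smooth_map_def
proof
  fix p
  assume p: "p \<in> points A"
  from ex[OF p] obtain c W where c: "c \<in> charts_at A p" and W: "open W" "snd c p \<in> W" "W \<subseteq> chart_image c"
    "smooth_on W (\<lambda>x. snd (X (chart_inv c x)) c)"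
    by (elim bexE exE conjE)
  have Xq: "X (chart_inv c x) \<in> tangent_space A (chart_inv c x)" "chart_inv c x \<in> fst c" if "x \<in> W" for x
  proof -
    show "chart_inv c x \<in> fst c"
      using that W(3) by (intro chart_inv_in) blast
    then show "X (chart_inv c x) \<in> tangent_space A (chart_inv c x)"
      using charts_atD(1)[OF c] unfolding points_def by (intro X[unfolded points_def] UN_I)
  qed
  have "smooth_on W (snd (tangent_chart A c) \<circ> X \<circ> chart_inv c)"
  proof (rule smooth_on_cong[OF W(1), THEN iffD1, OF _ smooth_on_Pair[OF W(1) smooth_on_ident[OF W(1)] W(4)]])
    fix x
    assume x: "x \<in> W"
    then have "x \<in> chart_image c"
      using W(3) by blast
    then show "(x, snd (X (chart_inv c x)) c) = (snd (tangent_chart A c) \<circ> X \<circ> chart_inv c) x"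
      by (simp add: snd_tangent_chart tangent_spaceD(1)[OF Xq(1)[OF x]] snd_chart_inv)
  qed
  moreover have "\<forall>x\<in>W. X (chart_inv c x) \<in> fst (tangent_chart A c)"
    using tangent_vectorsI[OF Xq(1)] tangent_spaceD(1)[OF Xq(1)] Xq(2) by (simp add: fst_tangent_chart)
  ultimately show "\<exists>c\<in>charts_at A p. \<exists>d\<in>charts_at (tangent_atlas A) (X p). \<exists>W. open W \<and> snd c p \<in> W \<and>
      W \<subseteq> chart_image c \<and> (\<forall>x\<in>W. X (chart_inv c x) \<in> fst d) \<and> smooth_on W (snd d \<circ> X \<circ> chart_inv c)"
    by (intro bexI[OF _ c] bexI[OF _ tangent_chart_at[OF X[OF p] c]] exI[of _ W] conjI W)
qed

lemma vector_fieldsD: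
  assumes "X \<in> vector_fields A"
  shows "p \<in> points A \<Longrightarrow> X p \<in> tangent_space A p" "smooth_map A (tangent_atlas A) X"
  using assms by (auto simp: vector_fields_def)

text \<open>A section maps the domain of \<open>c\<close> into that of the induced chart, so the
  open set supplied by \<open>smooth_map_charts\<close> is the whole chart image.\<close>

lemma smooth_on_vector_field_coord:
  assumes A: "smooth_atlas A" and X: "X \<in> vector_fields A" and c: "c \<in> A"
  shows "smooth_on (chart_image c) (\<lambda>x. snd (X (chart_inv c x)) c)"
proof -
  note TA = smooth_atlas_tangent_atlas[OF A] and op = open_chart_image[OF A c]
  have "X (chart_inv c x) \<in> fst (tangent_chart A c)" if "x \<in> chart_image c" for x
  proof -
    have "c \<in> charts_at A (chart_inv c x)"
      using c chart_inv_in[OF that] by (simp add: charts_at_def)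
    then show ?thesis
      by (intro charts_atD(2)[OF tangent_chart_at[OF vector_fieldsD(1)[OF X]]] charts_at_points)
  qed
  then have eq: "{x \<in> chart_image c. X (chart_inv c x) \<in> fst (tangent_chart A c)} = chart_image c"
    by blast
  have "tangent_chart A c \<in> tangent_atlas A"
    using c by (simp add: tangent_atlas_def)
  then have "smooth_on (chart_image c) (snd (tangent_chart A c) \<circ> X \<circ> chart_inv c)"
    using smooth_map_charts(2)[OF A TA vector_fieldsD(2)[OF X] c, of "tangent_chart A c"]
    unfolding eq by blast
  from smooth_on_snd[OF op this] show ?thesis
    by (simp add: snd_tangent_chart)
qed

text \<open>A constant coordinate field times a cut-off function, extended by zero vectors; the
  restriction to \<open>points A\<close> matches the extensionality required in
  \<open>vector_fields\<close>.\<close>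

definition chart_field ::
  "('m, 'e::euclidean_space) atlas \<Rightarrow> ('m, 'e) chart \<Rightarrow> ('e \<Rightarrow> real) \<Rightarrow> 'e \<Rightarrow> 'm \<Rightarrow> ('m, 'e) tvec"
  where "chart_field A c \<psi> v = (\<lambda>q\<in>points A.
    if q \<in> fst c then tvec_of A c q (\<psi> (snd c q) *\<^sub>R v) else tv_zero q)"

lemma chart_field_in_vector_fields:
  assumes M: "smooth_manifold A" and c: "c \<in> A" and \<psi>: "smooth_on UNIV \<psi>"
    and K: "compact K" "K \<subseteq> chart_image c" "\<And>x. x \<notin> K \<Longrightarrow> \<psi> x = 0"
  shows "chart_field A c \<psi> v \<in> vector_fields A"
proof -
  note A = smooth_atlas_of_manifold[OF M]
  let ?E = "chart_field A c \<psi> v"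
  have in_c: "c \<in> charts_at A q" if "q \<in> fst c" for q
    using c that by (simp add: charts_at_def)
  have E: "?E q \<in> tangent_space A q" if "q \<in> points A" for q
    using that tvec_of_in[OF A in_c] tv_zero_in[OF A] by (simp add: chart_field_def)
  \<comment> \<open>Inside the chart the vanishing of \<open>\<psi>\<close> off \<open>K\<close>
    gives zero coordinates, hence the zero vector, in agreement with the value prescribed outside
    the chart.\<close>
  have zero: "?E q = tv_zero q" if "q \<in> points A" "q \<notin> chart_inv c ` K" for q
  proof (cases "q \<in> fst c")
    case True
    then have "snd c q \<notin> K"
      using that(2) chart_inv_snd[OF A c True] by (metis imageI)
    then show ?thesis
      using True that K(3)[of "snd c q"]
      by (intro tangent_space_eqI[OF E tv_zero_in[OF A] in_c[OF True]])
        (simp_all add: chart_field_def tvec_of_coord[OF A in_c[OF True]] tv_zero_def)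
  qed (use that in \<open>simp add: chart_field_def\<close>)
  have "smooth_map A (tangent_atlas A) ?E"
  proof (rule smooth_map_sectionI[OF A E])
    fix p
    assume p: "p \<in> points A"
    show "\<exists>c\<in>charts_at A p. \<exists>W. open W \<and> snd c p \<in> W \<and> W \<subseteq> chart_image c \<and>
      smooth_on W (\<lambda>x. snd (?E (chart_inv c x)) c)"
    proof (cases "p \<in> fst c")
      case True
      note op = open_chart_image[OF A c]
      have sm: "smooth_on (chart_image c) (\<lambda>x. \<psi> x *\<^sub>R v)"
        by (intro smooth_on_scaleR smooth_on_const op smooth_on_subset[OF \<psi>]) simp
      have "smooth_on (chart_image c) (\<lambda>x. snd (?E (chart_inv c x)) c)"
      proof (rule smooth_on_cong[OF op, THEN iffD1, OF _ sm])
        fix x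
        assume x: "x \<in> chart_image c"
        show "\<psi> x *\<^sub>R v = snd (?E (chart_inv c x)) c"
          using in_c[OF chart_inv_in[OF x]]
          by (simp add: chart_field_def chart_inv_in[OF x] snd_chart_inv[OF x] charts_at_points
              tvec_of_coord[OF A])
      qed
      then show ?thesis
        by (intro bexI[OF _ in_c[OF True]] exI[of _ "chart_image c"] conjI op subset_refl
            snd_in_chart_image[OF True])
    next
      case False
      obtain d where d: "d \<in> charts_at A p"
        by (rule exE[OF charts_at_nonempty[OF p]])
      note d' = charts_atD[OF d]
      have "chart_inv c ` K \<subseteq> fst c"
        by (intro image_subsetI chart_inv_in subsetD[OF K(2)])
      then have pK: "p \<notin> chart_inv c ` K"
        using False by blast
      \<comment> \<open>A point outside the chart domain has this open complement as a
        neighbourhood, and there the field vanishes identically, so smoothness can be tested in any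
        chart \<open>d\<close>.\<close>
      have "openin (atlas_topology A) (points A - chart_inv c ` K)"
        using closedin_chart_inv_image[OF M c K(1,2)]
        by (simp add: closedin_def topspace_atlas_topology[OF A])
      define W where "W = snd d ` ((points A - chart_inv c ` K) \<inter> fst d)"
      have W: "open W"
        using \<open>openin _ _\<close> d'(1) unfolding W_def openin_atlas_topology[OF A] by blast
      have sub: "W \<subseteq> chart_image d"
        by (auto simp: W_def chart_image_def)
      have "smooth_on W (\<lambda>x. snd (?E (chart_inv d x)) d)"
      proof (rule smooth_on_cong[OF W, THEN iffD1, OF _ smooth_on_const[OF W]])
        fix x
        assume "x \<in> W"
        then obtain q where "q \<in> points A" "q \<notin> chart_inv c ` K" "q \<in> fst d" "x = snd d q"
          unfolding W_def by blast
        then show "0 = snd (?E (chart_inv d x)) d"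
          using chart_inv_snd[OF A d'(1), of q] zero[of q] by (simp add: tv_zero_def)
      qed
      moreover have "snd d p \<in> W"
        using p pK d'(2) by (auto simp: W_def)
      ultimately show ?thesis
        by (intro bexI[OF _ d] exI[of _ W] conjI W sub)
    qed
  qed
  then show ?thesis
    using E by (simp add: vector_fields_def PiE_iff extensional_def) (simp add: chart_field_def)
qed

section \<open>The connection map in coordinates\<close>

lemma dir_deriv_const: "dir_deriv A x (\<lambda>_. r) = 0"
proof -
  have "((\<lambda>_. r) \<circ> f) = (\<lambda>_. r)" for f :: "'x \<Rightarrow> 'y"
    by auto
  then show ?thesis
    by (simp add: dir_deriv_def Let_def)
qed

lemma affine_connectionD:
  assumes "affine_connection A D"
  shows "\<lbrakk>Y \<in> vector_fields A; x \<in> tangent_space A p\<rbrakk> \<Longrightarrow> D x Y \<in> tangent_space A p"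
    and "\<lbrakk>Y \<in> vector_fields A; x \<in> tangent_space A p; x' \<in> tangent_space A p\<rbrakk> \<Longrightarrow>
      D (x +\<^sub>T x') Y = D x Y +\<^sub>T D x' Y"
    and "\<lbrakk>Y \<in> vector_fields A; x \<in> tangent_space A p\<rbrakk> \<Longrightarrow> D (r *\<^sub>T x) Y = r *\<^sub>T D x Y"
    and "\<lbrakk>Y \<in> vector_fields A; Z \<in> vector_fields A; x \<in> tangent_space A p\<rbrakk> \<Longrightarrow>
      D x (\<lambda>q\<in>points A. Y q +\<^sub>T Z q) = D x Y +\<^sub>T D x Z"
    and "\<lbrakk>Y \<in> vector_fields A; smooth_fun A f; x \<in> tangent_space A p\<rbrakk> \<Longrightarrow>
      D x (\<lambda>q\<in>points A. f q *\<^sub>T Y q) = dir_deriv A x f *\<^sub>T Y p +\<^sub>T f p *\<^sub>T D x Y"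
    and "\<lbrakk>X \<in> vector_fields A; Y \<in> vector_fields A\<rbrakk> \<Longrightarrow>
      (\<lambda>p\<in>points A. D (X p) Y) \<in> vector_fields A"
proof -
  note * = assms[unfolded affine_connection_def]
  note 1 = conjunct1[OF *] and 2 = conjunct1[OF conjunct2[OF *]]
    and 3 = conjunct1[OF conjunct2[OF conjunct2[OF *]]]
    and 4 = conjunct2[OF conjunct2[OF conjunct2[OF *]]]
  note p = tangent_spaceD(2)
  show "\<lbrakk>Y \<in> vector_fields A; x \<in> tangent_space A p\<rbrakk> \<Longrightarrow> D x Y \<in> tangent_space A p"
    using 1 p[of x A p] by simp
  show "\<lbrakk>Y \<in> vector_fields A; x \<in> tangent_space A p; x' \<in> tangent_space A p\<rbrakk> \<Longrightarrow>
      D (x +\<^sub>T x') Y = D x Y +\<^sub>T D x' Y"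
    using 1 p[of x A p] by simp
  show "\<lbrakk>Y \<in> vector_fields A; x \<in> tangent_space A p\<rbrakk> \<Longrightarrow> D (r *\<^sub>T x) Y = r *\<^sub>T D x Y"
    using 1 p[of x A p] by simp
  show "\<lbrakk>Y \<in> vector_fields A; Z \<in> vector_fields A; x \<in> tangent_space A p\<rbrakk> \<Longrightarrow>
      D x (\<lambda>q\<in>points A. Y q +\<^sub>T Z q) = D x Y +\<^sub>T D x Z"
    using 2 p[of x A p] by simp
  show "\<lbrakk>Y \<in> vector_fields A; smooth_fun A f; x \<in> tangent_space A p\<rbrakk> \<Longrightarrow>
      D x (\<lambda>q\<in>points A. f q *\<^sub>T Y q) = dir_deriv A x f *\<^sub>T Y p +\<^sub>T f p *\<^sub>T D x Y"
    using 3 p[of x A p] by simp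
  show "\<lbrakk>X \<in> vector_fields A; Y \<in> vector_fields A\<rbrakk> \<Longrightarrow>
      (\<lambda>p\<in>points A. D (X p) Y) \<in> vector_fields A"
    using 4 by simp
qed

text \<open>Homogeneity in the field argument is the Leibniz rule for a constant function, whose
  directional derivative is 0.\<close>

lemma affine_connection_scale:
  assumes A: "smooth_atlas A" and D: "affine_connection A D"
    and Y: "Y \<in> vector_fields A" and x: "x \<in> tangent_space A p"
  shows "D x (\<lambda>q\<in>points A. r *\<^sub>T Y q) = r *\<^sub>T D x Y"
proof -
  have "smooth_fun A (\<lambda>_. r)"
    using open_chart_image[OF A] by (simp add: smooth_fun_def comp_def smooth_on_const)
  then have "D x (\<lambda>q\<in>points A. r *\<^sub>T Y q) = 0 *\<^sub>T Y p +\<^sub>T r *\<^sub>T D x Y"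
    using affine_connectionD(5)[OF D Y _ x, of "\<lambda>_. r"] by (simp add: dir_deriv_const)
  also have "\<dots> = r *\<^sub>T D x Y"
    using tangent_spaceD(1)[OF vector_fieldsD(1)[OF Y tangent_spaceD(2)[OF x]]]
      tangent_spaceD(1)[OF affine_connectionD(1)[OF D Y x]]
    by (intro prod_eqI) (simp_all add: fun_eq_iff)
  finally show ?thesis .
qed

text \<open>An equality of functions, restriction included, in exactly the form in which
  \<open>affine_connection\<close> states additivity in its field argument. It makes the covariant
  derivative linear in the constant coordinates of the field.\<close>

lemma chart_field_add:
  assumes A: "smooth_atlas A" and c: "c \<in> A"
  shows "chart_field A c \<psi> (v + w) = (\<lambda>q\<in>points A. chart_field A c \<psi> v q +\<^sub>T chart_field A c \<psi> w q)"
proof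
  fix q
  show "chart_field A c \<psi> (v + w) q = (\<lambda>q\<in>points A. chart_field A c \<psi> v q +\<^sub>T chart_field A c \<psi> w q) q"
  proof (cases "q \<in> fst c")
    case True
    then have "c \<in> charts_at A q"
      using c by (simp add: charts_at_def)
    then show ?thesis
      using True by (simp add: chart_field_def scaleR_add_right tvec_of_add[OF A])
  qed (simp add: chart_field_def tv_zero_def tv_add_def)
qed

lemma chart_field_scale:
  assumes A: "smooth_atlas A" and c: "c \<in> A"
  shows "chart_field A c \<psi> (r *\<^sub>R v) = (\<lambda>q\<in>points A. r *\<^sub>T chart_field A c \<psi> v q)"
proof
  fix q
  show "chart_field A c \<psi> (r *\<^sub>R v) q = (\<lambda>q\<in>points A. r *\<^sub>T chart_field A c \<psi> v q) q"
  proof (cases "q \<in> fst c")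
    case True
    then have "c \<in> charts_at A q"
      using c by (simp add: charts_at_def)
    then show ?thesis
      using True tvec_of_scale[OF A, of c q r "\<psi> (snd c q) *\<^sub>R v"]
      by (simp add: chart_field_def mult.commute)
  qed (simp add: chart_field_def tv_zero_def tv_scale_def)
qed

text \<open>The base vector \<open>u\<close> of the lift is extended by a field with constant coordinates near the point,
  cut off by a bump function. Then \<open>\<Gamma>\<close> only involves covariant derivatives of such globally defined
  fields along each other, so that no locality property of the connection is needed.\<close>

lemma connection_map_coords:
  fixes A :: "('m, 'e::euclidean_space) atlas"
  assumes M: "smooth_manifold A" and D: "affine_connection A D" and C: "connection_map A D C"
    and c: "c \<in> A" and x0: "x0 \<in> chart_image c"
  obtains B \<Gamma> where "open B" "x0 \<in> B" "B \<subseteq> chart_image c"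
    and "smooth_on (B \<times> UNIV) (\<lambda>z. \<Gamma> (fst z) (fst (snd z)) (snd (snd z)))"
    and "\<And>x v. x \<in> B \<Longrightarrow> linear (\<Gamma> x v)"
    and "\<And>q u x. \<lbrakk>q \<in> fst c; snd c q \<in> B; u \<in> tangent_space A q; x \<in> tangent_space A q\<rbrakk> \<Longrightarrow>
      C u x \<in> tangent_space (tangent_atlas A) u \<and>
      snd (C u x) (tangent_chart A c) = (snd x c, - \<Gamma> (snd c q) (snd u c) (snd x c))"
proof -
  note A = smooth_atlas_of_manifold[OF M]
  note TA = smooth_atlas_tangent_atlas[OF A] and op = open_chart_image[OF A c]
  obtain \<psi> :: "'e \<Rightarrow> real" and B K where \<psi>: "smooth_on UNIV \<psi>" "open B" "x0 \<in> B" "B \<subseteq> chart_image c"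
    "compact K" "K \<subseteq> chart_image c" "\<And>x. x \<in> B \<Longrightarrow> \<psi> x = 1" "\<And>x. x \<notin> K \<Longrightarrow> \<psi> x = 0"
    using smooth_bump_exists[OF op x0] by metis
  define E where "E = chart_field A c \<psi>"
  have E: "E v \<in> vector_fields A" for v
    unfolding E_def by (rule chart_field_in_vector_fields[OF M c \<psi>(1,5,6,8)])
  have in_c: "c \<in> charts_at A q" if "q \<in> fst c" for q
    using c that by (simp add: charts_at_def)
  have E_eq: "E v q = tvec_of A c q v" if "q \<in> fst c" "snd c q \<in> B" for q v
    using that charts_at_points[OF in_c[OF that(1)]] by (simp add: E_def chart_field_def \<psi>(7))
  \<comment> \<open>The inner vectors hold the Christoffel symbols. \<open>v\<close> stands for the
    coordinates of the base vector and \<open>a\<close> for those of the lifted vector; over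
    \<open>B\<close> the field \<open>E j\<close> is the \<open>j\<close>-th coordinate field, as
    \<open>\<psi>\<close> is 1 there.\<close>
  define \<Gamma> where "\<Gamma> x v a = (\<Sum>i\<in>Basis. \<Sum>j\<in>Basis. (v \<bullet> i) *\<^sub>R (a \<bullet> j) *\<^sub>R
      snd (D (E j (chart_inv c x)) (E i)) c)" for x v a
  have lin: "linear (\<Gamma> x v)" for x v
    by (rule linearI)
      (simp_all add: \<Gamma>_def inner_add_left inner_scaleR_left scaleR_add_left scaleR_add_right
        sum.distrib scaleR_sum_right mult.left_commute)
  have \<Gamma>: "snd (D x (E (snd u c))) c = \<Gamma> (snd c q) (snd u c) (snd x c)"
    if q: "q \<in> fst c" "snd c q \<in> B" and x: "x \<in> tangent_space A q" for q u x
  proof -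
    note cq = in_c[OF q(1)]
    \<comment> \<open>Bilinearity has two sources: the field argument of \<open>D\<close> gives
      linearity in the coordinates of \<open>u\<close>, the direction argument gives linearity in
      those of \<open>x\<close>. Expanding both in \<open>Basis\<close> produces
      \<open>\<Gamma>\<close>.\<close>
    have "linear (\<lambda>v. snd (D y (E v)) c)" if "y \<in> tangent_space A q" for y
    proof (rule linearI)
      show "snd (D y (E (v + w))) c = snd (D y (E v)) c + snd (D y (E w)) c" for v w
        using affine_connectionD(4)[OF D E E that, of v w]
        by (simp add: E_def chart_field_add[OF A c])
      show "snd (D y (E (r *\<^sub>R v))) c = r *\<^sub>R snd (D y (E v)) c" for r v
        using affine_connection_scale[OF A D E that, of r v]
        by (simp add: E_def chart_field_scale[OF A c])
    qed
    note lin1 = linear_euclidean_expand[OF this]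
    have lin2: "linear (\<lambda>a. snd (D (tvec_of A c q a) (E v)) c)" for v
    proof (rule linearI)
      show "snd (D (tvec_of A c q (a + b)) (E v)) c =
          snd (D (tvec_of A c q a) (E v)) c + snd (D (tvec_of A c q b) (E v)) c" for a b
        unfolding tvec_of_add[OF A cq]
          affine_connectionD(2)[OF D E tvec_of_in[OF A cq] tvec_of_in[OF A cq]] by simp
      show "snd (D (tvec_of A c q (r *\<^sub>R a)) (E v)) c = r *\<^sub>R snd (D (tvec_of A c q a) (E v)) c" for r a
        unfolding tvec_of_scale[OF A cq] affine_connectionD(3)[OF D E tvec_of_in[OF A cq]] by simp
    qed
    have "snd (D x (E (snd u c))) c = (\<Sum>i\<in>Basis. (snd u c \<bullet> i) *\<^sub>R snd (D x (E i)) c)"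
      by (rule lin1[OF x])
    also have "\<dots> = (\<Sum>i\<in>Basis. (snd u c \<bullet> i) *\<^sub>R
        (\<Sum>j\<in>Basis. (snd x c \<bullet> j) *\<^sub>R snd (D (tvec_of A c q j) (E i)) c))"
      using linear_euclidean_expand[OF lin2, of "snd x c"] by (simp add: tvec_of_tangent[OF A cq x])
    also have "\<dots> = \<Gamma> (snd c q) (snd u c) (snd x c)"
      by (simp add: \<Gamma>_def chart_inv_snd[OF A c q(1)] E_eq[OF q] scaleR_sum_right)
    finally show ?thesis .
  qed
  have opB: "open (B \<times> (UNIV :: ('e \<times> 'e) set))"
    using \<psi>(2) by (simp add: open_Times)
  \<comment> \<open>The Christoffel symbols are smooth because the covariant derivative of
    \<open>E i\<close> along \<open>E j\<close> is again a vector field.\<close>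
  have "smooth_on B (\<lambda>x. snd (D (E j (chart_inv c x)) (E i)) c)" for i j
  proof (rule smooth_on_subset[OF _ \<psi>(4)], rule smooth_on_cong[OF op, THEN iffD1, OF _
        smooth_on_vector_field_coord[OF A affine_connectionD(6)[OF D E[of j] E[of i]] c]])
    fix x
    assume "x \<in> chart_image c"
    then have "chart_inv c x \<in> points A"
      by (intro charts_at_points[OF in_c[OF chart_inv_in]])
    then show "snd ((\<lambda>p\<in>points A. D (E j p) (E i)) (chart_inv c x)) c =
        snd (D (E j (chart_inv c x)) (E i)) c"
      by simp
  qed
  then have sm: "smooth_on (B \<times> (UNIV :: ('e \<times> 'e) set)) (\<lambda>z. snd (D (E j (chart_inv c (fst z))) (E i)) c)"
    for i j
    by (rule smooth_on_compose[OF _ smooth_on_fst[OF opB smooth_on_ident[OF opB]] opB \<psi>(2)]) auto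
  have smooth: "smooth_on (B \<times> (UNIV :: ('e \<times> 'e) set)) (\<lambda>z. \<Gamma> (fst z) (fst (snd z)) (snd (snd z)))"
    unfolding \<Gamma>_def by (intro smooth_on_sum smooth_on_scaleR smooth_on_inner smooth_on_fst smooth_on_snd
        smooth_on_const smooth_on_ident opB sm)
  have "C u x \<in> tangent_space (tangent_atlas A) u \<and>
      snd (C u x) (tangent_chart A c) = (snd x c, - \<Gamma> (snd c q) (snd u c) (snd x c))"
    if q: "q \<in> fst c" "snd c q \<in> B" and u: "u \<in> tangent_space A q" and x: "x \<in> tangent_space A q"
    for q u x
  proof -
    define Y where "Y = E (snd u c)"
    note cq = in_c[OF q(1)] and YA = E[of "snd u c", folded Y_def]
    note qA = charts_at_points[OF cq]
    have Yq: "Y q = u"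
      unfolding Y_def E_eq[OF q] by (rule tvec_of_tangent[OF A cq u])
    note DY = affine_connectionD(1)[OF D YA x]
    have Cux: "C u x = pushforward A (tangent_atlas A) Y x -\<^sub>T vertical_lift A u (D x Y)"
      using C YA qA x unfolding connection_map_def Yq[symmetric] by blast
    have tcu: "tangent_chart A c \<in> charts_at (tangent_atlas A) (Y q)"
      unfolding Yq by (rule tangent_chart_at[OF u cq])
    have in1: "pushforward A (tangent_atlas A) Y x \<in> tangent_space (tangent_atlas A) u"
      using pushforward_in[OF A TA vector_fieldsD(2)[OF YA] x charts_at_points[OF tcu]]
      unfolding Yq .
    \<comment> \<open>Constancy of the coordinates of \<open>Y\<close> holds on all of the open set
      \<open>B\<close>, not just at \<open>q\<close>, which is what permits differentiating
      them.\<close>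
    have "coord_deriv c (tangent_chart A c) Y q = (\<lambda>a. (a, 0))"
    proof (rule coord_deriv_eqI[OF A cq \<psi>(2) q(2)])
      show "(snd (tangent_chart A c) \<circ> Y \<circ> chart_inv c) y = (y, snd u c)" if "y \<in> B" for y
      proof -
        have y: "y \<in> chart_image c"
          using that \<psi>(4) by blast
        then have "Y (chart_inv c y) = tvec_of A c (chart_inv c y) (snd u c)"
          unfolding Y_def by (intro E_eq chart_inv_in) (simp_all add: snd_chart_inv that)
        then show ?thesis
          using y by (simp add: snd_tangent_chart snd_chart_inv tvec_of_coord[OF A in_c[OF chart_inv_in]])
      qed
      show "((\<lambda>y. (y, snd u c)) has_derivative (\<lambda>a. (a, 0))) (at (snd c q))"
        by (intro has_derivative_Pair has_derivative_ident has_derivative_const)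
    qed
    then have "snd (pushforward A (tangent_atlas A) Y x) (tangent_chart A c) = (snd x c, 0)"
      using pushforward_coord[OF A TA vector_fieldsD(2)[OF YA] x cq tcu] by simp
    moreover have "snd (vertical_lift A u (D x Y)) (tangent_chart A c) =
        (0, \<Gamma> (snd c q) (snd u c) (snd x c))"
      using vertical_lift_coord[OF A u DY cq] \<Gamma>[OF q x, of u] by (simp add: Y_def)
    ultimately show ?thesis
      unfolding Cux using tv_diff_in[OF TA in1 vertical_lift_in[OF A u DY]] by simp
  qed
  then show thesis
    using that[OF \<psi>(2,3,4) smooth lin] by blast
qed

section \<open>Vertical vectors and the horizontal-vertical splitting\<close>

lemma vertical_lift_add:
  assumes A: "smooth_atlas A" and u: "u \<in> tangent_space A p" and v: "v \<in> tangent_space A p"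
    and w: "w \<in> tangent_space A p"
  shows "vertical_lift A u (v +\<^sub>T w) = vertical_lift A u v +\<^sub>T vertical_lift A u w"
proof -
  obtain c where c: "c \<in> charts_at A p"
    by (rule exE[OF charts_at_nonempty[OF tangent_spaceD(2)[OF u]]])
  show ?thesis
    unfolding vertical_lift_eq[OF A u v c] vertical_lift_eq[OF A u w c]
      vertical_lift_eq[OF A u tv_add_in[OF A v w] c]
      tvec_of_add[OF smooth_atlas_tangent_atlas[OF A] tangent_chart_at[OF u c], symmetric]
    by simp
qed

lemma vertical_lift_scale:
  assumes A: "smooth_atlas A" and u: "u \<in> tangent_space A p" and v: "v \<in> tangent_space A p"
  shows "vertical_lift A u (r *\<^sub>T v) = r *\<^sub>T vertical_lift A u v"
proof -
  obtain c where c: "c \<in> charts_at A p"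
    by (rule exE[OF charts_at_nonempty[OF tangent_spaceD(2)[OF u]]])
  show ?thesis
    unfolding vertical_lift_eq[OF A u v c] vertical_lift_eq[OF A u tv_scale_in[OF A v] c]
      tvec_of_scale[OF smooth_atlas_tangent_atlas[OF A] tangent_chart_at[OF u c], symmetric]
    by simp
qed

lemma vertical_lift_inj:
  assumes A: "smooth_atlas A" and u: "u \<in> tangent_space A p" and v: "v \<in> tangent_space A p"
    and u': "u' \<in> tangent_space A q" and v': "v' \<in> tangent_space A q"
    and eq: "vertical_lift A u v = vertical_lift A u' v'"
  shows "u = u'" "v = v'"
proof -
  show uu: "u = u'"
    using tangent_spaceD(1)[OF vertical_lift_in[OF A u v]]
      tangent_spaceD(1)[OF vertical_lift_in[OF A u' v']] eq by simp
  have pq: "q = p"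
    using tangent_spaceD(1)[OF u] tangent_spaceD(1)[OF u'] uu by simp
  obtain c where c: "c \<in> charts_at A p"
    by (rule exE[OF charts_at_nonempty[OF tangent_spaceD(2)[OF u]]])
  show "v = v'"
    by (rule tangent_space_eqI[OF v v'[unfolded pq] c])
      (use eq vertical_lift_coord[OF A u v c] vertical_lift_coord[OF A u'[unfolded pq] v'[unfolded pq] c] in simp)
qed

lemma vertical_lift_vertical:
  assumes A: "smooth_atlas A" and u: "u \<in> tangent_space A p" and v: "v \<in> tangent_space A p"
  shows "vertical_lift A u v \<in> vb_total (vertical_bundle A)"
proof -
  obtain c where c: "c \<in> charts_at A p"
    by (rule exE[OF charts_at_nonempty[OF tangent_spaceD(2)[OF u]]])
  show ?thesis
    unfolding in_vertical_bundle_iff[OF A u c vertical_lift_in[OF A u v]]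
      vertical_lift_coord[OF A u v c] by simp
qed

lemma vertical_bundle_in_tangent_space:
  assumes "\<xi> \<in> vb_total (vertical_bundle A)"
  shows "\<xi> \<in> tangent_space (tangent_atlas A) (fst \<xi>)" "fst \<xi> \<in> tangent_space A (fst (fst \<xi>))"
proof -
  show 1: "\<xi> \<in> tangent_space (tangent_atlas A) (fst \<xi>)"
    using assms by (simp add: vertical_bundle_def tangent_vectors_iff)
  show "fst \<xi> \<in> tangent_space A (fst (fst \<xi>))"
    using tangent_spaceD(2)[OF 1] by (simp add: points_tangent_atlas tangent_vectors_iff)
qed

text \<open>A vertical vector has coordinates \<open>(0, w)\<close> in an induced chart, so the
  tangent vector with coordinates \<open>w\<close> lifts to it.\<close>

lemma vertical_eq_lift:
  assumes A: "smooth_atlas A" and u: "u \<in> tangent_space A p"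
    and \<xi>: "\<xi> \<in> vb_total (vertical_bundle A)" "fst \<xi> = u"
  obtains v where "v \<in> tangent_space A p" "\<xi> = vertical_lift A u v"
proof -
  obtain c where c: "c \<in> charts_at A p"
    by (rule exE[OF charts_at_nonempty[OF tangent_spaceD(2)[OF u]]])
  let ?tc = "tangent_chart A c"
  define v where "v = tvec_of A c p (snd (snd \<xi> ?tc))"
  have v: "v \<in> tangent_space A p" "snd v c = snd (snd \<xi> ?tc)"
    unfolding v_def by (rule tvec_of_in[OF A c], rule tvec_of_coord[OF A c])
  have \<xi>u: "\<xi> \<in> tangent_space (tangent_atlas A) u"
    using vertical_bundle_in_tangent_space(1)[OF \<xi>(1)] \<xi>(2) by simp
  have "fst (snd \<xi> ?tc) = 0"
    using \<xi>(1) in_vertical_bundle_iff[OF A u c \<xi>u] by blast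
  then have "\<xi> = vertical_lift A u v"
    by (intro tangent_space_eqI[OF \<xi>u vertical_lift_in[OF A u v(1)] tangent_chart_at[OF u c]])
      (simp add: vertical_lift_coord[OF A u v(1) c] v(2) prod_eq_iff)
  with v(1) show thesis
    by (rule that)
qed

text \<open>\<open>vertical_part\<close> goes through \<open>inv_into\<close>, which inverts the
  vertical lift once the lift is injective on the whole Whitney sum: its base point recovers
  \<open>u\<close> and its fibre coordinates recover \<open>v\<close>.\<close>

lemma vertical_part_lift:
  fixes A :: "('m, 'e::euclidean_space) atlas"
  assumes A: "smooth_atlas A" and u: "u \<in> tangent_space A p" and v: "v \<in> tangent_space A p"
  shows "vertical_part A (vertical_lift A u v) = v"
proof -
  let ?T = "vb_total (whitney_sum (tangent_bundle A) (tangent_bundle A))"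
  have T: "z \<in> ?T \<longleftrightarrow> fst z \<in> tangent_space A (fst (fst z)) \<and> snd z \<in> tangent_space A (fst (fst z))"
    for z :: "('m, 'e) tvec \<times> ('m, 'e) tvec"
    using tangent_spaceD(1)[of "snd z" A "fst (fst z)"]
    by (cases z) (auto simp: whitney_sum_def tangent_bundle_def tangent_vectors_iff)
  have "inj_on (\<lambda>(u, v). vertical_lift A u v) ?T"
  proof (rule inj_onI)
    fix y z
    assume yz: "y \<in> ?T" "z \<in> ?T" and eq: "(\<lambda>(u, v). vertical_lift A u v) y = (\<lambda>(u, v). vertical_lift A u v) z"
    have eq': "vertical_lift A (fst y) (snd y) = vertical_lift A (fst z) (snd z)"
      using eq by (simp add: case_prod_beta)
    note y = yz(1)[unfolded T] and z = yz(2)[unfolded T]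
    show "y = z"
      using vertical_lift_inj[OF A conjunct1[OF y] conjunct2[OF y] conjunct1[OF z] conjunct2[OF z] eq']
      by (rule prod_eqI)
  qed
  moreover have "(u, v) \<in> ?T"
    unfolding T using u v tangent_spaceD(1)[OF u] by simp
  ultimately show ?thesis
    unfolding vertical_part_def using inv_into_f_f[of "\<lambda>(u, v). vertical_lift A u v" ?T "(u, v)"] by simp
qed

lemma vb_fibre_tangent_bundle: "vb_fibre (tangent_bundle A) p = tangent_space A p"
proof (intro equalityI subsetI)
  fix u
  assume "u \<in> tangent_space A p"
  then show "u \<in> vb_fibre (tangent_bundle A) p"
    using tangent_vectorsI[of u A p] tangent_spaceD(1)[of u A p]
    by (simp add: vb_fibre_def tangent_bundle_def)
qed (auto simp: vb_fibre_def tangent_bundle_def tangent_vectors_iff)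

text \<open>Replaces compositions with inverse charts by a formula for target coordinates in terms
  of source coordinates, the form in which the total spaces of bundles are handled below.\<close>

lemma smooth_map_of_coord_rep:
  assumes "\<And>p. p \<in> points A \<Longrightarrow> \<exists>c\<in>charts_at A p. \<exists>d\<in>B. \<exists>W T. open W \<and> snd c p \<in> W \<and> W \<subseteq> chart_image c \<and>
    smooth_on W T \<and> (\<forall>q\<in>fst c. snd c q \<in> W \<longrightarrow> F q \<in> fst d \<and> snd d (F q) = T (snd c q))"
  shows "smooth_map A B F"
  unfolding smooth_map_def
proof
  fix p
  assume "p \<in> points A"
  from assms[OF this] obtain c d W T where c: "c \<in> charts_at A p" and d: "d \<in> B"
    and W: "open W" "snd c p \<in> W" "W \<subseteq> chart_image c" "smooth_on W T"
    and F: "\<And>q. q \<in> fst c \<Longrightarrow> snd c q \<in> W \<Longrightarrow> F q \<in> fst d \<and> snd d (F q) = T (snd c q)"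
    by (elim bexE exE conjE) blast
  have F': "F (chart_inv c x) \<in> fst d \<and> snd d (F (chart_inv c x)) = T x" if "x \<in> W" for x
  proof -
    have "x \<in> chart_image c"
      using that W(3) by blast
    then show ?thesis
      using F[OF chart_inv_in] that by (simp add: snd_chart_inv)
  qed
  have "d \<in> charts_at B (F p)"
    using d F[OF charts_atD(2)[OF c] W(2)] by (simp add: charts_at_def)
  moreover have "smooth_on W (snd d \<circ> F \<circ> chart_inv c)"
    by (rule smooth_on_cong[OF W(1), THEN iffD1, OF _ W(4)]) (simp add: F')
  moreover have "\<forall>x\<in>W. F (chart_inv c x) \<in> fst d"
    using F' by simp
  ultimately show "\<exists>c\<in>charts_at A p. \<exists>d\<in>charts_at B (F p). \<exists>W. open W \<and> snd c p \<in> W \<and>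
      W \<subseteq> chart_image c \<and> (\<forall>x\<in>W. F (chart_inv c x) \<in> fst d) \<and> smooth_on W (snd d \<circ> F \<circ> chart_inv c)"
    by (intro bexI[OF _ c] bexI[of _ d] exI[of _ W] conjI W)
qed

section \<open>The splitting of \<open>TTM\<close> and the fibrewise linear bijection
  \<open>\<Psi>\<close>\<close>

locale connection_splitting =
  fixes M :: "('m, 'e::euclidean_space) atlas"
    and nabla :: "('m, 'e) tvec \<Rightarrow> ('m \<Rightarrow> ('m, 'e) tvec) \<Rightarrow> ('m, 'e) tvec"
    and C :: "('m, 'e) tvec \<Rightarrow> ('m, 'e) tvec \<Rightarrow> (('m, 'e) tvec, 'e \<times> 'e) tvec"
    and \<Psi> :: "(('m, 'e) tvec, 'e \<times> 'e) tvec \<Rightarrow>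
               (('m, 'e) tvec, 'e \<times> 'e) tvec \<times> (('m, 'e) tvec, 'e \<times> 'e) tvec"
  assumes manifold: "smooth_manifold M"
    and connection: "affine_connection M nabla"
    and connection_map: "connection_map M nabla C"
    and splitting: "\<lbrakk>p \<in> points M; u \<in> tangent_space M p; v \<in> tangent_space M p; w \<in> tangent_space M p\<rbrakk> \<Longrightarrow>
      \<Psi> (C u v +\<^sub>T vertical_lift M u w) = (vertical_lift M u v, vertical_lift M u w)"
begin

abbreviation "TM \<equiv> tangent_atlas M"
abbreviation "VV \<equiv> whitney_sum (vertical_bundle M) (vertical_bundle M)"

lemmas atlas = smooth_atlas_of_manifold[OF manifold]
lemmas TM_atlas = smooth_atlas_tangent_atlas[OF atlas]

lemma \<Psi>_eq:
  "\<lbrakk>u \<in> tangent_space M p; v \<in> tangent_space M p; w \<in> tangent_space M p\<rbrakk> \<Longrightarrow>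
    \<Psi> (C u v +\<^sub>T vertical_lift M u w) = (vertical_lift M u v, vertical_lift M u w)"
  using splitting tangent_spaceD(2)[of u M p] by simp

text \<open>Read off from the coordinate description, which applies at every point because the chart
  and the base point of \<open>connection_map_coords\<close> are arbitrary.\<close>

lemma horizontal_lift_in:
  assumes u: "u \<in> tangent_space M p" and v: "v \<in> tangent_space M p"
  shows "C u v \<in> tangent_space TM u"
proof -
  obtain c where c: "c \<in> charts_at M p"
    by (rule exE[OF charts_at_nonempty[OF tangent_spaceD(2)[OF u]]])
  note c' = charts_atD[OF c]
  show ?thesis
    by (rule connection_map_coords[OF manifold connection connection_map c'(1) snd_in_chart_image[OF c'(2)]])
      (use c'(2) u v in blast)
qed

text \<open>Both coordinates \<open>(v, - \<Gamma> x u v)\<close> are linear in \<open>v\<close>,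
  and equality in one chart of \<open>TM\<close> suffices.\<close>

lemma horizontal_lift_linear:
  assumes u: "u \<in> tangent_space M p" and v: "v \<in> tangent_space M p" and w: "w \<in> tangent_space M p"
  shows "C u (v +\<^sub>T w) = C u v +\<^sub>T C u w" "C u (r *\<^sub>T v) = r *\<^sub>T C u v"
proof -
  obtain c where c: "c \<in> charts_at M p"
    by (rule exE[OF charts_at_nonempty[OF tangent_spaceD(2)[OF u]]])
  note c' = charts_atD[OF c] and tc = tangent_chart_at[OF u c]
  obtain B \<Gamma> where B: "snd c p \<in> B" and lin: "\<And>x v. x \<in> B \<Longrightarrow> linear (\<Gamma> x v)"
    and coord: "\<And>q u x. \<lbrakk>q \<in> fst c; snd c q \<in> B; u \<in> tangent_space M q; x \<in> tangent_space M q\<rbrakk> \<Longrightarrow>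
      C u x \<in> tangent_space TM u \<and>
      snd (C u x) (tangent_chart M c) = (snd x c, - \<Gamma> (snd c q) (snd u c) (snd x c))"
    by (rule connection_map_coords[OF manifold connection connection_map c'(1) snd_in_chart_image[OF c'(2)]])
      blast
  note coord' = conjunct2[OF coord[OF c'(2) B u]] and L = lin[OF B, of "snd u c"]
  show "C u (v +\<^sub>T w) = C u v +\<^sub>T C u w"
    by (rule tangent_space_eqI[OF horizontal_lift_in[OF u tv_add_in[OF atlas v w]]
          tv_add_in[OF TM_atlas horizontal_lift_in[OF u v] horizontal_lift_in[OF u w]] tc])
      (simp add: coord'[OF v] coord'[OF w] coord'[OF tv_add_in[OF atlas v w]] linear_add[OF L])
  show "C u (r *\<^sub>T v) = r *\<^sub>T C u v"
    by (rule tangent_space_eqI[OF horizontal_lift_in[OF u tv_scale_in[OF atlas v]]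
          tv_scale_in[OF TM_atlas horizontal_lift_in[OF u v]] tc])
      (simp add: coord'[OF v] coord'[OF tv_scale_in[OF atlas v]] linear_cmul[OF L])
qed

lemma splitting_exists:
  assumes u: "u \<in> tangent_space M p" and \<xi>: "\<xi> \<in> tangent_space TM u"
  obtains v w where "v \<in> tangent_space M p" "w \<in> tangent_space M p" "\<xi> = C u v +\<^sub>T vertical_lift M u w"
proof -
  obtain c where c: "c \<in> charts_at M p"
    by (rule exE[OF charts_at_nonempty[OF tangent_spaceD(2)[OF u]]])
  note c' = charts_atD[OF c] and tc = tangent_chart_at[OF u c]
  let ?tc = "tangent_chart M c"
  obtain B \<Gamma> where B: "snd c p \<in> B"
    and coord: "\<And>q u x. \<lbrakk>q \<in> fst c; snd c q \<in> B; u \<in> tangent_space M q; x \<in> tangent_space M q\<rbrakk> \<Longrightarrow>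
      C u x \<in> tangent_space TM u \<and>
      snd (C u x) (tangent_chart M c) = (snd x c, - \<Gamma> (snd c q) (snd u c) (snd x c))"
    by (rule connection_map_coords[OF manifold connection connection_map c'(1) snd_in_chart_image[OF c'(2)]])
      blast
  \<comment> \<open>These solve \<open>(a, b) = (v, w - \<Gamma> x u v)\<close>, where
    \<open>(a, b)\<close> are the coordinates of \<open>\<xi>\<close>: first \<open>v = a\<close>,
    then \<open>w = b + \<Gamma> x u a\<close>.\<close>
  define v where "v = tvec_of M c p (fst (snd \<xi> ?tc))"
  define w where "w = tvec_of M c p (snd (snd \<xi> ?tc) + \<Gamma> (snd c p) (snd u c) (fst (snd \<xi> ?tc)))"
  have v: "v \<in> tangent_space M p" and w: "w \<in> tangent_space M p"
    unfolding v_def w_def by (rule tvec_of_in[OF atlas c])+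
  have vw: "snd v c = fst (snd \<xi> ?tc)"
    "snd w c = snd (snd \<xi> ?tc) + \<Gamma> (snd c p) (snd u c) (fst (snd \<xi> ?tc))"
    unfolding v_def w_def by (rule tvec_of_coord[OF atlas c])+
  have "\<xi> = C u v +\<^sub>T vertical_lift M u w"
    by (rule tangent_space_eqI[OF \<xi> tv_add_in[OF TM_atlas horizontal_lift_in[OF u v]
            vertical_lift_in[OF atlas u w]] tc])
      (simp add: conjunct2[OF coord[OF c'(2) B u v]] vertical_lift_coord[OF atlas u w c] vw prod_eq_iff)
  with v w show thesis
    by (rule that)
qed

lemma tangent_vectors_TM_cases:
  assumes "\<xi> \<in> tangent_vectors TM"
  obtains p u v w where "u \<in> tangent_space M p" "v \<in> tangent_space M p" "w \<in> tangent_space M p"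
    "\<xi> = C u v +\<^sub>T vertical_lift M u w" "fst \<xi> = u"
proof -
  have \<xi>: "\<xi> \<in> tangent_space TM (fst \<xi>)"
    using assms by (simp add: tangent_vectors_iff)
  then have u: "fst \<xi> \<in> tangent_space M (fst (fst \<xi>))"
    using tangent_spaceD(2)[OF \<xi>] by (simp add: points_tangent_atlas tangent_vectors_iff)
  show thesis
    by (rule splitting_exists[OF u \<xi>]) (use that[OF u] in blast)
qed

lemma splitting_in:
  assumes "u \<in> tangent_space M p" "v \<in> tangent_space M p" "w \<in> tangent_space M p"
  shows "C u v +\<^sub>T vertical_lift M u w \<in> tangent_space TM u"
  by (intro tv_add_in TM_atlas horizontal_lift_in[of u p] vertical_lift_in[OF atlas, of u p] assms)

lemma splitting_add:
  assumes u: "u \<in> tangent_space M p" and v: "v \<in> tangent_space M p" and w: "w \<in> tangent_space M p"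
    and v': "v' \<in> tangent_space M p" and w': "w' \<in> tangent_space M p"
  shows "(C u v +\<^sub>T vertical_lift M u w) +\<^sub>T (C u v' +\<^sub>T vertical_lift M u w') =
    C u (v +\<^sub>T v') +\<^sub>T vertical_lift M u (w +\<^sub>T w')"
  unfolding horizontal_lift_linear(1)[OF u v v'] vertical_lift_add[OF atlas u w w']
  by (rule prod_eqI) (simp_all add: fun_eq_iff)

lemma splitting_scale:
  assumes u: "u \<in> tangent_space M p" and v: "v \<in> tangent_space M p" and w: "w \<in> tangent_space M p"
  shows "r *\<^sub>T (C u v +\<^sub>T vertical_lift M u w) = C u (r *\<^sub>T v) +\<^sub>T vertical_lift M u (r *\<^sub>T w)"
  unfolding horizontal_lift_linear(2)[OF u v v] vertical_lift_scale[OF atlas u w]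
  by (rule prod_eqI) (simp_all add: fun_eq_iff scaleR_add_right)

lemma vb_total_VV:
  "\<eta> \<in> vb_total VV \<longleftrightarrow> fst \<eta> \<in> vb_total (vertical_bundle M) \<and> snd \<eta> \<in> vb_total (vertical_bundle M) \<and>
    fst (fst \<eta>) = fst (snd \<eta>)"
  by (cases \<eta>) (auto simp: whitney_sum_def vertical_bundle_def)

lemma lifts_in_VV:
  assumes "u \<in> tangent_space M p" "v \<in> tangent_space M p" "w \<in> tangent_space M p"
  shows "(vertical_lift M u v, vertical_lift M u w) \<in> vb_total VV"
  unfolding vb_total_VV using assms
  by (simp add: vertical_lift_vertical[OF atlas] tangent_spaceD(1)[OF vertical_lift_in[OF atlas]])

lemma VV_cases:
  assumes "\<eta> \<in> vb_total VV"
  obtains p u v w where "u \<in> tangent_space M p" "v \<in> tangent_space M p" "w \<in> tangent_space M p"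
    "\<eta> = (vertical_lift M u v, vertical_lift M u w)"
proof -
  have \<eta>: "fst \<eta> \<in> vb_total (vertical_bundle M)" "snd \<eta> \<in> vb_total (vertical_bundle M)"
    "fst (snd \<eta>) = fst (fst \<eta>)"
    using assms unfolding vb_total_VV by simp_all
  note u = vertical_bundle_in_tangent_space(2)[OF \<eta>(1)]
  obtain v where v: "v \<in> tangent_space M (fst (fst (fst \<eta>)))" "fst \<eta> = vertical_lift M (fst (fst \<eta>)) v"
    by (rule vertical_eq_lift[OF atlas u \<eta>(1) refl])
  obtain w where w: "w \<in> tangent_space M (fst (fst (fst \<eta>)))" "snd \<eta> = vertical_lift M (fst (fst \<eta>)) w"
    by (rule vertical_eq_lift[OF atlas u \<eta>(2,3)])
  show thesis
    by (rule that[OF u v(1) w(1)]) (rule prod_eqI, use v(2) w(2) in simp_all)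
qed

text \<open>Injectivity is visible in the values: a pair of vertical lifts determines
  \<open>u\<close>, \<open>v\<close> and \<open>w\<close> by injectivity of the lift. Surjectivity
  holds since every element of the target is such a pair.\<close>

lemma bij_\<Psi>: "bij_betw \<Psi> (tangent_vectors TM) (vb_total VV)"
proof (rule bij_betwI')
  fix \<xi> \<xi>'
  assume "\<xi> \<in> tangent_vectors TM" "\<xi>' \<in> tangent_vectors TM"
  then obtain p u v w p' u' v' w' where 1: "u \<in> tangent_space M p" "v \<in> tangent_space M p" "w \<in> tangent_space M p"
    "\<xi> = C u v +\<^sub>T vertical_lift M u w"
    and 2: "u' \<in> tangent_space M p'" "v' \<in> tangent_space M p'" "w' \<in> tangent_space M p'"
    "\<xi>' = C u' v' +\<^sub>T vertical_lift M u' w'"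
    by (elim tangent_vectors_TM_cases)
  show "\<Psi> \<xi> = \<Psi> \<xi>' \<longleftrightarrow> \<xi> = \<xi>'"
  proof
    assume "\<Psi> \<xi> = \<Psi> \<xi>'"
    then have "vertical_lift M u v = vertical_lift M u' v'" "vertical_lift M u w = vertical_lift M u' w'"
      by (simp_all add: 1(4) 2(4) \<Psi>_eq[OF 1(1-3)] \<Psi>_eq[OF 2(1-3)])
    then have "u = u'" "v = v'" "w = w'"
      using vertical_lift_inj[OF atlas 1(1,2) 2(1,2)] vertical_lift_inj[OF atlas 1(1,3) 2(1,3)] by simp_all
    then show "\<xi> = \<xi>'"
      by (simp add: 1(4) 2(4))
  qed simp
next
  fix \<xi>
  assume "\<xi> \<in> tangent_vectors TM"
  then show "\<Psi> \<xi> \<in> vb_total VV"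
    by (rule tangent_vectors_TM_cases) (simp add: \<Psi>_eq lifts_in_VV)
next
  fix \<eta>
  assume "\<eta> \<in> vb_total VV"
  then obtain p u v w where *: "u \<in> tangent_space M p" "v \<in> tangent_space M p" "w \<in> tangent_space M p"
    "\<eta> = (vertical_lift M u v, vertical_lift M u w)"
    by (rule VV_cases)
  show "\<exists>\<xi>\<in>tangent_vectors TM. \<eta> = \<Psi> \<xi>"
    by (rule bexI[OF _ tangent_vectorsI[OF splitting_in[OF *(1-3)]]]) (simp add: \<Psi>_eq[OF *(1-3)] *(4))
qed

lemma vb_proj_VV_\<Psi>:
  assumes "\<xi> \<in> tangent_vectors TM"
  shows "vb_proj VV (\<Psi> \<xi>) = fst \<xi>"
  using assms
proof (rule tangent_vectors_TM_cases)
  fix p u v w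
  assume *: "u \<in> tangent_space M p" "v \<in> tangent_space M p" "w \<in> tangent_space M p"
    "\<xi> = C u v +\<^sub>T vertical_lift M u w" "fst \<xi> = u"
  show ?thesis
    unfolding *(5) unfolding *(4) \<Psi>_eq[OF *(1-3)]
    by (simp add: whitney_sum_def vertical_bundle_def tangent_spaceD(1)[OF vertical_lift_in[OF atlas *(1,2)]])
qed

text \<open>Vectors over the same \<open>u\<close> are decomposed separately; since both lifts are
  linear, the decompositions add and scale, and \<open>\<Psi>\<close> can be evaluated on the
  result.\<close>

lemma linear_\<Psi>:
  assumes "\<xi> \<in> tangent_space TM u" "\<xi>' \<in> tangent_space TM u"
  shows "\<Psi> (\<xi> +\<^sub>T \<xi>') = vb_add VV (\<Psi> \<xi>) (\<Psi> \<xi>')" "\<Psi> (r *\<^sub>T \<xi>) = vb_scale VV r (\<Psi> \<xi>)"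
proof -
  have u: "u \<in> tangent_space M (fst u)"
    using tangent_spaceD(2)[OF assms(1)] by (simp add: points_tangent_atlas tangent_vectors_iff)
  obtain v w where 1: "v \<in> tangent_space M (fst u)" "w \<in> tangent_space M (fst u)"
    "\<xi> = C u v +\<^sub>T vertical_lift M u w"
    by (rule splitting_exists[OF u assms(1)])
  obtain v' w' where 2: "v' \<in> tangent_space M (fst u)" "w' \<in> tangent_space M (fst u)"
    "\<xi>' = C u v' +\<^sub>T vertical_lift M u w'"
    by (rule splitting_exists[OF u assms(2)])
  show "\<Psi> (\<xi> +\<^sub>T \<xi>') = vb_add VV (\<Psi> \<xi>) (\<Psi> \<xi>')"
    unfolding 1(3) 2(3) splitting_add[OF u 1(1,2) 2(1,2)] \<Psi>_eq[OF u 1(1,2)] \<Psi>_eq[OF u 2(1,2)]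
      \<Psi>_eq[OF u tv_add_in[OF atlas 1(1) 2(1)] tv_add_in[OF atlas 1(2) 2(2)]]
    by (simp add: whitney_sum_def vertical_bundle_def vertical_lift_add[OF atlas u 1(1) 2(1)]
        vertical_lift_add[OF atlas u 1(2) 2(2)])
  show "\<Psi> (r *\<^sub>T \<xi>) = vb_scale VV r (\<Psi> \<xi>)"
    unfolding 1(3) splitting_scale[OF u 1(1,2)] \<Psi>_eq[OF u 1(1,2)]
      \<Psi>_eq[OF u tv_scale_in[OF atlas 1(1)] tv_scale_in[OF atlas 1(2)]]
    by (simp add: whitney_sum_def vertical_bundle_def vertical_lift_scale[OF atlas u 1(1)]
        vertical_lift_scale[OF atlas u 1(2)])
qed

section \<open>Smoothness of \<open>\<Psi>\<close> and of its inverse in explicit charts\<close>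

text \<open>A member of the bundle atlas whose base chart and trivialization come from one chart of
  \<open>M\<close>, unfolded to explicit coordinates \<open>((x, u), (a, b))\<close>.\<close>

definition TTM_chart :: "('m, 'e) chart \<Rightarrow> ((('m, 'e) tvec, 'e \<times> 'e) tvec, ('e \<times> 'e) \<times> 'e \<times> 'e) chart"
  where "TTM_chart c = ({\<xi> \<in> tangent_vectors TM. fst (fst \<xi>) \<in> fst c},
    \<lambda>\<xi>. ((snd c (fst (fst \<xi>)), snd (fst \<xi>) c), snd \<xi> (tangent_chart M c)))"

text \<open>Only the fibre slot of each vertical vector is recorded, the other slot being 0. The
  coordinate space is that of \<open>TTM_chart\<close>, so \<open>\<Psi>\<close> becomes a map
  between open sets of one space.\<close>

definition VV_chart :: "('m, 'e) chart \<Rightarrow>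
    ((('m, 'e) tvec, 'e \<times> 'e) tvec \<times> (('m, 'e) tvec, 'e \<times> 'e) tvec, ('e \<times> 'e) \<times> 'e \<times> 'e) chart"
  where "VV_chart c = ({\<eta> \<in> vb_total VV. fst (fst (fst \<eta>)) \<in> fst c},
    \<lambda>\<eta>. ((snd c (fst (fst (fst \<eta>))), snd (fst (fst \<eta>)) c),
      snd (snd (fst \<eta>) (tangent_chart M c)), snd (snd (snd \<eta>) (tangent_chart M c))))"

lemma TTM_chart_in:
  assumes c: "c \<in> M"
  shows "TTM_chart c \<in> vb_atlas (tangent_bundle TM)"
proof -
  have "fst \<xi> \<in> tangent_vectors M" if "\<xi> \<in> tangent_vectors TM" for \<xi> :: "(('m, 'e) tvec, 'e \<times> 'e) tvec"
    using that tangent_spaceD(2)[of \<xi> TM] by (simp add: tangent_vectors_iff[of \<xi>] points_tangent_atlas)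
  then have "TTM_chart c = ({\<xi> \<in> tangent_vectors TM. fst \<xi> \<in> fst (tangent_chart M c) \<inter> fst (tangent_chart M c)},
      \<lambda>\<xi>. (snd (tangent_chart M c) (fst \<xi>), snd \<xi> (tangent_chart M c)))"
    by (auto simp: TTM_chart_def fst_tangent_chart snd_tangent_chart)
  then show ?thesis
    using c unfolding vb_atlas_def tangent_bundle_def
    by (intro CollectI exI[of _ "tangent_chart M c"]
        exI[of _ "(fst (tangent_chart M c), \<lambda>\<xi>. snd \<xi> (tangent_chart M c))"])
      (simp add: tangent_atlas_def)
qed

lemma VV_chart_in:
  assumes c: "c \<in> M"
  shows "VV_chart c \<in> vb_atlas VV"
proof -
  let ?t = "(fst (tangent_chart M c), \<lambda>\<xi>. snd (snd \<xi> (tangent_chart M c))) ::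
    ('m, 'e) tvec set \<times> ((('m, 'e) tvec, 'e \<times> 'e) tvec \<Rightarrow> 'e)"
  let ?tt = "(fst ?t \<inter> fst ?t, \<lambda>(e, f). (snd ?t e, snd ?t f))"
  have "?t \<in> vb_trivs (vertical_bundle M)"
    unfolding vertical_bundle_def vbundle.simps using c by (rule imageI)
  then have tt: "?tt \<in> vb_trivs VV"
    unfolding whitney_sum_def vbundle.simps by (intro CollectI exI[of _ ?t] conjI refl)
  have "fst (fst \<eta>) \<in> tangent_vectors M" if "\<eta> \<in> vb_total VV"
    for \<eta> :: "(('m, 'e) tvec, 'e \<times> 'e) tvec \<times> (('m, 'e) tvec, 'e \<times> 'e) tvec"
    using that vertical_bundle_in_tangent_space(2)[of "fst \<eta>" M]
    by (simp add: vb_total_VV tangent_vectors_iff)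
  then have "VV_chart c = ({\<eta> \<in> vb_total VV. vb_proj VV \<eta> \<in> fst (tangent_chart M c) \<inter> fst ?tt},
      \<lambda>\<eta>. (snd (tangent_chart M c) (vb_proj VV \<eta>), snd ?tt \<eta>))"
    by (auto simp: VV_chart_def fst_tangent_chart snd_tangent_chart whitney_sum_def vertical_bundle_def
        case_prod_beta)
  moreover have "tangent_chart M c \<in> vb_base VV"
    using c by (simp add: whitney_sum_def vertical_bundle_def tangent_atlas_def)
  ultimately show ?thesis
    unfolding vb_atlas_def using tt
    by (intro CollectI exI[of _ "tangent_chart M c"] exI[of _ ?tt] conjI)
qed

text \<open>Prescribing first the coordinates of \<open>u\<close> and then those of a vector at
  \<open>u\<close> realizes every triple over the image of \<open>c\<close>; this places the product
  neighbourhoods used later inside the chart image.\<close>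

lemma chart_image_TTM_chart:
  assumes c: "c \<in> M" and x: "x \<in> chart_image c"
  shows "((x, y), z) \<in> chart_image (TTM_chart c)"
proof -
  define q where "q = chart_inv c x"
  have q: "c \<in> charts_at M q" "snd c q = x"
    using c x by (simp_all add: q_def charts_at_def chart_inv_in snd_chart_inv)
  define u where "u = tvec_of M c q y"
  have u: "u \<in> tangent_space M q" "snd u c = y"
    unfolding u_def by (rule tvec_of_in[OF atlas q(1)], rule tvec_of_coord[OF atlas q(1)])
  note tc = tangent_chart_at[OF u(1) q(1)]
  show ?thesis
    unfolding chart_image_def
  proof (rule image_eqI)
    show "tvec_of TM (tangent_chart M c) u z \<in> fst (TTM_chart c)"
      using tangent_vectorsI[OF tvec_of_in[OF TM_atlas tc]] charts_atD(2)[OF q(1)]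
      by (simp add: TTM_chart_def tangent_spaceD(1)[OF u(1)])
    show "((x, y), z) = snd (TTM_chart c) (tvec_of TM (tangent_chart M c) u z)"
      by (simp add: TTM_chart_def tangent_spaceD(1)[OF u(1)] q(2) u(2) tvec_of_coord[OF TM_atlas tc])
  qed
qed

lemma VV_chart_lifts:
  assumes c: "c \<in> charts_at M q" and "u \<in> tangent_space M q" "v \<in> tangent_space M q" "w \<in> tangent_space M q"
  shows "(vertical_lift M u v, vertical_lift M u w) \<in> fst (VV_chart c)"
    "snd (VV_chart c) (vertical_lift M u v, vertical_lift M u w) = ((snd c q, snd u c), (snd v c, snd w c))"
proof -
  have *: "fst (vertical_lift M u v) = u" "fst u = q"
    using tangent_spaceD(1)[OF vertical_lift_in[OF atlas assms(2,3)]] tangent_spaceD(1)[OF assms(2)] by simp_all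
  show "(vertical_lift M u v, vertical_lift M u w) \<in> fst (VV_chart c)"
    using lifts_in_VV[OF assms(2-4)] charts_atD(2)[OF c] by (simp add: VV_chart_def *)
  show "snd (VV_chart c) (vertical_lift M u v, vertical_lift M u w) = ((snd c q, snd u c), (snd v c, snd w c))"
    by (simp add: VV_chart_def * vertical_lift_coord[OF atlas assms(2,3) c]
        vertical_lift_coord[OF atlas assms(2,4) c])
qed

lemma chart_image_VV_chart:
  assumes c: "c \<in> M" and x: "x \<in> chart_image c"
  shows "((x, y), z) \<in> chart_image (VV_chart c)"
proof -
  define q where "q = chart_inv c x"
  have q: "c \<in> charts_at M q" "snd c q = x"
    using c x by (simp_all add: q_def charts_at_def chart_inv_in snd_chart_inv)
  let ?t = "tvec_of M c q"
  note t = tvec_of_in[OF atlas q(1)] tvec_of_coord[OF atlas q(1)]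
  have "((x, y), z) = snd (VV_chart c)
      (vertical_lift M (?t y) (?t (fst z)), vertical_lift M (?t y) (?t (snd z)))"
    by (simp add: VV_chart_lifts(2)[OF q(1) t(1) t(1) t(1)] t(2) q(2))
  then show ?thesis
    unfolding chart_image_def by (rule image_eqI) (rule VV_chart_lifts(1)[OF q(1) t(1) t(1) t(1)])
qed

text \<open>In these charts the decomposed vector reads \<open>(v, w - \<Gamma> x u v)\<close> and
  its image \<open>(v, w)\<close>, so \<open>\<Psi>\<close> adds \<open>\<Gamma>\<close> to the last
  slot. Both chart images are covered because the product set serves as source domain for
  \<open>\<Psi>\<close> and for its inverse.\<close>

lemma \<Psi>_coords:
  assumes p: "p \<in> points M"
  obtains c B \<Gamma> where "c \<in> charts_at M p" "open B" "snd c p \<in> B"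
    and "(B \<times> UNIV) \<times> UNIV \<subseteq> chart_image (TTM_chart c)"
    and "(B \<times> UNIV) \<times> UNIV \<subseteq> chart_image (VV_chart c)"
    and "smooth_on ((B \<times> UNIV) \<times> (UNIV :: ('e \<times> 'e) set))
      (\<lambda>z. \<Gamma> (fst (fst z)) (snd (fst z)) (fst (snd z)))"
    and "\<And>\<xi>. \<lbrakk>\<xi> \<in> fst (TTM_chart c); snd (TTM_chart c) \<xi> \<in> (B \<times> UNIV) \<times> UNIV\<rbrakk> \<Longrightarrow>
      \<Psi> \<xi> \<in> fst (VV_chart c) \<and>
      snd (VV_chart c) (\<Psi> \<xi>) =
        (\<lambda>z. (fst z, (fst (snd z), snd (snd z) + \<Gamma> (fst (fst z)) (snd (fst z)) (fst (snd z)))))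
          (snd (TTM_chart c) \<xi>)"
proof -
  obtain c where c: "c \<in> charts_at M p"
    by (rule exE[OF charts_at_nonempty[OF p]])
  note c' = charts_atD[OF c]
  obtain B \<Gamma> where B: "open B" "snd c p \<in> B" "B \<subseteq> chart_image c"
    and sm: "smooth_on (B \<times> UNIV) (\<lambda>z. \<Gamma> (fst z) (fst (snd z)) (snd (snd z)))"
    and coord: "\<And>q u x. \<lbrakk>q \<in> fst c; snd c q \<in> B; u \<in> tangent_space M q; x \<in> tangent_space M q\<rbrakk> \<Longrightarrow>
      C u x \<in> tangent_space TM u \<and>
      snd (C u x) (tangent_chart M c) = (snd x c, - \<Gamma> (snd c q) (snd u c) (snd x c))"
    by (rule connection_map_coords[OF manifold connection connection_map c'(1) snd_in_chart_image[OF c'(2)]])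
      blast
  have image: "(B \<times> UNIV) \<times> UNIV \<subseteq> chart_image (TTM_chart c)"
    "(B \<times> UNIV) \<times> UNIV \<subseteq> chart_image (VV_chart c)"
    using chart_image_TTM_chart[OF c'(1)] chart_image_VV_chart[OF c'(1)] B(3) by auto
  have opW: "open ((B \<times> (UNIV :: 'e set)) \<times> (UNIV :: ('e \<times> 'e) set))"
    using B(1) by (simp add: open_Times)
  \<comment> \<open>Regroups \<open>((x, u), (a, b))\<close> as \<open>(x, (u, a))\<close>, the
    argument order in which \<open>\<Gamma>\<close> is known to be smooth.\<close>
  have "smooth_on ((B \<times> (UNIV :: 'e set)) \<times> (UNIV :: ('e \<times> 'e) set))
      (\<lambda>z. (\<lambda>y. \<Gamma> (fst y) (fst (snd y)) (snd (snd y))) (fst (fst z), (snd (fst z), fst (snd z))))"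
    by (rule smooth_on_compose[OF sm _ opW])
      (auto intro!: smooth_on_Pair smooth_on_fst smooth_on_snd smooth_on_ident opW simp: open_Times B(1))
  then have smooth: "smooth_on ((B \<times> UNIV) \<times> (UNIV :: ('e \<times> 'e) set))
      (\<lambda>z. \<Gamma> (fst (fst z)) (snd (fst z)) (fst (snd z)))"
    by simp
  have "\<Psi> \<xi> \<in> fst (VV_chart c) \<and> snd (VV_chart c) (\<Psi> \<xi>) =
        (\<lambda>z. (fst z, (fst (snd z), snd (snd z) + \<Gamma> (fst (fst z)) (snd (fst z)) (fst (snd z)))))
          (snd (TTM_chart c) \<xi>)"
    if \<xi>: "\<xi> \<in> fst (TTM_chart c)" "snd (TTM_chart c) \<xi> \<in> (B \<times> UNIV) \<times> UNIV" for \<xi>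
  proof -
    have "\<xi> \<in> tangent_vectors TM"
      using \<xi>(1) by (simp add: TTM_chart_def)
    then obtain q u v w where *: "u \<in> tangent_space M q" "v \<in> tangent_space M q" "w \<in> tangent_space M q"
      "\<xi> = C u v +\<^sub>T vertical_lift M u w" "fst \<xi> = u"
      by (rule tangent_vectors_TM_cases)
    note q = tangent_spaceD(1)[OF *(1)]
    have qc: "q \<in> fst c" "snd c q \<in> B"
      using \<xi> by (simp_all add: TTM_chart_def *(5) q)
    have cq: "c \<in> charts_at M q"
      using c'(1) qc(1) by (simp add: charts_at_def)
    have "snd \<xi> (tangent_chart M c) = (snd v c, snd w c - \<Gamma> (snd c q) (snd u c) (snd v c))"
      by (simp add: *(4) conjunct2[OF coord[OF qc *(1,2)]] vertical_lift_coord[OF atlas *(1,3) cq])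
    then have "snd (TTM_chart c) \<xi> =
        ((snd c q, snd u c), (snd v c, snd w c - \<Gamma> (snd c q) (snd u c) (snd v c)))"
      by (simp add: TTM_chart_def *(5) q)
    moreover have "\<Psi> \<xi> = (vertical_lift M u v, vertical_lift M u w)"
      unfolding *(4) by (rule \<Psi>_eq[OF *(1-3)])
    ultimately show ?thesis
      using VV_chart_lifts[OF cq *(1-3)] by simp
  qed
  then show thesis
    using that[OF c B(1,2) image smooth] by blast
qed

lemma smooth_\<Psi>: "smooth_map (vb_atlas (tangent_bundle TM)) (vb_atlas VV) \<Psi>"
proof (rule smooth_map_of_coord_rep)
  fix \<xi>0
  assume "\<xi>0 \<in> points (vb_atlas (tangent_bundle TM))"
  then have \<xi>0: "\<xi>0 \<in> tangent_vectors TM"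
    by (auto simp: points_def vb_atlas_def tangent_bundle_def)
  then obtain u where u: "u \<in> tangent_space M (fst (fst \<xi>0))"
    by (rule tangent_vectors_TM_cases) (metis tangent_spaceD(1))
  obtain c B \<Gamma> where c: "c \<in> charts_at M (fst (fst \<xi>0))" "open B" "snd c (fst (fst \<xi>0)) \<in> B"
    "(B \<times> UNIV) \<times> UNIV \<subseteq> chart_image (TTM_chart c)"
    and sm: "smooth_on ((B \<times> UNIV) \<times> (UNIV :: ('e \<times> 'e) set))
      (\<lambda>z. \<Gamma> (fst (fst z)) (snd (fst z)) (fst (snd z)))"
    and coord: "\<And>\<xi>. \<lbrakk>\<xi> \<in> fst (TTM_chart c); snd (TTM_chart c) \<xi> \<in> (B \<times> UNIV) \<times> UNIV\<rbrakk> \<Longrightarrow>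
      \<Psi> \<xi> \<in> fst (VV_chart c) \<and>
      snd (VV_chart c) (\<Psi> \<xi>) =
        (\<lambda>z. (fst z, (fst (snd z), snd (snd z) + \<Gamma> (fst (fst z)) (snd (fst z)) (fst (snd z)))))
          (snd (TTM_chart c) \<xi>)"
    by (rule \<Psi>_coords[OF tangent_spaceD(2)[OF u]]) blast
  note c' = charts_atD[OF c(1)]
  let ?W = "(B \<times> (UNIV :: 'e set)) \<times> (UNIV :: ('e \<times> 'e) set)"
  let ?T = "\<lambda>z. (fst z, (fst (snd z), snd (snd z) + \<Gamma> (fst (fst z)) (snd (fst z)) (fst (snd z))))"
  have opW: "open ?W"
    using c(2) by (simp add: open_Times)
  have "TTM_chart c \<in> charts_at (vb_atlas (tangent_bundle TM)) \<xi>0"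
    using TTM_chart_in[OF c'(1)] \<xi>0 c'(2) by (simp add: charts_at_def TTM_chart_def)
  moreover have "snd (TTM_chart c) \<xi>0 \<in> ?W"
    using c(3) by (simp add: TTM_chart_def)
  moreover have "smooth_on ?W ?T"
    by (intro smooth_on_Pair smooth_on_add smooth_on_fst smooth_on_snd smooth_on_ident opW sm)
  ultimately show "\<exists>c\<in>charts_at (vb_atlas (tangent_bundle TM)) \<xi>0. \<exists>d\<in>vb_atlas VV. \<exists>W T. open W \<and>
      snd c \<xi>0 \<in> W \<and> W \<subseteq> chart_image c \<and> smooth_on W T \<and>
      (\<forall>q\<in>fst c. snd c q \<in> W \<longrightarrow> \<Psi> q \<in> fst d \<and> snd d (\<Psi> q) = T (snd c q))"
    using coord
    by (intro bexI[of _ "TTM_chart c"] bexI[OF _ VV_chart_in[OF c'(1)]] exI[of _ ?W] exI[of _ ?T]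
        conjI opW c(4)) simp_all
qed

lemma smooth_inv_\<Psi>:
  "smooth_map (vb_atlas VV) (vb_atlas (tangent_bundle TM)) (inv_into (tangent_vectors TM) \<Psi>)"
proof (rule smooth_map_of_coord_rep)
  let ?inv = "inv_into (tangent_vectors TM) \<Psi>"
  fix \<eta>0
  assume "\<eta>0 \<in> points (vb_atlas VV)"
  then have \<eta>0: "\<eta>0 \<in> vb_total VV"
    by (auto simp: points_def vb_atlas_def)
  then have p: "fst (fst (fst \<eta>0)) \<in> points M"
    unfolding vb_total_VV by (intro tangent_spaceD(2)[OF vertical_bundle_in_tangent_space(2)]) simp
  obtain c B \<Gamma> where c: "c \<in> charts_at M (fst (fst (fst \<eta>0)))" "open B" "snd c (fst (fst (fst \<eta>0))) \<in> B"
    "(B \<times> UNIV) \<times> UNIV \<subseteq> chart_image (VV_chart c)"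
    and sm: "smooth_on ((B \<times> UNIV) \<times> (UNIV :: ('e \<times> 'e) set))
      (\<lambda>z. \<Gamma> (fst (fst z)) (snd (fst z)) (fst (snd z)))"
    and coord: "\<And>\<xi>. \<lbrakk>\<xi> \<in> fst (TTM_chart c); snd (TTM_chart c) \<xi> \<in> (B \<times> UNIV) \<times> UNIV\<rbrakk> \<Longrightarrow>
      \<Psi> \<xi> \<in> fst (VV_chart c) \<and>
      snd (VV_chart c) (\<Psi> \<xi>) =
        (\<lambda>z. (fst z, (fst (snd z), snd (snd z) + \<Gamma> (fst (fst z)) (snd (fst z)) (fst (snd z)))))
          (snd (TTM_chart c) \<xi>)"
    by (rule \<Psi>_coords[OF p]) blast
  note c' = charts_atD[OF c(1)]
  let ?W = "(B \<times> (UNIV :: 'e set)) \<times> (UNIV :: ('e \<times> 'e) set)"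
  let ?T = "\<lambda>z. (fst z, (fst (snd z), snd (snd z) - \<Gamma> (fst (fst z)) (snd (fst z)) (fst (snd z))))"
  have opW: "open ?W"
    using c(2) by (simp add: open_Times)
  have inv: "?inv \<eta> \<in> fst (TTM_chart c) \<and> snd (TTM_chart c) (?inv \<eta>) = ?T (snd (VV_chart c) \<eta>)"
    if \<eta>: "\<eta> \<in> fst (VV_chart c)" "snd (VV_chart c) \<eta> \<in> ?W" for \<eta>
  proof -
    have "\<eta> \<in> \<Psi> ` tangent_vectors TM"
      using \<eta>(1) bij_betw_imp_surj_on[OF bij_\<Psi>] by (simp add: VV_chart_def)
    then have \<xi>: "?inv \<eta> \<in> tangent_vectors TM" "\<Psi> (?inv \<eta>) = \<eta>"
      by (rule inv_into_into, rule f_inv_into_f)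
    \<comment> \<open>\<open>\<Psi>\<close> covers the identity, so the preimage has the same base
      coordinates as \<open>\<eta>\<close>, and these alone decide membership in \<open>?W\<close>.
      The formula for \<open>\<Psi>\<close> then applies to the preimage and is solved for the last
      slot.\<close>
    have base: "fst (?inv \<eta>) = fst (fst \<eta>)"
      using vb_proj_VV_\<Psi>[OF \<xi>(1)] \<xi>(2) by (simp add: whitney_sum_def vertical_bundle_def case_prod_beta)
    have "?inv \<eta> \<in> fst (TTM_chart c)"
      using \<xi>(1) \<eta>(1) by (simp add: TTM_chart_def VV_chart_def base)
    moreover have "snd (TTM_chart c) (?inv \<eta>) \<in> ?W"
      using \<eta>(2) by (simp add: TTM_chart_def VV_chart_def base)
    ultimately show ?thesis
      using coord[of "?inv \<eta>"] \<xi>(2) by (simp add: prod_eq_iff)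
  qed
  have "VV_chart c \<in> charts_at (vb_atlas VV) \<eta>0"
    using VV_chart_in[OF c'(1)] \<eta>0 c'(2) by (simp add: charts_at_def VV_chart_def)
  moreover have "snd (VV_chart c) \<eta>0 \<in> ?W"
    using c(3) by (simp add: VV_chart_def)
  moreover have "smooth_on ?W ?T"
    by (intro smooth_on_Pair smooth_on_diff smooth_on_fst smooth_on_snd smooth_on_ident opW sm)
  ultimately show "\<exists>c\<in>charts_at (vb_atlas VV) \<eta>0. \<exists>d\<in>vb_atlas (tangent_bundle TM). \<exists>W T. open W \<and>
      snd c \<eta>0 \<in> W \<and> W \<subseteq> chart_image c \<and> smooth_on W T \<and>
      (\<forall>q\<in>fst c. snd c q \<in> W \<longrightarrow> ?inv q \<in> fst d \<and> snd d (?inv q) = T (snd c q))"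
    using inv
    by (intro bexI[of _ "VV_chart c"] bexI[OF _ TTM_chart_in[OF c'(1)]] exI[of _ ?W] exI[of _ ?T]
        conjI opW c(4)) simp_all
qed

lemma vb_isomorphism_\<Psi>: "vb_isomorphism (tangent_bundle TM) VV \<Psi>"
proof -
  have "vb_base (tangent_bundle TM) = vb_base VV" "vb_total (tangent_bundle TM) = tangent_vectors TM"
    "vb_proj (tangent_bundle TM) = fst" "vb_add (tangent_bundle TM) = tv_add"
    "vb_scale (tangent_bundle TM) = tv_scale"
    by (simp_all add: tangent_bundle_def whitney_sum_def vertical_bundle_def)
  then show ?thesis
    using bij_\<Psi> vb_proj_VV_\<Psi> linear_\<Psi> smooth_\<Psi> smooth_inv_\<Psi>
    unfolding vb_isomorphism_def vb_fibre_tangent_bundle by simp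
qed

end

section \<open>Metrics: transport along an isomorphism and the isometry property\<close>

text \<open>Every fibre element of \<open>F\<close> is the image of one of \<open>E\<close>, where
  the axioms hold. Closure of the fibres of \<open>E\<close> is an explicit assumption because a
  \<open>vbundle\<close> is only a record of data; it is needed to apply the isometry to sums and
  multiples.\<close>

lemma vb_metric_transport:
  assumes a: "vb_metric E a" and iso: "vb_isomorphism E F \<Phi>"
    and isometry: "\<And>p e e'. \<lbrakk>p \<in> points (vb_base E); e \<in> vb_fibre E p; e' \<in> vb_fibre E p\<rbrakk> \<Longrightarrow>
      b (\<Phi> e) (\<Phi> e') = a e e'"
    and closed: "\<And>p e e' r. \<lbrakk>e \<in> vb_fibre E p; e' \<in> vb_fibre E p\<rbrakk> \<Longrightarrow>
      vb_add E e e' \<in> vb_fibre E p \<and> vb_scale E r e \<in> vb_fibre E p"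
  shows "vb_metric F b"
  unfolding vb_metric_def
proof (intro ballI allI)
  fix p y y' z r
  assume p: "p \<in> points (vb_base F)" and y: "y \<in> vb_fibre F p" "y' \<in> vb_fibre F p" "z \<in> vb_fibre F p"
  have base: "vb_base F = vb_base E" and bij: "bij_betw \<Phi> (vb_total E) (vb_total F)"
    and proj: "\<And>e. e \<in> vb_total E \<Longrightarrow> vb_proj F (\<Phi> e) = vb_proj E e"
    using iso by (simp_all add: vb_isomorphism_def)
  have pE: "p \<in> points (vb_base E)"
    using p base by simp
  have lin: "\<Phi> (vb_add E e e') = vb_add F (\<Phi> e) (\<Phi> e')" "\<Phi> (vb_scale E r e) = vb_scale F r (\<Phi> e)"
    if "e \<in> vb_fibre E p" "e' \<in> vb_fibre E p" for e e' r
    using iso pE that unfolding vb_isomorphism_def by blast+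
  have ex: "\<exists>e. e \<in> vb_fibre E p \<and> \<Phi> e = y" if y: "y \<in> vb_fibre F p" for y
  proof -
    have "y \<in> \<Phi> ` vb_total E"
      using y bij_betw_imp_surj_on[OF bij] by (simp add: vb_fibre_def)
    then obtain e where e: "e \<in> vb_total E" "\<Phi> e = y"
      by blast
    then show ?thesis
      using y proj[OF e(1)] by (auto simp: vb_fibre_def)
  qed
  obtain e e' f where e: "e \<in> vb_fibre E p" "\<Phi> e = y" and e': "e' \<in> vb_fibre E p" "\<Phi> e' = y'"
    and f: "f \<in> vb_fibre E p" "\<Phi> f = z"
    using ex y by metis
  note iso' = isometry[OF pE]
  have met: "a e f = a f e" "a (vb_add E e e') f = a e f + a e' f" "a (vb_scale E r e) f = r * a e f"
    "e \<noteq> vb_scale E 0 e \<Longrightarrow> 0 < a e e"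
    using a pE e(1) e'(1) f(1) unfolding vb_metric_def by blast+
  have "b y z = b z y"
    using met(1) iso'[OF e(1) f(1)] iso'[OF f(1) e(1)] by (simp add: e(2) f(2))
  moreover have "b (vb_add F y y') z = b y z + b y' z"
    using met(2) iso'[OF conjunct1[OF closed[OF e(1) e'(1)]] f(1)] iso'[OF e(1) f(1)] iso'[OF e'(1) f(1)]
    by (simp add: lin(1)[OF e(1) e'(1)] e(2) e'(2) f(2))
  moreover have "b (vb_scale F r y) z = r * b y z"
    using met(3) iso'[OF conjunct2[OF closed[OF e(1) e(1)]] f(1)] iso'[OF e(1) f(1)]
    by (simp add: lin(2)[OF e(1) e(1)] e(2) f(2))
  moreover have "0 < b y y" if "y \<noteq> vb_scale F 0 y"
  proof -
    \<comment> \<open>Linearity sends the zero vector of a fibre to the zero vector, so a nonzero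
      \<open>y\<close> has a nonzero preimage.\<close>
    have "e \<noteq> vb_scale E 0 e"
      using that lin(2)[OF e(1) e(1), of 0] e(2) by metis
    then show ?thesis
      using met(4) iso'[OF e(1) e(1)] by (simp add: e(2))
  qed
  ultimately show "b y z = b z y \<and> b (vb_add F y y') z = b y z + b y' z \<and>
      b (vb_scale F r y) z = r * b y z \<and> (y \<noteq> vb_scale F 0 y \<longrightarrow> 0 < b y y)"
    by blast
qed

theorem proposition3p5:
  fixes M :: "('m, 'e::euclidean_space) atlas"
    and g :: "('m, 'e) tvec \<Rightarrow> ('m, 'e) tvec \<Rightarrow> real"
    and nabla :: "('m, 'e) tvec \<Rightarrow> ('m \<Rightarrow> ('m, 'e) tvec) \<Rightarrow> ('m, 'e) tvec"
    and C :: "('m, 'e) tvec \<Rightarrow> ('m, 'e) tvec \<Rightarrow> (('m, 'e) tvec, 'e \<times> 'e) tvec"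
    and gS :: "(('m, 'e) tvec, 'e \<times> 'e) tvec \<Rightarrow> (('m, 'e) tvec, 'e \<times> 'e) tvec \<Rightarrow> real"
    and \<Psi> :: "(('m, 'e) tvec, 'e \<times> 'e) tvec \<Rightarrow>
               (('m, 'e) tvec, 'e \<times> 'e) tvec \<times> (('m, 'e) tvec, 'e \<times> 'e) tvec"
  assumes "smooth_manifold M"
    and "riemannian_metric M g"
    and "levi_civita M g nabla"
    and "connection_map M nabla C"
    and "sasaki_metric M g C gS"
    and "\<And>p u v w. \<lbrakk>p \<in> points M; u \<in> tangent_space M p; v \<in> tangent_space M p;
           w \<in> tangent_space M p\<rbrakk> \<Longrightarrow>
           \<Psi> (C u v +\<^sub>T vertical_lift M u w) = (vertical_lift M u v, vertical_lift M u w)"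
  shows "bundle_isometry
           (tangent_bundle (tangent_atlas M)) gS
           (whitney_sum (vertical_bundle M) (vertical_bundle M))
           (whitney_sum_metric (pullback_metric (vertical_part M) g)
              (pullback_metric (vertical_part M) g))
           \<Psi>"
proof -
  have "affine_connection M nabla"
    using assms(3) by (simp add: levi_civita_def)
  then interpret connection_splitting M nabla C \<Psi>
    using assms(1,4,6) by unfold_locales
  let ?E = "tangent_bundle TM"
  let ?h = "whitney_sum_metric (pullback_metric (vertical_part M) g) (pullback_metric (vertical_part M) g)"
  note fibre = vb_fibre_tangent_bundle[of TM]
  have gS: "vb_metric ?E gS"
    using assms(5) by (simp add: sasaki_metric_def)
  have gS_sym: "gS \<xi> \<zeta> = gS \<zeta> \<xi>" and gS_add: "gS (\<xi> +\<^sub>T \<xi>') \<zeta> = gS \<xi> \<zeta> + gS \<xi>' \<zeta>"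
    if "\<xi> \<in> tangent_space TM u" "\<xi>' \<in> tangent_space TM u" "\<zeta> \<in> tangent_space TM u" for \<xi> \<xi>' \<zeta> u
    using gS that tangent_spaceD(2)[OF that(1)] unfolding vb_metric_def fibre
    by (simp_all add: tangent_bundle_def)
  have sasaki: "gS (C u v) (C u w) = g v w" "gS (vertical_lift M u v) (vertical_lift M u w) = g v w"
    "gS (vertical_lift M u v) (C u w) = 0"
    if "u \<in> tangent_space M p" "v \<in> tangent_space M p" "w \<in> tangent_space M p" for p u v w
    using assms(5) that tangent_spaceD(2)[OF that(1)] unfolding sasaki_metric_def by blast+
  have isometry: "?h (\<Psi> \<xi>) (\<Psi> \<xi>') = gS \<xi> \<xi>'"
    if \<xi>: "\<xi> \<in> tangent_space TM u" "\<xi>' \<in> tangent_space TM u" for u \<xi> \<xi>'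
  proof -
    have u: "u \<in> tangent_space M (fst u)"
      using tangent_spaceD(2)[OF \<xi>(1)] by (simp add: points_tangent_atlas tangent_vectors_iff)
    obtain v w where 1: "v \<in> tangent_space M (fst u)" "w \<in> tangent_space M (fst u)"
      "\<xi> = C u v +\<^sub>T vertical_lift M u w"
      by (rule splitting_exists[OF u \<xi>(1)])
    obtain v' w' where 2: "v' \<in> tangent_space M (fst u)" "w' \<in> tangent_space M (fst u)"
      "\<xi>' = C u v' +\<^sub>T vertical_lift M u w'"
      by (rule splitting_exists[OF u \<xi>(2)])
    note H = horizontal_lift_in[OF u] and V = vertical_lift_in[OF atlas u]
    \<comment> \<open>\<open>vb_metric\<close> states additivity only in the first argument, so the
      second is expanded after swapping by symmetry. The last swaps restore the order in which the
      Sasaki conditions are stated; the two mixed terms then vanish.\<close>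
    have "gS \<xi> \<xi>' = gS (C u v) \<xi>' + gS (vertical_lift M u w) \<xi>'"
      unfolding 1(3) by (rule gS_add[OF H[OF 1(1)] V[OF 1(2)] \<xi>(2)])
    also have "gS (C u v) \<xi>' = gS (C u v') (C u v) + gS (vertical_lift M u w') (C u v)"
      unfolding gS_sym[OF H[OF 1(1)] \<xi>(2) \<xi>(2)] unfolding 2(3)
      by (rule gS_add[OF H[OF 2(1)] V[OF 2(2)] H[OF 1(1)]])
    also have "gS (C u v') (C u v) = gS (C u v) (C u v')"
      by (rule gS_sym[OF H[OF 2(1)] H[OF 1(1)] H[OF 1(1)]])
    also have "gS (vertical_lift M u w) \<xi>' =
        gS (C u v') (vertical_lift M u w) + gS (vertical_lift M u w') (vertical_lift M u w)"
      unfolding gS_sym[OF V[OF 1(2)] \<xi>(2) \<xi>(2)] unfolding 2(3)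
      by (rule gS_add[OF H[OF 2(1)] V[OF 2(2)] V[OF 1(2)]])
    also have "gS (C u v') (vertical_lift M u w) = gS (vertical_lift M u w) (C u v')"
      by (rule gS_sym[OF H[OF 2(1)] V[OF 1(2)] V[OF 1(2)]])
    also have "gS (vertical_lift M u w') (vertical_lift M u w) = gS (vertical_lift M u w) (vertical_lift M u w')"
      by (rule gS_sym[OF V[OF 2(2)] V[OF 1(2)] V[OF 1(2)]])
    finally have "gS \<xi> \<xi>' = g v v' + g w w'"
      by (simp add: sasaki(1)[OF u 1(1) 2(1)] sasaki(2)[OF u 1(2) 2(2)] sasaki(3)[OF u 2(2) 1(1)]
          sasaki(3)[OF u 1(2) 2(1)])
    \<comment> \<open>On the other side, \<open>vertical_part\<close> recovers \<open>v\<close>,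
      \<open>w\<close> and \<open>v'\<close>, \<open>w'\<close> from the vertical lifts, so
      \<open>?h\<close> evaluates to the same sum.\<close>
    then show ?thesis
      unfolding 1(3) 2(3) \<Psi>_eq[OF u 1(1,2)] \<Psi>_eq[OF u 2(1,2)]
      by (simp add: whitney_sum_metric_def pullback_metric_def vertical_part_lift[OF atlas u 1(1)]
          vertical_part_lift[OF atlas u 1(2)] vertical_part_lift[OF atlas u 2(1)]
          vertical_part_lift[OF atlas u 2(2)])
  qed
  have "vb_metric VV ?h"
  proof (rule vb_metric_transport[OF gS vb_isomorphism_\<Psi>])
    show "vb_add ?E e e' \<in> vb_fibre ?E u \<and> vb_scale ?E r e \<in> vb_fibre ?E u"
      if "e \<in> vb_fibre ?E u" "e' \<in> vb_fibre ?E u" for u e e' r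
      using tv_add_in[OF TM_atlas, of e u e'] tv_scale_in[OF TM_atlas, of e u r] that
      unfolding fibre by (simp add: tangent_bundle_def)
  qed (use isometry in \<open>simp add: fibre\<close>)
  then show ?thesis
    unfolding bundle_isometry_def using gS vb_isomorphism_\<Psi> isometry by (simp add: fibre)
qed

end
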